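(* Let $\Theta$ be an inner function on the unit disc $\mathbb{D}$. Then $\Theta$ satisfies the Sharp Invertibility Property (SIP) if and only if for every $0<\varepsilon<1$ the set $\{z\in\mathbb{D}: 0<|\Theta(z)|<1-\varepsilon\}$ is narrow.
   Context: $H^\infty$ is the algebra of bounded analytic functions on $\mathbb{D}$ with the sup norm $\|\cdot\|_\infty$. $\Theta\in H^\infty$ is inner if it has radial limits of modulus $1$ at almost every point of $\partial\mathbb{D}$. The quotient algebra $H^\infty/\Theta H^\infty$ carries the norm $\|[f]\|=\inf\{\|f+g\Theta\|_\infty: g\in H^\infty\}$. $\mathcal{Z}(\Theta)=\{z\in\mathbb{D}:\Theta(z)=0\}$. Sharp Invertibility Property (SIP): for every $\varepsilon>0$ there exists $\delta>0$ such that for every $f\in H^\infty$, the conditions $\|[f]\|\le 1$ and $\inf_{\mathcal{Z}(\Theta)}|f|\ge 1-\delta$ (vacuously true if $\mathcal{Z}(\Theta)=\emptyset$) imply that $[f]$ is invertible in $H^\infty/\Theta H^\infty$ and $\|[f]^{-1}\|\le 1+\varepsilon$. Pseudohyperbolic distance: $\rho(z,w)=\left|\frac{z-w}{1-\bar w z}\right|$. A set $S\subset\mathbb{D}$ is narrow if there exists $0<R<1$ such that $S$ contains no pseudohyperbolic disc $\{w\in\mathbb{D}:\rho(z,w)<R\}$, $z\in\mathbb{D}$, of pseudohyperbolic radius $R$. *)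

theory Defs
  imports "HOL-Analysis.Analysis" "HOL-Algebra.QuotRing"
begin

abbreviation unit_disc :: "complex set" where
  "unit_disc \<equiv> ball 0 1"

text \<open>
  Functions on the disc are total functions vanishing off the disc, so that equality in the
  ring is equality of functions on the disc.
\<close>

definition H_infty :: "(complex \<Rightarrow> complex) ring" where
  "H_infty =
    \<lparr>carrier = {f. f holomorphic_on unit_disc \<and> bounded (f ` unit_disc) \<and>
                   (\<forall>z. z \<notin> unit_disc \<longrightarrow> f z = 0)},
     mult = (\<lambda>f g z. f z * g z),
     one = (\<lambda>z. if z \<in> unit_disc then 1 else 0),
     zero = (\<lambda>z. 0),
     add = (\<lambda>f g z. f z + g z)\<rparr>"

definition sup_norm :: "(complex \<Rightarrow> complex) \<Rightarrow> real" where
  "sup_norm f = (SUP z\<in>unit_disc. cmod (f z))"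

definition inner_function :: "(complex \<Rightarrow> complex) \<Rightarrow> bool" where
  "inner_function \<Theta> \<longleftrightarrow> \<Theta> \<in> carrier H_infty \<and>
     (AE t in lebesgue_on {0..2 * pi}.
        \<exists>l. cmod l = 1 \<and> ((\<lambda>r::real. \<Theta> (of_real r * cis t)) \<longlongrightarrow> l) (at_left 1))"

definition zero_set :: "(complex \<Rightarrow> complex) \<Rightarrow> complex set" where
  "zero_set \<Theta> = {z \<in> unit_disc. \<Theta> z = 0}"

definition quot_class :: "(complex \<Rightarrow> complex) \<Rightarrow> (complex \<Rightarrow> complex) \<Rightarrow> (complex \<Rightarrow> complex) set" where
  "quot_class \<Theta> f = (PIdl\<^bsub>H_infty\<^esub> \<Theta>) +>\<^bsub>H_infty\<^esub> f"

definition quot_algebra :: "(complex \<Rightarrow> complex) \<Rightarrow> (complex \<Rightarrow> complex) set ring" where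
  "quot_algebra \<Theta> = H_infty Quot (PIdl\<^bsub>H_infty\<^esub> \<Theta>)"

text \<open>The argument is a coset; lemma \<open>quot_norm_quot_class\<close> gives the formula for \<open>[f]\<close>.\<close>

definition quot_norm :: "(complex \<Rightarrow> complex) set \<Rightarrow> real" where
  "quot_norm C = (INF h\<in>C. sup_norm h)"

definition SIP :: "(complex \<Rightarrow> complex) \<Rightarrow> bool" where
  "SIP \<Theta> \<longleftrightarrow>
     (\<forall>\<epsilon>>0. \<exists>\<delta>>0. \<forall>f \<in> carrier H_infty.
        quot_norm (quot_class \<Theta> f) \<le> 1 \<longrightarrow>
        (zero_set \<Theta> \<noteq> {} \<longrightarrow> (INF z\<in>zero_set \<Theta>. cmod (f z)) \<ge> 1 - \<delta>) \<longrightarrow>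
        quot_class \<Theta> f \<in> Units (quot_algebra \<Theta>) \<and>
        quot_norm (inv\<^bsub>quot_algebra \<Theta>\<^esub> (quot_class \<Theta> f)) \<le> 1 + \<epsilon>)"

definition pseudohyp_dist :: "complex \<Rightarrow> complex \<Rightarrow> real" where
  "pseudohyp_dist z w = cmod ((z - w) / (1 - cnj w * z))"

definition narrow :: "complex set \<Rightarrow> bool" where
  "narrow S \<longleftrightarrow>
     (\<exists>R. 0 < R \<and> R < 1 \<and>
        \<not> (\<exists>z \<in> unit_disc. {w \<in> unit_disc. pseudohyp_dist z w < R} \<subseteq> S))"

lemma bounded_image_mult:
  fixes f g :: "complex \<Rightarrow> complex"
  assumes "bounded (f ` S)" "bounded (g ` S)"
  shows "bounded ((\<lambda>z. f z * g z) ` S)"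
proof -
  obtain A where A: "\<And>z. z \<in> S \<Longrightarrow> norm (f z) \<le> A" using assms(1) by (auto simp: bounded_iff)
  obtain B where B: "\<And>z. z \<in> S \<Longrightarrow> norm (g z) \<le> B" using assms(2) by (auto simp: bounded_iff)
  have "norm (f z * g z) \<le> \<bar>A\<bar> * \<bar>B\<bar>" if "z \<in> S" for z
    unfolding norm_mult using A[OF that] B[OF that] by (intro mult_mono) auto
  then show ?thesis by (auto simp: bounded_iff)
qed

lemma bounded_image_add:
  fixes f g :: "complex \<Rightarrow> complex"
  assumes "bounded (f ` S)" "bounded (g ` S)"
  shows "bounded ((\<lambda>z. f z + g z) ` S)"
  using assms by (rule bounded_plus_comp)

lemma cring_H_infty: "cring H_infty"
proof (rule cringI)
  show "abelian_group H_infty"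
  proof (rule abelian_groupI)
    fix f assume f: "f \<in> carrier H_infty"
    then have "(\<lambda>z. - f z) \<in> carrier H_infty"
      by (auto simp: H_infty_def bounded_iff intro!: holomorphic_intros)
    then show "\<exists>g\<in>carrier H_infty. g \<oplus>\<^bsub>H_infty\<^esub> f = \<zero>\<^bsub>H_infty\<^esub>"
      by (rule bexI[rotated]) (simp add: H_infty_def)
  qed (auto simp: H_infty_def bounded_image_add algebra_simps bounded_iff[of "{0}"]
         image_constant_conv intro!: holomorphic_intros)
  show "comm_monoid H_infty"
  proof (rule comm_monoidI)
    have "(\<lambda>z. if z \<in> unit_disc then 1 else 0::complex) holomorphic_on unit_disc"
      by (rule holomorphic_transform[of "\<lambda>_. 1"]) auto
    then show "\<one>\<^bsub>H_infty\<^esub> \<in> carrier H_infty"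
      by (auto simp: H_infty_def bounded_iff)
  qed (auto simp: H_infty_def bounded_image_mult fun_eq_iff intro!: holomorphic_intros)
qed (auto simp: H_infty_def algebra_simps)

lemma ideal_PIdl_H_infty: "\<Theta> \<in> carrier H_infty \<Longrightarrow> ideal (PIdl\<^bsub>H_infty\<^esub> \<Theta>) H_infty"
  by (rule cring.cgenideal_ideal[OF cring_H_infty])

lemma quot_norm_quot_class:
  "quot_norm (quot_class \<Theta> f) = Inf {sup_norm (\<lambda>z. f z + g z * \<Theta> z) | g. g \<in> carrier H_infty}"
proof -
  have "sup_norm ` quot_class \<Theta> f = {sup_norm (\<lambda>z. f z + g z * \<Theta> z) | g. g \<in> carrier H_infty}"
    by (auto simp: quot_class_def a_r_coset_def' cgenideal_def H_infty_def add.commute image_iff)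
      (auto simp: add.commute)
  then show ?thesis
    by (simp add: quot_norm_def)
qed

end

theory Submission
  imports Defs "HOL-Complex_Analysis.Complex_Analysis"
begin

text \<open>
  If \<open>f g = 1 + h \<Theta>\<close> with \<open>g\<close> nearly contractive, then \<open>Re (h \<Theta>)\<close> is at most a small \<open>\<epsilon>/2\<close>, so
  \<open>h / (\<epsilon> - h \<Theta>)\<close> is bounded by \<open>1\<close> because \<open>\<Theta>\<close> is inner. At a zero of \<open>f\<close> this forces
  \<open>|\<Theta>| \<ge> 1/(1 + \<epsilon>)\<close>. Taking for \<open>f\<close> a disc automorphism that vanishes at the centre of a large
  pseudohyperbolic disc without zeros of \<open>\<Theta>\<close> shows that the property implies narrowness.

  Conversely, narrowness forces \<open>|\<Theta>|\<close> to be close to \<open>1\<close> far from its zeros, so that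
  \<open>max |f| |\<Theta>| \<ge> 1 - \<eta>\<close> throughout the disc, and one needs a corona theorem for such data with
  \<open>\<parallel>g\<parallel> \<le> 1 + \<epsilon>\<close>. By a lurking isometry argument it reduces to the Hilbert space inequality
  \<open>(1 - \<epsilon>) \<parallel>p\<parallel>\<^sup>2 \<le> \<parallel>f(S)\<^sup>* p\<parallel>\<^sup>2 + C \<parallel>\<Theta>(S)\<^sup>* p\<parallel>\<^sup>2\<close> on the Hardy space, where \<open>S\<close> is the shift. There
  \<open>\<parallel>p\<parallel>\<^sup>2 - \<parallel>f(S)\<^sup>* p\<parallel>\<^sup>2\<close> is the inner product of \<open>p\<close> with \<open>q = p - f f(S)\<^sup>* p\<close>. The Littlewood-Paley formula
  turns it into an area integral of \<open>p' cnj q'\<close>. A function close to the model space of an inner function has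
  little energy where that function is close to \<open>1\<close> in modulus; so \<open>p'\<close> is negligible where
  \<open>|\<Theta>|\<close> is near \<open>1\<close>, and \<open>q'\<close> where \<open>|f|\<close> is.
\<close>

section \<open>The Littlewood-Paley formula\<close>

text \<open>The obstacle is sharpness: the norm bound must tend to 1 with \<open>\<eta>\<close>, so
  every localisation to a region where a modulus is near 1 has to cost o(1). A cutoff by a single
  power of \<open>|T|\<close> leaves an error of order 1. Spreading it over the powers
  \<open>|T|^2, ..., |T|^(2M)\<close> with harmonic weights lowers the error to order
  \<open>1 / sqrt (harm M)\<close>, and \<open>M\<close> is tied to the corona data by
  \<open>\<eta> = 1 / (4 * M)\<close>. Boundary values and operators on the Hardy space are avoided.
  The function \<open>p\<close> ranges over finite sums of Szego kernels, on which the adjoint of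
  multiplication by \<open>f\<close> acts explicitly: the kernel at \<open>a\<close> is multiplied
  by \<open>cnj (f a)\<close>. After a dilation all functions are holomorphic past the closed disc.
  The resulting inequality is a positivity condition on finitely many points, so the lurking
  isometry lives in finite dimension; normal families and the identity theorem then recover the
  whole disc.\<close>

definition circle_mean :: "(complex \<Rightarrow> real) \<Rightarrow> real" where
  "circle_mean W = integral {0..2*pi} (\<lambda>t. W (cis t)) / (2*pi)"

text \<open>The radial weight is chosen such that \<open>|z|\<^bsup>2(n-1)\<^esup>\<close> has integral \<open>1/n\<^sup>2\<close>. At \<open>r = 0\<close> it vanishes,
  since \<open>ln 0 = 0\<close>.\<close>

definition lp_int :: "(complex \<Rightarrow> real) \<Rightarrow> real" where
  "lp_int W = integral (cbox (0,0) (1,2*pi)) (\<lambda>(r,t). - (2/pi) * (r * ln r) * W (of_real r * cis t))"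

lemma continuous_on_r_ln: "continuous_on {0..} (\<lambda>r::real. r * ln r)"
  unfolding continuous_on_def
proof
  fix x :: real assume "x \<in> {0..}"
  show "((\<lambda>r. r * ln r) \<longlongrightarrow> x * ln x) (at x within {0..})"
  proof (cases "x = 0")
    case True
    have "((\<lambda>r::real. r * ln r) \<longlongrightarrow> 0) (at_right 0)" by real_asymp
    then have "((\<lambda>r::real. r * ln r) \<longlongrightarrow> 0) (at 0 within {0..})"
      by (metis at_within_Ici_at_right)
    then show ?thesis using True by simp
  next
    case False
    then have "isCont (\<lambda>r. r * ln r) x" by (intro continuous_intros) auto
    then have "continuous (at x within {0..}) (\<lambda>r. r * ln r)"
      by (rule continuous_at_imp_continuous_at_within)
    then show ?thesis by (simp add: continuous_within)
  qed
qed

lemma continuous_on_polar: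
  assumes "continuous_on (cball 0 1) W"
  shows "continuous_on (cbox (0,0) (1,2*pi)) (\<lambda>(r,t). W (of_real r * cis t))"
proof -
  have "(\<lambda>(r,t). of_real r * cis t) ` cbox (0::real,0::real) (1,2*pi) \<subseteq> cball 0 1"
    by (auto simp: norm_mult cbox_Pair_eq)
  then have "continuous_on (cbox (0,0) (1,2*pi)) (\<lambda>x. W ((\<lambda>(r,t). of_real r * cis t) x))"
    by (intro continuous_on_compose2[OF assms])
      (auto simp: case_prod_unfold intro!: continuous_intros)
  then show ?thesis by (simp add: case_prod_unfold)
qed

lemma continuous_on_lp:
  assumes "continuous_on (cball 0 1) W"
  shows "continuous_on (cbox (0,0) (1,2*pi))
    (\<lambda>(r,t). - (2/pi) * (r * ln r) * W (of_real r * cis t) :: real)"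
proof -
  have "continuous_on (cbox (0::real,0::real) (1,2*pi)) (\<lambda>x. fst x * ln (fst x))"
    by (rule continuous_on_compose2[OF continuous_on_r_ln])
       (auto intro!: continuous_intros simp: cbox_Pair_eq)
  from continuous_on_mult[OF continuous_on_mult[OF continuous_on_const[of _ "- (2/pi)"] this]
      continuous_on_polar[OF assms]]
  show ?thesis by (simp add: case_prod_unfold)
qed

lemma lp_integrable:
  assumes "continuous_on (cball 0 1) W"
  shows "(\<lambda>(r,t). - (2/pi) * (r * ln r) * W (of_real r * cis t) :: real) integrable_on cbox (0,0) (1,2*pi)"
  by (rule integrable_continuous[OF continuous_on_lp[OF assms]])

lemma lp_int_add:
  assumes "continuous_on (cball 0 1) V" "continuous_on (cball 0 1) W"
  shows "lp_int (\<lambda>z. V z + W z) = lp_int V + lp_int W"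
  unfolding lp_int_def
  by (subst integral_add[OF lp_integrable[OF assms(1)] lp_integrable[OF assms(2)], symmetric])
     (simp add: case_prod_unfold algebra_simps)

lemma lp_int_cmult: "lp_int (\<lambda>z. c * W z) = c * lp_int W"
  unfolding lp_int_def
  by (subst integral_mult_right[symmetric]) (simp add: case_prod_unfold algebra_simps)

lemma lp_int_mono:
  assumes "continuous_on (cball 0 1) V" "continuous_on (cball 0 1) W"
    and "\<And>z. cmod z \<le> 1 \<Longrightarrow> V z \<le> W z"
  shows "lp_int V \<le> lp_int W"
  unfolding lp_int_def
proof (rule integral_le[OF lp_integrable[OF assms(1)] lp_integrable[OF assms(2)]])
  fix x :: "real \<times> real" assume x: "x \<in> cbox (0,0) (1,2*pi)"
  obtain r t where rt: "x = (r,t)" by force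
  have r: "0 \<le> r" "r \<le> 1" using x by (auto simp: rt cbox_Pair_eq)
  have "r * ln r \<le> 0" using r by (cases "r = 0") (auto simp: mult_nonneg_nonpos)
  then have "- (2/pi) * (r * ln r) \<ge> 0" by (auto simp: mult_nonneg_nonpos field_simps)
  moreover have "V (of_real r * cis t) \<le> W (of_real r * cis t)" using r by (intro assms) (simp add: norm_mult)
  ultimately show "(case x of (r,t) \<Rightarrow> - (2/pi) * (r * ln r) * V (of_real r * cis t)) \<le>
    (case x of (r,t) \<Rightarrow> - (2/pi) * (r * ln r) * W (of_real r * cis t))"
    unfolding rt prod.case by (rule mult_left_mono[rotated])
qed

lemma lp_int_sum:
  assumes "finite I" "\<And>i. i \<in> I \<Longrightarrow> continuous_on (cball 0 1) (W i)"
  shows "lp_int (\<lambda>z. \<Sum>i\<in>I. W i z) = (\<Sum>i\<in>I. lp_int (W i))"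
  using assms
proof (induction I rule: finite_induct)
  case empty
  show ?case by (simp add: lp_int_def case_prod_unfold)
next
  case (insert i I)
  then show ?case by (simp add: lp_int_add continuous_on_sum)
qed

lemma circle_integrable:
  assumes "continuous_on (sphere 0 1) W"
  shows "(\<lambda>t. W (cis t) :: real) integrable_on {0..2*pi}"
  by (intro integrable_continuous_real continuous_on_compose2[OF assms]) (auto intro!: continuous_intros)

lemma circle_mean_add:
  assumes "continuous_on (sphere 0 1) V" "continuous_on (sphere 0 1) W"
  shows "circle_mean (\<lambda>z. V z + W z) = circle_mean V + circle_mean W"
  unfolding circle_mean_def
  by (simp add: integral_add[OF circle_integrable[OF assms(1)] circle_integrable[OF assms(2)]] add_divide_distrib)

lemma circle_mean_cmult: "circle_mean (\<lambda>z. c * W z) = c * circle_mean W"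
  unfolding circle_mean_def by simp

lemma circle_mean_mono:
  assumes "continuous_on (sphere 0 1) V" "continuous_on (sphere 0 1) W"
    and "\<And>z. cmod z = 1 \<Longrightarrow> V z \<le> W z"
  shows "circle_mean V \<le> circle_mean W"
  unfolding circle_mean_def
  by (intro divide_right_mono integral_le circle_integrable assms) auto

lemma circle_mean_cong:
  assumes "\<And>z. cmod z = 1 \<Longrightarrow> V z = W z"
  shows "circle_mean V = circle_mean W"
  unfolding circle_mean_def using assms by simp

lemma circle_mean_sum:
  assumes "finite I" "\<And>i. i \<in> I \<Longrightarrow> continuous_on (sphere 0 1) (W i)"
  shows "circle_mean (\<lambda>z. \<Sum>i\<in>I. W i z) = (\<Sum>i\<in>I. circle_mean (W i))"
  using assms
proof (induction I rule: finite_induct)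
  case empty
  show ?case by (simp add: circle_mean_def)
next
  case (insert i I)
  then show ?case by (simp add: circle_mean_add continuous_on_sum)
qed

section \<open>Parseval for polynomials and passage to functions holomorphic past the closed
  disc\<close>

lemma has_integral_cis:
  "((\<lambda>t. cis (of_int k * t)) has_integral (if k = 0 then of_real (2*pi) else 0)) {0..2*pi}"
proof (cases "k = 0")
  case True
  then show ?thesis using has_integral_const_real[of "1::complex" 0 "2*pi"] by (simp add: scaleR_conv_of_real)
next
  case False
  have "((\<lambda>t. cis (of_int k * t)) has_integral
     (cis (of_int k * (2*pi)) / (\<i> * of_int k) - cis (of_int k * 0) / (\<i> * of_int k))) {0..2*pi}"
  proof (rule fundamental_theorem_of_calculus)
    fix t :: real
    have "((\<lambda>z. exp (\<i> * of_int k * z) / (\<i> * of_int k)) has_field_derivative exp (\<i> * of_int k * of_real t))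
      (at (of_real t))"
      using False by (auto intro!: derivative_eq_intros)
    from has_vector_derivative_real_field[OF this]
    show "((\<lambda>t. cis (of_int k * t) / (\<i> * of_int k)) has_vector_derivative cis (of_int k * t)) (at t within {0..2*pi})"
      by (simp add: cis_conv_exp mult.assoc has_vector_derivative_at_within)
  qed simp
  moreover have "cis (of_int k * (2*pi)) = 1"
    using cos_int_2pin[of k] sin_int_2pin[of k] by (simp add: complex_eq_iff mult_ac)
  ultimately show ?thesis using False by simp
qed

text \<open>Orthogonality of the characters kills the off-diagonal terms. The radius is kept general
  because \<open>lp_int_poly\<close> integrates over it.\<close>

lemma poly_circle_norm_integral:
  fixes c :: "nat \<Rightarrow> complex"
  shows "integral {0..2*pi} (\<lambda>t. (cmod (\<Sum>n<N. c n * (of_real r * cis t)^n))\<^sup>2)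
    = 2*pi * (\<Sum>n<N. (cmod (c n))\<^sup>2 * r^(2*n))"
proof -
  let ?k = "\<lambda>n m t. c n * cnj (c m) * of_real (r^(n+m)) * cis (of_int (int n - int m) * t)"
  have expand: "of_real ((cmod (\<Sum>n<N. c n * (of_real r * cis t)^n))\<^sup>2) = (\<Sum>n<N. \<Sum>m<N. ?k n m t)" for t
  proof -
    have "(cis t)^n * cnj ((cis t)^m) = cis (of_int (int n - int m) * t)" for n m
      by (simp only: complex_cnj_power cis_cnj Complex.DeMoivre cis_mult) (simp add: algebra_simps)
    then have e: "c n * (of_real r * cis t)^n * cnj (c m * (of_real r * cis t)^m) = ?k n m t" for n m
      by (simp add: power_mult_distrib power_add algebra_simps)
    show ?thesis
      unfolding complex_norm_square cnj_sum sum_product e ..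
  qed
  have cis: "((\<lambda>t. cis (of_int (int n - int m) * t)) has_integral (if m = n then of_real (2*pi) else 0)) {0..2*pi}"
    for n m
    using has_integral_cis[of "int n - int m"] by (cases "m = n") simp_all
  have "((\<lambda>t. \<Sum>m<N. ?k n m t) has_integral of_real (2*pi * ((cmod (c n))\<^sup>2 * r^(2*n)))) {0..2*pi}"
    if "n < N" for n
  proof -
    have "((\<lambda>t. \<Sum>m<N. ?k n m t) has_integral
        (\<Sum>m<N. c n * cnj (c m) * of_real (r^(n+m)) * (if m = n then of_real (2*pi) else 0))) {0..2*pi}"
      by (intro has_integral_sum has_integral_mult_right cis) auto
    moreover have "(\<Sum>m<N. c n * cnj (c m) * of_real (r^(n+m)) * (if m = n then of_real (2*pi) else 0))
        = (\<Sum>m<N. if m = n then c n * cnj (c n) * of_real (r^(n+n)) * of_real (2*pi) else 0)"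
      by (rule sum.cong[OF refl]) simp
    moreover have "c n * cnj (c n) * of_real (r^(n+n)) * of_real (2*pi) = of_real (2*pi * ((cmod (c n))\<^sup>2 * r^(2*n)))"
      unfolding complex_norm_square[symmetric] mult_2 by simp
    moreover have "(\<Sum>m<N. if m = n then X else 0) = X" for X :: complex using that by simp
    ultimately show ?thesis by (simp only:)
  qed
  then have "((\<lambda>t. \<Sum>n<N. \<Sum>m<N. ?k n m t) has_integral
     (\<Sum>n<N. of_real (2*pi * ((cmod (c n))\<^sup>2 * r^(2*n))))) {0..2*pi}"
    by (intro has_integral_sum) auto
  then have "((\<lambda>t. complex_of_real ((cmod (\<Sum>n<N. c n * (of_real r * cis t)^n))\<^sup>2)) has_integral
     of_real (2*pi * (\<Sum>n<N. (cmod (c n))\<^sup>2 * r^(2*n)))) {0..2*pi}"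
    by (simp only: expand sum_distrib_left of_real_sum)
  from has_integral_linear[OF this bounded_linear_Re]
  show ?thesis by (intro integral_unique) (simp add: o_def)
qed

text \<open>The factor -4 is the radial weight of \<open>lp_int\<close> multiplied by the angular
  length 2 pi. The value \<open>1 / n^2\<close> cancels the \<open>n^2\<close> produced by
  differentiating \<open>z^n\<close>.\<close>

lemma has_integral_r_ln:
  assumes "n > 0"
  shows "((\<lambda>r::real. - 4 * (r * ln r) * r^(2*(n-1))) has_integral 1 / (real n)\<^sup>2) {0..1}"
proof -
  obtain m where m: "n = Suc m" using assms by (cases n) auto
  \<comment> \<open>Integration by parts gives this antiderivative. It is continuous at 0 by
    \<open>continuous_on_r_ln\<close>, while the derivative is taken only in the open
    interval.\<close>
  let ?G = "\<lambda>r::real. - (2 / real n) * (r * ln r) * r^(2*m+1) + r^(2*m+2) / (real n)\<^sup>2"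
  have "((\<lambda>r::real. - 4 * (r * ln r) * r^(2*m)) has_integral (?G 1 - ?G 0)) {0..1}"
  proof (rule fundamental_theorem_of_calculus_interior)
    show "continuous_on {0..1} ?G"
      by (intro continuous_intros continuous_on_subset[OF continuous_on_r_ln]) (use assms in auto)
    fix r :: real assume r: "r \<in> {0<..<1}"
    have "((\<lambda>r::real. - (2 / real n) * (ln r * r^(2*m+2)) + r^(2*m+2) / (real n)\<^sup>2) has_real_derivative
        - (2 / real n) * (inverse r * r^(2*m+2) + ln r * (real (2*m+2) * r^(2*m+1)))
        + real (2*m+2) * r^(2*m+1) / (real n)\<^sup>2) (at r)"
    proof -
      have P: "((\<lambda>r. r^(2*m+2)) has_real_derivative real (2*m+2) * r^(2*m+1)) (at r)"
        using DERIV_pow[of "2*m+2" r] by simp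
      have "((\<lambda>r. ln r * r^(2*m+2)) has_real_derivative inverse r * r^(2*m+2) + real (2*m+2) * r^(2*m+1) * ln r) (at r)"
        using r by (intro DERIV_mult DERIV_ln P) auto
      from DERIV_add[OF DERIV_cmult[OF this, of "- (2/real n)"] DERIV_cdivide[OF P, of "(real n)\<^sup>2"]]
      show ?thesis by (simp only: mult.commute[of "ln r"])
    qed
    moreover have "inverse r * r^(2*m+2) = r^(2*m+1)" using r by (simp add: field_simps)
    moreover have "real (2*m+2) = 2 * real n" by (simp add: m)
    ultimately have "((\<lambda>r::real. - (2 / real n) * (ln r * r^(2*m+2)) + r^(2*m+2) / (real n)\<^sup>2) has_real_derivative
        - (2 / real n) * (r^(2*m+1) + ln r * (2 * real n * r^(2*m+1)))
        + 2 * real n * r^(2*m+1) / (real n)\<^sup>2) (at r)" by (simp only:)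
    moreover have "- (2 / real n) * (r^(2*m+1) + ln r * (2 * real n * r^(2*m+1)))
        + 2 * real n * r^(2*m+1) / (real n)\<^sup>2 = - 4 * (r * ln r) * r^(2*m)"
      using assms by (simp add: field_simps power2_eq_square)
    moreover have "(\<lambda>r::real. - (2 / real n) * (ln r * r^(2*m+2)) + r^(2*m+2) / (real n)\<^sup>2) = ?G"
      by (simp add: fun_eq_iff algebra_simps)
    ultimately show "(?G has_vector_derivative - 4 * (r * ln r) * r^(2*m)) (at r)"
      by (simp only: has_real_derivative_iff_has_vector_derivative)
  qed simp
  moreover have "?G 1 - ?G 0 = 1 / (real n)\<^sup>2" using assms by simp
  ultimately show ?thesis by (simp add: m)
qed

lemma lp_int_poly:
  "lp_int (\<lambda>z. (cmod (\<Sum>n<N. c n * z^n))\<^sup>2) = (\<Sum>n<N. (cmod (c n))\<^sup>2 / (real (Suc n))\<^sup>2)"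
proof -
  let ?W = "\<lambda>z. (cmod (\<Sum>n<N. c n * z^n))\<^sup>2"
  have "lp_int ?W = integral {0..1} (\<lambda>r. integral {0..2*pi} (\<lambda>t. - (2/pi) * (r * ln r) * ?W (of_real r * cis t)))"
    unfolding lp_int_def
    by (subst integral_prod_continuous[OF continuous_on_lp]) (auto intro!: continuous_intros)
  also have "\<dots> = integral {0..1} (\<lambda>r. \<Sum>n<N. (cmod (c n))\<^sup>2 * (- 4 * (r * ln r) * r^(2*n)))"
    unfolding integral_mult_right poly_circle_norm_integral
    by (simp add: sum_distrib_left sum_negf mult_ac)
  also have "\<dots> = (\<Sum>n<N. (cmod (c n))\<^sup>2 * (1 / (real (Suc n))\<^sup>2))"
  proof (intro integral_unique has_integral_sum has_integral_mult_right)
    fix n show "((\<lambda>r. - 4 * (r * ln r) * r ^ (2 * n)) has_integral 1 / (real (Suc n))\<^sup>2) {0..1}"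
      using has_integral_r_ln[of "Suc n"] by simp
  qed simp
  finally show ?thesis by simp
qed

lemma circle_mean_poly:
  "circle_mean (\<lambda>z. (cmod (\<Sum>n<N. c n * z^n))\<^sup>2) = (\<Sum>n<N. (cmod (c n))\<^sup>2)"
  unfolding circle_mean_def
  using poly_circle_norm_integral[where r = 1 and c = c and N = N, unfolded of_real_1 mult_1 power_one mult_1_right]
  by (simp only:) simp

lemma holomorphic_imp_powser_uniform_limit:
  assumes "f holomorphic_on ball 0 R" "R > 1"
  shows "uniform_limit (cball 0 1) (\<lambda>N z. \<Sum>n<N. (deriv ^^ n) f 0 / fact n * z^n) f sequentially"
proof -
  let ?a = "\<lambda>n. (deriv ^^ n) f 0 / fact n"
  have sums: "(\<lambda>n. ?a n * z^n) sums f z" if "cmod z < R" for z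
    using holomorphic_power_series[OF assms(1), of z] that by simp
  \<comment> \<open>Convergence at a point beyond the unit circle gives a convergence radius
    strictly above 1, hence uniformity on the closed disc.\<close>
  obtain \<rho> where \<rho>: "1 < \<rho>" "\<rho> < R" using dense[OF assms(2)] by blast
  have "ereal \<rho> \<le> conv_radius ?a"
    using sums_summable[OF sums[of "of_real \<rho>"]] \<rho> conv_radius_geI[of ?a "of_real \<rho>"] by simp
  then have "ereal 1 < conv_radius ?a" using \<rho>(1) less_le_trans[of "ereal 1" "ereal \<rho>"] by simp
  from powser_uniform_limit[OF this, of 0]
  have "uniform_limit (cball 0 1) (\<lambda>N z. \<Sum>n<N. ?a n * z^n) (\<lambda>z. \<Sum>n. ?a n * z^n) sequentially"
    by simp
  note lim = this
  have eq: "(\<Sum>n. ?a n * z^n) = f z" if "z \<in> cball 0 1" for z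
    using sums_unique[OF sums[of z]] that assms(2) by simp
  show ?thesis
    by (rule uniform_limit_cong'[THEN iffD1, OF refl eq lim])
qed

lemma holomorphic_continuous_cball:
  "f holomorphic_on ball 0 R \<Longrightarrow> R > 1 \<Longrightarrow> continuous_on (cball 0 1) f"
  by (rule continuous_on_subset[OF holomorphic_on_imp_continuous_on]) auto

lemma uniform_limit_norm_square:
  assumes "uniform_limit S f g F" "bounded (g ` S)"
  shows "uniform_limit S (\<lambda>n z. (cmod (f n z))\<^sup>2) (\<lambda>z. (cmod (g z))\<^sup>2) F"
  unfolding power2_eq_square
  by (intro uniform_lim_mult uniform_limit_norm[OF assms(1)])
    (use assms(2) in \<open>auto simp: bounded_iff\<close>)

text \<open>The weight has total mass 1; this is the case of a constant polynomial.\<close>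

lemma lp_int_const: "lp_int (\<lambda>_. c) = c"
  using lp_int_cmult[of c "\<lambda>_. 1"] lp_int_poly[of "\<lambda>_. 1" 1] by simp

lemma circle_mean_const: "circle_mean (\<lambda>_. c) = c"
  by (simp add: circle_mean_def)

text \<open>Monotonicity together with total mass 1 transports a uniform error unchanged to the
  integrals.\<close>

lemma lp_int_uniform_limit:
  assumes "uniform_limit (cball 0 1) W V sequentially" "\<And>n. continuous_on (cball 0 1) (W n)"
  shows "(\<lambda>n. lp_int (W n)) \<longlonglongrightarrow> lp_int V"
proof (rule tendstoI)
  fix e :: real assume e: "e > 0"
  have V: "continuous_on (cball 0 1) V"
    by (rule uniform_limit_theorem[OF _ assms(1)]) (auto simp: assms(2))
  have "\<forall>\<^sub>F n in sequentially. \<forall>z\<in>cball 0 1. dist (W n z) (V z) < e/2"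
    using uniform_limitD[OF assms(1), of "e/2"] e by simp
  then show "\<forall>\<^sub>F n in sequentially. dist (lp_int (W n)) (lp_int V) < e"
  proof eventually_elim
    case (elim n)
    have d: "\<bar>W n z - V z\<bar> \<le> e/2" if "cmod z \<le> 1" for z
      using elim[THEN bspec, of z] that by (simp add: dist_real_def)
    have d': "W n z \<le> V z + e/2" "V z \<le> W n z + e/2" if "cmod z \<le> 1" for z
      using d[OF that] by linarith+
    have "lp_int (W n) \<le> lp_int (\<lambda>z. V z + e/2)"
      by (intro lp_int_mono assms V continuous_intros d')
    moreover have "lp_int V \<le> lp_int (\<lambda>z. W n z + e/2)"
      by (intro lp_int_mono assms V continuous_intros d')
    ultimately show ?case
      using e by (simp add: lp_int_add assms V lp_int_const dist_real_def)
  qed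
qed

lemma circle_mean_uniform_limit:
  assumes "uniform_limit (cball 0 1) W V sequentially" "\<And>n. continuous_on (cball 0 1) (W n)"
  shows "(\<lambda>n. circle_mean (W n)) \<longlonglongrightarrow> circle_mean V"
proof (rule tendstoI)
  fix e :: real assume e: "e > 0"
  have V: "continuous_on (sphere 0 1) V"
    by (rule continuous_on_subset[OF uniform_limit_theorem[OF _ assms(1)]]) (auto simp: assms(2))
  have W: "continuous_on (sphere 0 1) (W n)" for n
    by (rule continuous_on_subset[OF assms(2)]) auto
  have "\<forall>\<^sub>F n in sequentially. \<forall>z\<in>cball 0 1. dist (W n z) (V z) < e/2"
    using uniform_limitD[OF assms(1), of "e/2"] e by simp
  then show "\<forall>\<^sub>F n in sequentially. dist (circle_mean (W n)) (circle_mean V) < e"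
  proof eventually_elim
    case (elim n)
    have d: "\<bar>W n z - V z\<bar> \<le> e/2" if "cmod z = 1" for z
      using elim[THEN bspec, of z] that by (simp add: dist_real_def)
    have d': "W n z \<le> V z + e/2" "V z \<le> W n z + e/2" if "cmod z = 1" for z
      using d[OF that] by linarith+
    have "circle_mean (W n) \<le> circle_mean (\<lambda>z. V z + e/2)"
      by (intro circle_mean_mono W V continuous_intros d')
    moreover have "circle_mean V \<le> circle_mean (\<lambda>z. W n z + e/2)"
      by (intro circle_mean_mono W V continuous_intros d')
    ultimately show ?case
      using e by (simp add: circle_mean_add W V circle_mean_const dist_real_def)
  qed
qed

text \<open>On partial sums both sides are sums of squared coefficients, and the coefficient of
  \<open>z^n\<close> in \<open>deriv f\<close> is \<open>n + 1\<close> times that of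
  \<open>z^(n+1)\<close> in \<open>f\<close>, which the weight undoes. Uniform convergence on the
  closed disc passes this to the limit.\<close>

theorem littlewood_paley:
  assumes f: "f holomorphic_on ball 0 R" and R: "R > 1"
  shows "circle_mean (\<lambda>z. (cmod (f z))\<^sup>2) = (cmod (f 0))\<^sup>2 + lp_int (\<lambda>z. (cmod (deriv f z))\<^sup>2)"
proof -
  let ?a = "\<lambda>n. (deriv ^^ n) f 0 / fact n" and ?b = "\<lambda>n. (deriv ^^ n) (deriv f) 0 / fact n"
  have f': "deriv f holomorphic_on ball 0 R" using f by (intro holomorphic_deriv) auto
  have bd: "bounded (g ` cball 0 1)" if "g holomorphic_on ball 0 R" for g :: "complex \<Rightarrow> complex"
    by (intro compact_imp_bounded compact_continuous_image holomorphic_continuous_cball[OF that R]) auto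
  have "(\<lambda>N. circle_mean (\<lambda>z. (cmod (\<Sum>n<N. ?a n * z^n))\<^sup>2)) \<longlonglongrightarrow> circle_mean (\<lambda>z. (cmod (f z))\<^sup>2)"
    by (intro circle_mean_uniform_limit uniform_limit_norm_square holomorphic_imp_powser_uniform_limit[OF f R]
        bd f continuous_intros)
  then have 1: "(\<lambda>N. \<Sum>n<Suc N. (cmod (?a n))\<^sup>2) \<longlonglongrightarrow> circle_mean (\<lambda>z. (cmod (f z))\<^sup>2)"
    unfolding circle_mean_poly by (rule LIMSEQ_Suc)
  have "(\<lambda>N. lp_int (\<lambda>z. (cmod (\<Sum>n<N. ?b n * z^n))\<^sup>2)) \<longlonglongrightarrow> lp_int (\<lambda>z. (cmod (deriv f z))\<^sup>2)"
    by (intro lp_int_uniform_limit uniform_limit_norm_square holomorphic_imp_powser_uniform_limit[OF f' R]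
        bd f' continuous_intros)
  then have "(\<lambda>N. (cmod (f 0))\<^sup>2 + (\<Sum>n<N. (cmod (?b n))\<^sup>2 / (real (Suc n))\<^sup>2))
    \<longlonglongrightarrow> (cmod (f 0))\<^sup>2 + lp_int (\<lambda>z. (cmod (deriv f z))\<^sup>2)"
    unfolding lp_int_poly by (intro tendsto_intros)
  moreover have "(cmod (?b n))\<^sup>2 / (real (Suc n))\<^sup>2 = (cmod (?a (Suc n)))\<^sup>2" for n
  proof -
    have "?b n / of_nat (Suc n) = ?a (Suc n)"
      by (simp add: funpow_Suc_right del: funpow.simps of_nat_Suc)
    then have "cmod (?a (Suc n)) = cmod (?b n) / real (Suc n)"
      by (metis norm_divide norm_of_nat)
    then show ?thesis by (simp add: power_divide)
  qed
  ultimately have "(\<lambda>N. (cmod (f 0))\<^sup>2 + (\<Sum>n<N. (cmod (?a (Suc n)))\<^sup>2))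
    \<longlonglongrightarrow> (cmod (f 0))\<^sup>2 + lp_int (\<lambda>z. (cmod (deriv f z))\<^sup>2)" by simp
  moreover have "(\<Sum>n<Suc N. (cmod (?a n))\<^sup>2) = (cmod (f 0))\<^sup>2 + (\<Sum>n<N. (cmod (?a (Suc n)))\<^sup>2)" for N
    by (subst sum.lessThan_Suc_shift) simp
  ultimately show ?thesis using 1 LIMSEQ_unique by simp
qed

section \<open>The energy estimate\<close>

abbreviation mean_sq :: "(complex \<Rightarrow> complex) \<Rightarrow> real" where
  "mean_sq f \<equiv> circle_mean (\<lambda>z. (cmod (f z))\<^sup>2)"

lemma continuous_on_sphere_if_cball: "continuous_on (cball 0 1) W \<Longrightarrow> continuous_on (sphere (0::complex) 1) W"
  by (rule continuous_on_subset) auto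

lemma holomorphic_deriv_continuous_cball:
  "f holomorphic_on ball 0 R \<Longrightarrow> R > 1 \<Longrightarrow> continuous_on (cball 0 1) (deriv f)"
  by (rule holomorphic_continuous_cball[OF holomorphic_deriv]) auto

lemma mean_sq_nonneg: "continuous_on (sphere 0 1) f \<Longrightarrow> mean_sq f \<ge> 0"
  using circle_mean_mono[of "\<lambda>_. 0" "\<lambda>z. (cmod (f z))\<^sup>2"]
  by (simp add: circle_mean_const continuous_intros)

lemma Re_of_real_mult: "Re (of_real a * z) = a * Re z"
  by simp

lemma norm_add_squared: "(cmod (a + b))\<^sup>2 = (cmod a)\<^sup>2 + (cmod b)\<^sup>2 + 2 * Re (a * cnj b)"
  unfolding cmod_power2 by (simp add: power2_eq_square algebra_simps)

lemma cmod_add_sq_le: "(cmod (u + v))\<^sup>2 \<le> 2 * (cmod u)\<^sup>2 + 2 * (cmod v)\<^sup>2"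
proof -
  have "(cmod (u + v))\<^sup>2 \<le> (cmod u + cmod v)\<^sup>2" by (intro power_mono norm_triangle_ineq) auto
  also have "\<dots> \<le> 2 * (cmod u)\<^sup>2 + 2 * (cmod v)\<^sup>2"
    using sum_squares_ge_zero[of "cmod u - cmod v" 0] by (simp add: power2_eq_square algebra_simps)
  finally show ?thesis .
qed

lemma cmod_diff_sq_le: "(cmod (u - v))\<^sup>2 \<le> 2 * (cmod u)\<^sup>2 + 2 * (cmod v)\<^sup>2"
  using cmod_add_sq_le[of u "- v"] by simp

lemma holomorphic_has_deriv_cball:
  "f holomorphic_on ball 0 R \<Longrightarrow> R > 1 \<Longrightarrow> cmod z \<le> 1 \<Longrightarrow> (f has_field_derivative deriv f z) (at z)"
  by (rule holomorphic_derivI[of _ "ball 0 R"]) auto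

text \<open>Only real parts are compared, so applying \<open>littlewood_paley\<close> to
  \<open>f\<close>, \<open>g\<close> and \<open>f + g\<close> suffices.\<close>

lemma littlewood_paley_polarized:
  assumes f: "f holomorphic_on ball 0 R" and g: "g holomorphic_on ball 0 R" and R: "R > 1"
  shows "circle_mean (\<lambda>z. Re (f z * cnj (g z))) =
    Re (f 0 * cnj (g 0)) + lp_int (\<lambda>z. Re (deriv f z * cnj (deriv g z)))"
proof -
  note c = holomorphic_continuous_cball[OF f R] holomorphic_continuous_cball[OF g R]
    holomorphic_deriv_continuous_cball[OF f R] holomorphic_deriv_continuous_cball[OF g R]
  note cs = c(1,2)[THEN continuous_on_sphere_if_cball]
  have sum: "(\<lambda>z. f z + g z) holomorphic_on ball 0 R" using f g by (intro holomorphic_intros)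
  have "circle_mean (\<lambda>z. (cmod (f z + g z))\<^sup>2) = mean_sq f + mean_sq g + 2 * circle_mean (\<lambda>z. Re (f z * cnj (g z)))"
    unfolding norm_add_squared
    by (simp add: circle_mean_add circle_mean_cmult cs continuous_intros)
  moreover have "lp_int (\<lambda>z. (cmod (deriv (\<lambda>z. f z + g z) z))\<^sup>2) =
     lp_int (\<lambda>z. (cmod (deriv f z))\<^sup>2) + lp_int (\<lambda>z. (cmod (deriv g z))\<^sup>2)
       + 2 * lp_int (\<lambda>z. Re (deriv f z * cnj (deriv g z)))"
  proof -
    have d: "deriv (\<lambda>z. f z + g z) z = deriv f z + deriv g z" if "cmod z \<le> 1" for z
      by (intro DERIV_imp_deriv DERIV_add holomorphic_has_deriv_cball[OF _ R that] f g)
    have cd: "continuous_on (cball 0 1) (deriv (\<lambda>z. f z + g z))"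
      by (rule holomorphic_deriv_continuous_cball[OF sum R])
    have "lp_int (\<lambda>z. (cmod (deriv (\<lambda>z. f z + g z) z))\<^sup>2) = lp_int (\<lambda>z. (cmod (deriv f z + deriv g z))\<^sup>2)"
      by (intro antisym lp_int_mono continuous_intros c cd) (auto simp: d)
    also have "\<dots> = lp_int (\<lambda>z. (cmod (deriv f z))\<^sup>2) + lp_int (\<lambda>z. (cmod (deriv g z))\<^sup>2)
       + 2 * lp_int (\<lambda>z. Re (deriv f z * cnj (deriv g z)))"
      unfolding norm_add_squared
      by (simp add: lp_int_add lp_int_cmult c continuous_intros)
    finally show ?thesis .
  qed
  ultimately show ?thesis
    using littlewood_paley[OF f R] littlewood_paley[OF g R] littlewood_paley[OF sum R]
      norm_add_squared[of "f 0" "g 0"] by linarith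
qed

section \<open>Carleson measures built from the derivative of a bounded function\<close>

lemma lp_deriv_le_mean_sq:
  assumes "f holomorphic_on ball 0 R" "R > 1"
  shows "lp_int (\<lambda>z. (cmod (deriv f z))\<^sup>2) \<le> mean_sq f"
  using littlewood_paley[OF assms] by simp

lemma deriv_power_mult:
  assumes "T holomorphic_on ball 0 R" "x holomorphic_on ball 0 R" "R > 1" "cmod z \<le> 1"
  shows "deriv (\<lambda>z. T z ^ Suc n * x z) z = T z ^ n * (T z * deriv x z + of_nat (Suc n) * deriv T z * x z)"
proof (rule DERIV_imp_deriv)
  have "((\<lambda>z. T z ^ Suc n) has_field_derivative (1 + of_nat n) * (deriv T z * T z ^ n)) (at z)"
    by (rule DERIV_power_Suc[OF holomorphic_has_deriv_cball[OF assms(1,3,4)]])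
  from DERIV_mult[OF this holomorphic_has_deriv_cball[OF assms(2,3,4)]]
  show "((\<lambda>z. T z ^ Suc n * x z) has_field_derivative
      T z ^ n * (T z * deriv x z + of_nat (Suc n) * deriv T z * x z)) (at z)"
    by (simp add: algebra_simps)
qed

text \<open>The function \<open>(n+1) T^n T' x\<close> is the difference of
  \<open>(T^(n+1) x)'\<close> and \<open>T^(n+1) x'\<close>, each of energy at most
  \<open>mean_sq x\<close>. Dividing by \<open>(n+1)^2\<close> gives the decay in \<open>n\<close>
  that \<open>lp_carleson_log\<close> sums.\<close>

lemma lp_carleson:
  assumes T: "T holomorphic_on ball 0 R" and x: "x holomorphic_on ball 0 R" and R: "R > 1"
    and T1: "\<And>z. cmod z \<le> 1 \<Longrightarrow> cmod (T z) \<le> 1"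
  shows "lp_int (\<lambda>z. (cmod (T z)) ^ (2*n) * ((cmod (deriv T z))\<^sup>2 * (cmod (x z))\<^sup>2)) \<le> 4 * mean_sq x / (real (Suc n))\<^sup>2"
proof -
  let ?F = "\<lambda>z. T z ^ Suc n * x z"
  note c = holomorphic_continuous_cball[OF T R] holomorphic_continuous_cball[OF x R]
    holomorphic_deriv_continuous_cball[OF T R] holomorphic_deriv_continuous_cball[OF x R]
  have F: "?F holomorphic_on ball 0 R" using T x by (intro holomorphic_intros)
  note cF = holomorphic_deriv_continuous_cball[OF F R]
  have "mean_sq ?F \<le> mean_sq x"
  proof (intro circle_mean_mono continuous_intros c[THEN continuous_on_sphere_if_cball])
    fix z :: complex assume "cmod z = 1"
    then have "cmod (T z) ^ Suc n \<le> 1" using T1[of z] by (intro power_le_one) auto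
    then show "(cmod (?F z))\<^sup>2 \<le> (cmod (x z))\<^sup>2"
      by (intro power_mono) (simp_all add: norm_mult norm_power mult_left_le_one_le)
  qed
  then have "lp_int (\<lambda>z. (cmod (deriv ?F z))\<^sup>2) \<le> mean_sq x"
    using lp_deriv_le_mean_sq[OF F R] by linarith
  moreover have "lp_int (\<lambda>z. (real (Suc n))\<^sup>2 * ((cmod (T z)) ^ (2*n) * ((cmod (deriv T z))\<^sup>2 * (cmod (x z))\<^sup>2)))
    \<le> lp_int (\<lambda>z. 2 * (cmod (deriv ?F z))\<^sup>2 + 2 * (cmod (deriv x z))\<^sup>2)"
  proof (intro lp_int_mono continuous_intros c cF)
    fix z :: complex assume z: "cmod z \<le> 1"
    let ?a = "T z ^ n * (of_nat (Suc n) * deriv T z * x z)" and ?b = "T z ^ Suc n * deriv x z"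
    have "(real (Suc n))\<^sup>2 * ((cmod (T z)) ^ (2*n) * ((cmod (deriv T z))\<^sup>2 * (cmod (x z))\<^sup>2)) = (cmod ?a)\<^sup>2"
      by (simp add: norm_mult norm_power power_mult_distrib power_mult power_even_eq mult_ac del: of_nat_Suc)
    also have "?a = deriv ?F z - ?b"
      unfolding deriv_power_mult[OF T x R z] by (simp add: algebra_simps del: of_nat_Suc)
    also have "(cmod (deriv ?F z - ?b))\<^sup>2 \<le> 2 * (cmod (deriv ?F z))\<^sup>2 + 2 * (cmod ?b)\<^sup>2"
      by (rule cmod_diff_sq_le)
    also have "(cmod ?b)\<^sup>2 \<le> (cmod (deriv x z))\<^sup>2"
    proof -
      have "cmod (T z) ^ Suc n \<le> 1" using T1[OF z] by (intro power_le_one) auto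
      then show ?thesis by (intro power_mono) (simp_all add: norm_mult norm_power mult_left_le_one_le)
    qed
    finally show "(real (Suc n))\<^sup>2 * ((cmod (T z)) ^ (2*n) * ((cmod (deriv T z))\<^sup>2 * (cmod (x z))\<^sup>2))
      \<le> 2 * (cmod (deriv ?F z))\<^sup>2 + 2 * (cmod (deriv x z))\<^sup>2" by simp
  qed
  moreover have "lp_int (\<lambda>z. 2 * (cmod (deriv ?F z))\<^sup>2 + 2 * (cmod (deriv x z))\<^sup>2)
     = 2 * lp_int (\<lambda>z. (cmod (deriv ?F z))\<^sup>2) + 2 * lp_int (\<lambda>z. (cmod (deriv x z))\<^sup>2)"
    by (simp add: lp_int_add lp_int_cmult c cF continuous_intros del: power_Suc)
  ultimately have "(real (Suc n))\<^sup>2 * lp_int (\<lambda>z. (cmod (T z)) ^ (2*n) * ((cmod (deriv T z))\<^sup>2 * (cmod (x z))\<^sup>2)) \<le> 4 * mean_sq x"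
    using lp_deriv_le_mean_sq[OF x R] by (simp only: lp_int_cmult)
  then show ?thesis by (simp add: field_simps del: of_nat_Suc)
qed

text \<open>A normalised truncation of \<open>- ln (1 - t)\<close>: with \<open>t = |T|\<^sup>2\<close> it localises to the region where \<open>|T|\<close> is
  close to \<open>1\<close>, with a logarithmically slow cutoff that is a polynomial in \<open>T\<close> and \<open>cnj T\<close>.\<close>

definition log_weight :: "nat \<Rightarrow> real \<Rightarrow> real" where
  "log_weight M t = (\<Sum>n<M. t ^ Suc n / real (Suc n)) / harm M"

text \<open>A telescoping bound. The induction keeps the remainder and treats one summand more, so
  that the base case is not empty.\<close>

lemma sum_inverse_squares_tail: "(\<Sum>j<M. 1 / (real (Suc (i+j)))\<^sup>2) \<le> 2 / real (Suc i)"
proof -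
  have "(\<Sum>j<Suc M. 1 / (real (Suc (i+j)))\<^sup>2) \<le> 2 / real (Suc i) - 1 / real (Suc (i+M))" for M
  proof (induction M)
    case 0
    have "1 / a\<^sup>2 \<le> 1 / a" if "a \<ge> 1" for a :: real
      using that by (intro divide_left_mono) (auto simp: power2_eq_square)
    from this[of "real (Suc i)"] show ?case by simp
  next
    case (Suc M)
    have "1 / (real (Suc (i + Suc M)))\<^sup>2 \<le> 1 / real (Suc (i+M)) - 1 / real (Suc (i + Suc M))"
    proof -
      have "1 / (b + 1)\<^sup>2 \<le> 1 / b - 1 / (b + 1)" if "b \<ge> 1" for b :: real
      proof -
        have "1 / b - 1 / (b + 1) = 1 / (b * (b + 1))" using that by (simp add: field_simps)
        moreover have "1 / (b + 1)\<^sup>2 \<le> 1 / (b * (b + 1))"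
          using that by (intro divide_left_mono) (auto simp: power2_eq_square)
        ultimately show ?thesis by simp
      qed
      from this[of "real (Suc (i+M))"] show ?thesis by (simp add: add.commute)
    qed
    then show ?case using Suc.IH by simp
  qed
  from this[of M] show ?thesis
    by (simp del: of_nat_Suc) (smt (verit) divide_nonneg_nonneg of_nat_0_le_iff zero_le_power2)
qed

lemma power_sum_squared: "(\<Sum>k<M. t ^ k)\<^sup>2 = (\<Sum>i<M. \<Sum>j<M. (t::real) ^ (i+j))"
  by (simp add: power2_eq_square sum_product power_add)

text \<open>The growth in \<open>M\<close> is only logarithmic; this is what makes the error terms of
  \<open>energy_estimate\<close> small.\<close>

lemma lp_carleson_log:
  assumes T: "T holomorphic_on ball 0 R" and x: "x holomorphic_on ball 0 R" and R: "R > 1"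
    and T1: "\<And>z. cmod z \<le> 1 \<Longrightarrow> cmod (T z) \<le> 1"
  shows "lp_int (\<lambda>z. (\<Sum>k<M. ((cmod (T z))\<^sup>2) ^ k)\<^sup>2 * ((cmod (deriv T z))\<^sup>2 * (cmod (x z))\<^sup>2)) \<le> 8 * harm M * mean_sq x"
proof -
  note c = holomorphic_continuous_cball[OF T R] holomorphic_continuous_cball[OF x R]
    holomorphic_deriv_continuous_cball[OF T R] holomorphic_deriv_continuous_cball[OF x R]
  have m0: "mean_sq x \<ge> 0" by (rule mean_sq_nonneg[OF continuous_on_sphere_if_cball[OF c(2)]])
  have "lp_int (\<lambda>z. (\<Sum>k<M. ((cmod (T z))\<^sup>2) ^ k)\<^sup>2 * ((cmod (deriv T z))\<^sup>2 * (cmod (x z))\<^sup>2))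
    = lp_int (\<lambda>z. \<Sum>i<M. \<Sum>j<M. cmod (T z) ^ (2*(i+j)) * ((cmod (deriv T z))\<^sup>2 * (cmod (x z))\<^sup>2))"
    by (simp only: power_sum_squared sum_distrib_right power_mult)
  also have "\<dots> = (\<Sum>i<M. \<Sum>j<M. lp_int (\<lambda>z. cmod (T z) ^ (2*(i+j)) * ((cmod (deriv T z))\<^sup>2 * (cmod (x z))\<^sup>2)))"
    by (simp add: lp_int_sum c continuous_intros)
  also have "\<dots> \<le> (\<Sum>i<M. \<Sum>j<M. 4 * mean_sq x * (1 / (real (Suc (i+j)))\<^sup>2))"
    by (intro sum_mono order.trans[OF lp_carleson[OF T x R T1]]) auto
  also have "\<dots> = 4 * mean_sq x * (\<Sum>i<M. \<Sum>j<M. 1 / (real (Suc (i+j)))\<^sup>2)"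
    by (simp add: sum_distrib_left)
  also have "\<dots> \<le> 4 * mean_sq x * (\<Sum>i<M. 2 / real (Suc i))"
    by (intro mult_left_mono sum_mono sum_inverse_squares_tail) (use m0 in auto)
  also have "(\<Sum>i<M. 2 / real (Suc i)) = 2 * harm M"
    by (simp add: harm_def sum_distrib_left field_simps sum.atLeast1_atMost_eq)
  finally show ?thesis by (simp add: mult_ac)
qed

text \<open>The letters \<open>p, s, a, b, c, d\<close> stand for the moduli of
  \<open>T, T', x, X, x', X'\<close>, and \<open>n\<close> for \<open>k + 1\<close>. The right side
  minus the left is the sum of the four nonnegative quantities established in the proof.\<close>

lemma energy_term_real:
  fixes p s a b c d n :: real
  assumes "0 \<le> p" "p \<le> 1" "0 \<le> s" "0 \<le> a" "0 \<le> b" "0 \<le> c" "0 \<le> d" "1 \<le> n"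
  shows "p\<^sup>2 * (c\<^sup>2 + d\<^sup>2) - 2 * n * s * (c*a + d*b + 2*c*b + 2*d*a + s*a*b)
    \<le> (p*c - n * s * a)\<^sup>2 + (p*d - n * s * b)\<^sup>2 - 2 * ((p*(c*b + a*d) + n * s * a*b) * ((n+1)*p * s))"
proof -
  have 1: "0 \<le> 2 * n * s * (1 - p) * (c*a + d*b)" using assms by simp
  have "p\<^sup>2 \<le> 1" using assms by (simp add: power_le_one)
  have "(2*n+2) * p\<^sup>2 \<le> (2*n+2) * 1" using assms \<open>p\<^sup>2 \<le> 1\<close> by (intro mult_left_mono) auto
  also have "(2*n+2) * 1 \<le> 4*n" using assms(8) by simp
  finally have "(2*n+2) * p\<^sup>2 \<le> 4*n" .
  then have 2: "0 \<le> s * (c*b + a*d) * (4*n - (2*n+2)*p\<^sup>2)" using assms by (intro mult_nonneg_nonneg) auto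
  have 3: "0 \<le> s\<^sup>2 * (n\<^sup>2 * (a-b)\<^sup>2)" by simp
  have 4: "0 \<le> 2 * s\<^sup>2 * a * b * (n * (n+1) * (1 - p))"
    using assms by simp
  have "(p*c - n * s * a)\<^sup>2 + (p*d - n * s * b)\<^sup>2 - 2 * ((p*(c*b + a*d) + n * s * a*b) * ((n+1)*p * s))
     - (p\<^sup>2 * (c\<^sup>2 + d\<^sup>2) - 2 * n * s * (c*a + d*b + 2*c*b + 2*d*a + s*a*b))
    = 2 * n * s * (1 - p) * (c*a + d*b) + s * (c*b + a*d) * (4*n - (2*n+2)*p\<^sup>2)
      + s\<^sup>2 * (n\<^sup>2 * (a-b)\<^sup>2) + 2 * s\<^sup>2 * a * b * (n * (n+1) * (1 - p))"
    by (simp add: power2_eq_square algebra_simps)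
  then show ?thesis using 1 2 3 4 by linarith
qed

text \<open>The right side is the Littlewood-Paley integrand \<open>G k\<close> of
  \<open>energy_estimate\<close> with \<open>|T|^(2k)\<close> factored out. Besides the main term
  \<open>|T|^2 (|x'|^2 + |X'|^2)\<close>, every term on the left contains \<open>\<tau> = T'\<close>
  and can be charged to a Carleson measure.\<close>

lemma energy_term:
  fixes T \<tau> x X x' X' :: complex
  assumes "cmod T \<le> 1"
  shows "(cmod T)\<^sup>2 * ((cmod x')\<^sup>2 + (cmod X')\<^sup>2) - 2 * real (Suc k) * cmod \<tau> *
      (cmod x' * cmod x + cmod X' * cmod X + 2 * cmod x' * cmod X + 2 * cmod X' * cmod x + cmod \<tau> * cmod x * cmod X)
    \<le> (cmod (T * x' + of_nat (Suc k) * \<tau> * x))\<^sup>2 + (cmod (T * X' + of_nat (Suc k) * \<tau> * X))\<^sup>2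
      - 2 * Re ((T * (x' * X + x * X') + of_nat (Suc k) * \<tau> * (x * X)) * cnj (of_nat (Suc (Suc k)) * T * \<tau>))"
proof -
  let ?n = "real (Suc k)"
  have sq: "(cmod u - cmod v)\<^sup>2 \<le> (cmod (u + v))\<^sup>2" for u v :: complex
    using norm_diff_ineq[of u v] norm_diff_ineq[of v u]
    by (intro abs_le_square_iff[THEN iffD1]) (simp add: add.commute abs_le_iff)
  have "(cmod T * cmod x' - ?n * cmod \<tau> * cmod x)\<^sup>2 \<le> (cmod (T * x' + of_nat (Suc k) * \<tau> * x))\<^sup>2"
    using sq[of "T * x'" "of_nat (Suc k) * \<tau> * x"] by (simp only: norm_mult norm_of_nat)
  moreover have "(cmod T * cmod X' - ?n * cmod \<tau> * cmod X)\<^sup>2 \<le> (cmod (T * X' + of_nat (Suc k) * \<tau> * X))\<^sup>2"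
    using sq[of "T * X'" "of_nat (Suc k) * \<tau> * X"] by (simp only: norm_mult norm_of_nat)
  moreover have "Re ((T * (x' * X + x * X') + of_nat (Suc k) * \<tau> * (x * X)) * cnj (of_nat (Suc (Suc k)) * T * \<tau>))
    \<le> (cmod T * (cmod x' * cmod X + cmod x * cmod X') + ?n * cmod \<tau> * cmod x * cmod X) * ((?n + 1) * cmod T * cmod \<tau>)"
  proof -
    have "cmod (T * (x' * X + x * X') + of_nat (Suc k) * \<tau> * (x * X))
      \<le> cmod T * (cmod x' * cmod X + cmod x * cmod X') + ?n * cmod \<tau> * cmod x * cmod X"
    proof (rule order.trans[OF norm_triangle_ineq add_mono])
      show "cmod (T * (x' * X + x * X')) \<le> cmod T * (cmod x' * cmod X + cmod x * cmod X')"
        unfolding norm_mult by (intro mult_left_mono order.trans[OF norm_triangle_ineq]) (auto simp: norm_mult)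
    qed (simp add: norm_mult del: of_nat_Suc)
    moreover have "cmod (cnj (of_nat (Suc (Suc k)) * T * \<tau>)) = (?n + 1) * cmod T * cmod \<tau>"
      unfolding complex_mod_cnj norm_mult norm_of_nat by simp
    ultimately show ?thesis
      by (intro order.trans[OF complex_Re_le_cmod]) (metis norm_mult mult_right_mono norm_ge_zero)
  qed
  moreover note energy_term_real[of "cmod T" "cmod \<tau>" "cmod x" "cmod X" "cmod x'" "cmod X'" "?n"]
  ultimately show ?thesis using assms by simp
qed

text \<open>Used with \<open>k\<close> equal to a geometric sum in \<open>|T|^2\<close> divided by
  \<open>harm M\<close>: then \<open>\<theta>\<close> multiplies energies of bounded size, and
  \<open>1 / \<theta>\<close> multiplies what \<open>lp_carleson_log\<close> controls.\<close>

lemma energy_amgm: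
  fixes \<theta> :: real
  assumes "\<theta> > 0"
  shows "2 * k * s * (c*a + d*b + 2*c*b + 2*d*a + s*a*b)
    \<le> \<theta> * (3 * c\<^sup>2 + 3 * d\<^sup>2 + s\<^sup>2 * a\<^sup>2) + (3 * (k\<^sup>2 * (s\<^sup>2 * a\<^sup>2)) + 4 * (k\<^sup>2 * (s\<^sup>2 * b\<^sup>2))) / \<theta>"
proof -
  have *: "2 * u * v \<le> \<theta> * u\<^sup>2 + v\<^sup>2 / \<theta>" for u v
  proof -
    have "0 \<le> (\<theta> * u - v)\<^sup>2 / \<theta>" using assms by simp
    also have "\<dots> = \<theta> * u\<^sup>2 + v\<^sup>2 / \<theta> - 2 * u * v" using assms by (simp add: field_simps power2_eq_square)
    finally show ?thesis by simp
  qed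
  define U where "U = k\<^sup>2 * (s\<^sup>2 * a\<^sup>2) / \<theta>"
  define V where "V = k\<^sup>2 * (s\<^sup>2 * b\<^sup>2) / \<theta>"
  have UV: "(k * s * a)\<^sup>2 / \<theta> = U" "(k * s * b)\<^sup>2 / \<theta> = V"
    "(3 * (k\<^sup>2 * (s\<^sup>2 * a\<^sup>2)) + 4 * (k\<^sup>2 * (s\<^sup>2 * b\<^sup>2))) / \<theta> = 3 * U + 4 * V"
    by (simp_all add: U_def V_def power_mult_distrib add_divide_distrib)
  show ?thesis
    unfolding UV
    using *[of c "k * s * a"] *[of d "k * s * b"] *[of c "k * s * b"] *[of d "k * s * a"] *[of "s*a" "k * s * b"]
    unfolding UV by (simp add: power_mult_distrib algebra_simps)
qed

lemma circle_mean_add_diff: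
  assumes "continuous_on (sphere 0 1) A" "continuous_on (sphere 0 1) B" "continuous_on (sphere 0 1) C"
  shows "circle_mean (\<lambda>z. A z + B z - 2 * C z) = circle_mean A + circle_mean B - 2 * circle_mean C"
  using circle_mean_add[of "\<lambda>z. A z + B z" "\<lambda>z. (-2) * C z"] circle_mean_add[of A B] circle_mean_cmult[of "-2" C] assms
  by (simp add: continuous_intros)

lemma lp_int_add_diff:
  assumes "continuous_on (cball 0 1) A" "continuous_on (cball 0 1) B" "continuous_on (cball 0 1) C"
  shows "lp_int (\<lambda>z. A z + B z - 2 * C z) = lp_int A + lp_int B - 2 * lp_int C"
  using lp_int_add[of "\<lambda>z. A z + B z" "\<lambda>z. (-2) * C z"] lp_int_add[of A B] lp_int_cmult[of "-2" C] assms
  by (simp add: continuous_intros)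

text \<open>By completing the square, \<open>U = |x - T cnj X|^2 + (1 - |T|^2) |X|^2\<close>. So if
  \<open>x\<close> is close to \<open>T cnj X\<close> on the part of the circle where
  \<open>|T|\<close> is near 1, then \<open>x\<close> and \<open>X\<close> have little energy where
  \<open>|T|\<close> is near 1. The proof works because \<open>|T|^(2k+2) U\<close> is a combination
  of products of a holomorphic and an antiholomorphic function, to which Littlewood-Paley applies
  for each \<open>k\<close>.\<close>

theorem energy_estimate:
  fixes T x X :: "complex \<Rightarrow> complex"
  assumes T: "T holomorphic_on ball 0 R" and x: "x holomorphic_on ball 0 R" and X: "X holomorphic_on ball 0 R"
    and R: "R > 1" and T1: "\<And>z. cmod z \<le> 1 \<Longrightarrow> cmod (T z) \<le> 1" and M: "M > 0"
    and U: "\<And>z. U z = (cmod (x z))\<^sup>2 + (cmod (X z))\<^sup>2 - 2 * Re (x z * X z * cnj (T z))"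
  shows "log_weight M ((cmod (T 0))\<^sup>2) * U 0
      + lp_int (\<lambda>z. log_weight M ((cmod (T z))\<^sup>2) * ((cmod (deriv x z))\<^sup>2 + (cmod (deriv X z))\<^sup>2))
    \<le> circle_mean (\<lambda>z. log_weight M ((cmod (T z))\<^sup>2) * U z) + 39 * (mean_sq x + mean_sq X) / sqrt (harm M)"
proof -
  note c = holomorphic_continuous_cball[OF T R] holomorphic_continuous_cball[OF x R] holomorphic_continuous_cball[OF X R]
    holomorphic_deriv_continuous_cball[OF T R] holomorphic_deriv_continuous_cball[OF x R]
    holomorphic_deriv_continuous_cball[OF X R]
  define H :: real where "H = harm M"
  have H: "H > 0" unfolding H_def using M by (simp add: harm_pos)
  \<comment> \<open>Balances the two errors, of size \<open>\<theta>\<close> from the plain energies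
    and \<open>1 / (\<theta> * H)\<close> from the logarithmic Carleson bound.\<close>
  define \<theta> where "\<theta> = 1 / sqrt H"
  have \<theta>: "\<theta> > 0" using H by (simp add: \<theta>_def)
  \<comment> \<open>The coefficients of \<open>log_weight\<close>. Since
    \<open>a k * (k + 1)\<close> does not depend on \<open>k\<close>, the terms with
    \<open>T'\<close> add up to a geometric sum.\<close>
  define a where "a = (\<lambda>k. 1 / (real (Suc k) * H))"
  have a: "a k \<ge> 0" "a k * real (Suc k) = 1 / H" for k using H by (simp_all add: a_def)
  have weight: "log_weight M t = (\<Sum>k<M. a k * t ^ Suc k)" for t
    by (simp add: log_weight_def a_def H_def sum_divide_distrib)
  \<comment> \<open>Writing \<open>?V\<close> as a power times \<open>T\<close> brings all four
    functions under \<open>deriv_power_mult\<close>.\<close>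
  let ?P = "\<lambda>k z. T z ^ Suc k * x z" and ?Q = "\<lambda>k z. T z ^ Suc k * X z"
    and ?S = "\<lambda>k z. T z ^ Suc k * (x z * X z)" and ?V = "\<lambda>k z. T z ^ Suc k * T z"
  define G where "G = (\<lambda>k z. (cmod (deriv (?P k) z))\<^sup>2 + (cmod (deriv (?Q k) z))\<^sup>2
    - 2 * Re (deriv (?S k) z * cnj (deriv (?V k) z)))"
  have hol: "?P k holomorphic_on ball 0 R" "?Q k holomorphic_on ball 0 R" "?S k holomorphic_on ball 0 R"
      "?V k holomorphic_on ball 0 R" for k
    using T x X by (auto intro!: holomorphic_intros simp del: power_Suc)
  note cd = hol[THEN holomorphic_deriv_continuous_cball[OF _ R]]
  have cG: "continuous_on (cball 0 1) (G k)" for k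
    unfolding G_def by (intro continuous_intros cd)
  have UT: "(cmod (?P k z))\<^sup>2 + (cmod (?Q k z))\<^sup>2 - 2 * Re (?S k z * cnj (?V k z))
      = ((cmod (T z))\<^sup>2) ^ Suc k * U z" for k z
  proof -
    have "?S k z * cnj (?V k z) = of_real (((cmod (T z))\<^sup>2) ^ Suc k) * (x z * X z * cnj (T z))"
      by (subst of_real_power, subst complex_norm_square) (simp add: power_mult_distrib mult_ac)
    then have "Re (?S k z * cnj (?V k z)) = ((cmod (T z))\<^sup>2) ^ Suc k * Re (x z * X z * cnj (T z))"
      by (simp only: Re_of_real_mult)
    moreover have "(cmod (T z ^ Suc k * y))\<^sup>2 = ((cmod (T z))\<^sup>2) ^ Suc k * (cmod y)\<^sup>2" for y
      by (simp only: norm_mult norm_power power_mult_distrib flip: power_mult) (simp only: mult.commute)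
    ultimately show ?thesis unfolding U by (simp only: algebra_simps)
  qed
  have green: "circle_mean (\<lambda>z. ((cmod (T z))\<^sup>2) ^ Suc k * U z) = ((cmod (T 0))\<^sup>2) ^ Suc k * U 0 + lp_int (G k)" for k
  proof -
    have "circle_mean (\<lambda>z. ((cmod (T z))\<^sup>2) ^ Suc k * U z)
       = mean_sq (?P k) + mean_sq (?Q k) - 2 * circle_mean (\<lambda>z. Re (?S k z * cnj (?V k z)))"
      unfolding UT[symmetric] by (intro circle_mean_add_diff continuous_intros c[THEN continuous_on_sphere_if_cball])
    also have "\<dots> = ((cmod (T 0))\<^sup>2) ^ Suc k * U 0 + (lp_int (\<lambda>z. (cmod (deriv (?P k) z))\<^sup>2)
       + lp_int (\<lambda>z. (cmod (deriv (?Q k) z))\<^sup>2) - 2 * lp_int (\<lambda>z. Re (deriv (?S k) z * cnj (deriv (?V k) z))))"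
      unfolding UT[symmetric] littlewood_paley[OF hol(1) R] littlewood_paley[OF hol(2) R]
        littlewood_paley_polarized[OF hol(3,4) R] by simp
    also have "lp_int (\<lambda>z. (cmod (deriv (?P k) z))\<^sup>2) + lp_int (\<lambda>z. (cmod (deriv (?Q k) z))\<^sup>2)
        - 2 * lp_int (\<lambda>z. Re (deriv (?S k) z * cnj (deriv (?V k) z))) = lp_int (G k)"
      unfolding G_def by (intro lp_int_add_diff[symmetric] continuous_intros cd)
    finally show ?thesis .
  qed
  have cU: "continuous_on (cball 0 1) U"
    unfolding U by (intro continuous_intros c)
  have "circle_mean (\<lambda>z. log_weight M ((cmod (T z))\<^sup>2) * U z)
      = (\<Sum>k<M. a k * circle_mean (\<lambda>z. ((cmod (T z))\<^sup>2) ^ Suc k * U z))"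
    unfolding weight sum_distrib_right mult.assoc
    by (subst circle_mean_sum) (auto intro!: continuous_intros c[THEN continuous_on_sphere_if_cball] cU[THEN continuous_on_sphere_if_cball] simp: circle_mean_cmult)
  also have "\<dots> = log_weight M ((cmod (T 0))\<^sup>2) * U 0 + lp_int (\<lambda>z. \<Sum>k<M. a k * G k z)"
    unfolding green weight
    by (subst lp_int_sum) (auto intro!: continuous_intros cG simp: lp_int_cmult sum_distrib_right sum.distrib distrib_left mult.assoc)
  finally have main: "circle_mean (\<lambda>z. log_weight M ((cmod (T z))\<^sup>2) * U z)
     = log_weight M ((cmod (T 0))\<^sup>2) * U 0 + lp_int (\<lambda>z. \<Sum>k<M. a k * G k z)" .
  define E where "E = (\<lambda>z. \<theta> * (3 * (cmod (deriv x z))\<^sup>2 + 3 * (cmod (deriv X z))\<^sup>2 + (cmod (deriv T z))\<^sup>2 * (cmod (x z))\<^sup>2)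
    + 1 / (\<theta> * H\<^sup>2) * (3 * ((\<Sum>k<M. ((cmod (T z))\<^sup>2) ^ k)\<^sup>2 * ((cmod (deriv T z))\<^sup>2 * (cmod (x z))\<^sup>2))
      + 4 * ((\<Sum>k<M. ((cmod (T z))\<^sup>2) ^ k)\<^sup>2 * ((cmod (deriv T z))\<^sup>2 * (cmod (X z))\<^sup>2))))"
  have cE: "continuous_on (cball 0 1) E" unfolding E_def by (intro continuous_intros c)
  have cw: "continuous_on (cball 0 1) (\<lambda>z. log_weight M ((cmod (T z))\<^sup>2) * ((cmod (deriv x z))\<^sup>2 + (cmod (deriv X z))\<^sup>2))"
    unfolding weight by (intro continuous_intros c)
  have pointwise: "log_weight M ((cmod (T z))\<^sup>2) * ((cmod (deriv x z))\<^sup>2 + (cmod (deriv X z))\<^sup>2)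
      \<le> (\<Sum>k<M. a k * G k z) + E z" if z: "cmod z \<le> 1" for z
  proof -
    let ?t = "(cmod (T z))\<^sup>2" and ?s = "cmod (deriv T z)" and ?c = "cmod (deriv x z)" and ?d = "cmod (deriv X z)"
      and ?a = "cmod (x z)" and ?b = "cmod (X z)"
    define Y where "Y = ?c * ?a + ?d * ?b + 2 * ?c * ?b + 2 * ?d * ?a + ?s * ?a * ?b"
    have xX: "(\<lambda>z. x z * X z) holomorphic_on ball 0 R" using x X by (intro holomorphic_intros)
    have dxX: "deriv (\<lambda>z. x z * X z) z = deriv x z * X z + x z * deriv X z"
      using DERIV_imp_deriv[OF DERIV_mult[OF holomorphic_has_deriv_cball[OF x R z] holomorphic_has_deriv_cball[OF X R z]]] by (simp add: mult.commute)
    have G: "?t ^ k * (?t * (?c\<^sup>2 + ?d\<^sup>2) - 2 * real (Suc k) * ?s * Y) \<le> G k z" for k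
    proof -
      let ?B = "(cmod (T z * deriv x z + of_nat (Suc k) * deriv T z * x z))\<^sup>2
        + (cmod (T z * deriv X z + of_nat (Suc k) * deriv T z * X z))\<^sup>2
        - 2 * Re ((T z * (deriv x z * X z + x z * deriv X z) + of_nat (Suc k) * deriv T z * (x z * X z))
            * cnj (of_nat (Suc (Suc k)) * T z * deriv T z))"
      have "deriv (?V k) z = T z ^ k * (of_nat (Suc (Suc k)) * T z * deriv T z)"
        unfolding deriv_power_mult[OF T T R z] by (simp add: algebra_simps)
      then have "G k z = ?t ^ k * ?B"
      proof -
        have r: "Re (T z ^ k * u * cnj (T z ^ k * v)) = ?t ^ k * Re (u * cnj v)" for u v
        proof -
          have "T z ^ k * u * cnj (T z ^ k * v) = of_real (?t ^ k) * (u * cnj v)"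
            by (subst of_real_power, subst complex_norm_square) (simp add: power_mult_distrib mult_ac)
          then show ?thesis by (simp only: Re_of_real_mult)
        qed
        have n: "(cmod (T z ^ k * u))\<^sup>2 = ?t ^ k * (cmod u)\<^sup>2" for u
          by (simp only: norm_mult norm_power power_mult_distrib flip: power_mult) (simp only: mult.commute)
        show ?thesis
          unfolding G_def deriv_power_mult[OF T x R z] deriv_power_mult[OF T X R z] deriv_power_mult[OF T xX R z] dxX
            \<open>deriv (?V k) z = _\<close> r n
          by (simp only: algebra_simps)
      qed
      moreover have "?t * (?c\<^sup>2 + ?d\<^sup>2) - 2 * real (Suc k) * ?s * Y \<le> ?B"
        unfolding Y_def by (rule energy_term[OF T1[OF z]])
      ultimately show ?thesis by (simp add: mult_left_mono)
    qed
    have "log_weight M ?t * (?c\<^sup>2 + ?d\<^sup>2) - 2 * ((\<Sum>k<M. ?t ^ k) / H) * ?s * Y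
      = (\<Sum>k<M. a k * (?t ^ k * (?t * (?c\<^sup>2 + ?d\<^sup>2) - 2 * real (Suc k) * ?s * Y)))"
    proof -
      have "a k * (?t ^ k * (?t * (?c\<^sup>2 + ?d\<^sup>2) - 2 * real (Suc k) * ?s * Y))
        = a k * ?t ^ Suc k * (?c\<^sup>2 + ?d\<^sup>2) - (a k * real (Suc k)) * ?t ^ k * (2 * ?s * Y)" for k
        by (simp only: power_Suc algebra_simps)
      then show ?thesis
        unfolding weight a(2) by (simp add: sum_subtractf sum_distrib_left sum_distrib_right sum_divide_distrib mult_ac del: power_Suc)
    qed
    also have "\<dots> \<le> (\<Sum>k<M. a k * G k z)"
      by (intro sum_mono mult_left_mono G a)
    finally have "log_weight M ?t * (?c\<^sup>2 + ?d\<^sup>2) - 2 * ((\<Sum>k<M. ?t ^ k) / H) * ?s * Y \<le> (\<Sum>k<M. a k * G k z)" .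
    moreover have "2 * ((\<Sum>k<M. ?t ^ k) / H) * ?s * Y \<le> E z"
      unfolding Y_def using energy_amgm[OF \<theta>, of "(\<Sum>k<M. ?t ^ k) / H" ?s ?c ?a ?d ?b] H \<theta>
      by (simp add: E_def power_divide field_simps)
    ultimately show ?thesis by linarith
  qed
  have "lp_int (\<lambda>z. log_weight M ((cmod (T z))\<^sup>2) * ((cmod (deriv x z))\<^sup>2 + (cmod (deriv X z))\<^sup>2))
      \<le> lp_int (\<lambda>z. (\<Sum>k<M. a k * G k z) + E z)"
    by (intro lp_int_mono cw pointwise continuous_intros cG cE)
  also have "\<dots> = lp_int (\<lambda>z. \<Sum>k<M. a k * G k z) + lp_int E"
    by (intro lp_int_add continuous_intros cG cE)
  also have "lp_int E \<le> 39 * (mean_sq x + mean_sq X) / sqrt (harm M)"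
  proof -
    let ?A = "mean_sq x" and ?B = "mean_sq X"
    have AB: "?A \<ge> 0" "?B \<ge> 0" by (intro mean_sq_nonneg continuous_on_sphere_if_cball c)+
    let ?e1 = "lp_int (\<lambda>z. (cmod (deriv x z))\<^sup>2)" and ?e2 = "lp_int (\<lambda>z. (cmod (deriv X z))\<^sup>2)"
      and ?e3 = "lp_int (\<lambda>z. (cmod (deriv T z))\<^sup>2 * (cmod (x z))\<^sup>2)"
      and ?e4 = "lp_int (\<lambda>z. (\<Sum>k<M. ((cmod (T z))\<^sup>2) ^ k)\<^sup>2 * ((cmod (deriv T z))\<^sup>2 * (cmod (x z))\<^sup>2))"
      and ?e5 = "lp_int (\<lambda>z. (\<Sum>k<M. ((cmod (T z))\<^sup>2) ^ k)\<^sup>2 * ((cmod (deriv T z))\<^sup>2 * (cmod (X z))\<^sup>2))"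
    have "lp_int E = \<theta> * (3 * ?e1 + 3 * ?e2 + ?e3) + 1 / (\<theta> * H\<^sup>2) * (3 * ?e4 + 4 * ?e5)"
      unfolding E_def
      by (simp add: lp_int_add lp_int_cmult c continuous_intros del: times_divide_eq_left)
    also have "\<dots> \<le> \<theta> * (3 * ?A + 3 * ?B + 4 * ?A) + 1 / (\<theta> * H\<^sup>2) * (3 * (8 * H * ?A) + 4 * (8 * H * ?B))"
    proof (intro add_mono mult_left_mono)
      show "?e1 \<le> ?A" "?e2 \<le> ?B" using lp_deriv_le_mean_sq x X R by auto
      show "?e3 \<le> 4 * ?A" using lp_carleson[OF T x R T1, of 0] by simp
      show "?e4 \<le> 8 * H * ?A" unfolding H_def by (rule lp_carleson_log[OF T x R T1])
      show "?e5 \<le> 8 * H * ?B" unfolding H_def by (rule lp_carleson_log[OF T X R T1])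
    qed (use \<theta> in auto)
    \<comment> \<open>Here \<open>31 = 7 + 24\<close> and \<open>35 = 3 + 32\<close>, because
      \<open>1 / (\<theta> * H) = \<theta>\<close>.\<close>
    also have "\<dots> = (31 * ?A + 35 * ?B) / sqrt H"
    proof -
      have "1 / (\<theta> * H\<^sup>2) * (3 * (8 * H * ?A) + 4 * (8 * H * ?B)) = (1 / (\<theta> * H)) * (24 * ?A + 32 * ?B)"
        using H \<theta> by (simp add: field_simps power2_eq_square)
      also have "1 / (\<theta> * H) = \<theta>"
        unfolding \<theta>_def using H by (simp add: field_simps)
      finally have "1 / (\<theta> * H\<^sup>2) * (3 * (8 * H * ?A) + 4 * (8 * H * ?B)) = \<theta> * (24 * ?A + 32 * ?B)" .
      moreover have "(31 * ?A + 35 * ?B) / sqrt H = \<theta> * (31 * ?A + 35 * ?B)"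
        by (simp add: \<theta>_def)
      ultimately show ?thesis by (simp only: algebra_simps)
    qed
    also have "\<dots> \<le> 39 * (?A + ?B) / sqrt (harm M)"
      unfolding H_def[symmetric] using H AB by (intro divide_right_mono) auto
    finally show ?thesis .
  qed
  finally show ?thesis using main by simp
qed

section \<open>Szego kernels and the kernel inequality\<close>

lemma circle_mean_lincomb:
  assumes "continuous_on (sphere 0 1) A" "continuous_on (sphere 0 1) B"
  shows "circle_mean (\<lambda>z. a * A z + b * B z) = a * circle_mean A + b * circle_mean B"
  using circle_mean_add[of "\<lambda>z. a * A z" "\<lambda>z. b * B z"] circle_mean_cmult[of a A] circle_mean_cmult[of b B] assms
  by (simp add: continuous_intros)

lemma lp_int_lincomb:
  assumes "continuous_on (cball 0 1) A" "continuous_on (cball 0 1) B"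
  shows "lp_int (\<lambda>z. a * A z + b * B z) = a * lp_int A + b * lp_int B"
  using lp_int_add[of "\<lambda>z. a * A z" "\<lambda>z. b * B z"] lp_int_cmult[of a A] lp_int_cmult[of b B] assms
  by (simp add: continuous_intros)

lemma harm_eq_sum_Suc: "harm M = (\<Sum>n<M. 1 / real (Suc n))"
  by (simp add: harm_def sum.atLeast1_atMost_eq field_simps)

lemma harm_pos_real: "M > 0 \<Longrightarrow> (harm M :: real) > 0"
  by (simp add: harm_pos)

lemma log_weight_nonneg: "0 \<le> t \<Longrightarrow> 0 \<le> log_weight M t"
  unfolding log_weight_def by (intro divide_nonneg_nonneg sum_nonneg harm_nonneg) auto

lemma log_weight_le_1:
  assumes "0 \<le> t" "t \<le> 1" "M > 0"
  shows "log_weight M t \<le> 1"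
proof -
  have "(\<Sum>n<M. t ^ Suc n / real (Suc n)) \<le> harm M"
    unfolding harm_eq_sum_Suc using assms by (intro sum_mono divide_right_mono power_le_one) auto
  then show ?thesis unfolding log_weight_def using harm_pos_real[OF assms(3)] by simp
qed

text \<open>Every exponent in the sum is at most \<open>M\<close>. This turns a corona bound
  \<open>1/2 \<le> |T|^(2M)\<close> into a weight of at least \<open>1/2\<close>.\<close>

lemma log_weight_ge_power:
  assumes "0 \<le> t" "t \<le> 1" "M > 0"
  shows "t ^ M \<le> log_weight M t"
proof -
  have "t ^ M * harm M = (\<Sum>n<M. t ^ M / real (Suc n))"
    unfolding harm_eq_sum_Suc by (simp add: sum_distrib_left)
  also have "\<dots> \<le> (\<Sum>n<M. t ^ Suc n / real (Suc n))"
    using assms by (intro sum_mono divide_right_mono power_decreasing) auto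
  finally show ?thesis unfolding log_weight_def using harm_pos_real[OF assms(3)] by (simp add: field_simps)
qed

text \<open>Replacing each \<open>1 / (n+1)\<close> by 1 leaves a geometric sum, and
  \<open>1 - t\<close> times that sum is at most 1.\<close>

lemma one_minus_log_weight_le:
  assumes "0 \<le> t" "t \<le> 1" "M > 0"
  shows "(1 - t) * log_weight M t \<le> 1 / harm M"
proof -
  have "(1 - t) * (\<Sum>n<M. t ^ Suc n / real (Suc n)) \<le> (1 - t) * (\<Sum>n<M. t ^ n)"
  proof (intro mult_left_mono sum_mono)
    fix n
    have "t ^ Suc n / real (Suc n) \<le> t ^ Suc n"
      using divide_left_mono[of 1 "real (Suc n)" "t ^ Suc n"] assms by simp
    also have "\<dots> \<le> t ^ n" using assms by (intro power_decreasing) auto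
    finally show "t ^ Suc n / real (Suc n) \<le> t ^ n" .
  qed (use assms in auto)
  also have "\<dots> = 1 - t ^ M" by (simp add: one_diff_power_eq)
  also have "\<dots> \<le> 1" using assms by simp
  finally show ?thesis unfolding log_weight_def by (simp add: divide_right_mono harm_nonneg)
qed

lemma continuous_on_log_weight [continuous_intros]:
  "continuous_on S g \<Longrightarrow> continuous_on S (\<lambda>z. log_weight M (g z))"
  unfolding log_weight_def divide_inverse by (intro continuous_intros)

section \<open>Szego kernels and adjoint multiplication on their finite sums\<close>

definition szego :: "complex \<Rightarrow> complex \<Rightarrow> complex" where
  "szego w z = 1 / (1 - cnj w * z)"

lemma szego_holomorphic:
  assumes "cmod w * R \<le> 1" "R > 1"
  shows "szego w holomorphic_on ball 0 R"
proof -
  have "1 - cnj w * z \<noteq> 0" if "z \<in> ball 0 R" for z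
  proof
    assume "1 - cnj w * z = 0"
    then have "cmod w * cmod z = 1" by (metis complex_mod_cnj norm_mult norm_one right_minus_eq)
    moreover have "w \<noteq> 0" using calculation by auto
    ultimately have "1 < cmod w * R" using that by (smt (verit) mem_ball_0 mult_strict_left_mono zero_less_norm_iff)
    then show False using assms by simp
  qed
  then show ?thesis unfolding szego_def by (intro holomorphic_intros) auto
qed

text \<open>On the circle \<open>cnj z = 1 / z\<close>, so conjugation produces the Cauchy kernel;
  this is how difference quotients enter.\<close>

lemma cnj_szego_circle:
  assumes "cmod z = 1" "cmod w < 1"
  shows "cnj (szego w z) = z / (z - w)"
proof -
  have "cnj z = 1 / z" using assms(1)
    by (metis complex_norm_square mult.commute nonzero_eq_divide_eq norm_eq_zero of_real_1 one_power2 zero_neq_one)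
  moreover have "z \<noteq> 0" "z \<noteq> w" using assms by auto
  moreover have "cnj (szego w z) = 1 / (1 - w * cnj z)" by (simp add: szego_def)
  ultimately have "cnj (szego w z) = 1 / (1 - w * (1 / z))" by (simp only:)
  with \<open>z \<noteq> 0\<close> \<open>z \<noteq> w\<close> show ?thesis by (simp add: field_simps)
qed

lemma circle_mean_Re_holomorphic:
  assumes "f holomorphic_on ball 0 R" "R > 1"
  shows "circle_mean (\<lambda>z. Re (f z)) = Re (f 0)"
  using littlewood_paley_polarized[OF assms(1) holomorphic_on_const assms(2), of 1] by (simp add: lp_int_const)

definition diff_quot :: "(complex \<Rightarrow> complex) \<Rightarrow> complex \<Rightarrow> complex \<Rightarrow> complex" where
  "diff_quot f a z = (if z = a then deriv f a else (f z - f a) / (z - a))"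

lemma diff_quot_holomorphic: "f holomorphic_on S \<Longrightarrow> open S \<Longrightarrow> a \<in> S \<Longrightarrow> diff_quot f a holomorphic_on S"
  unfolding diff_quot_def by (rule pole_lemma) (auto simp: interior_open)

lemma diff_quot_mult: "(z - a) * diff_quot f a z = f z - f a"
  by (simp add: diff_quot_def)

text \<open>On the circle \<open>f * cnj (szego w)\<close> splits into
  \<open>z * diff_quot f w z\<close>, which vanishes at 0 and so has mean 0, and
  \<open>f w * cnj (szego w)\<close>, whose mean is \<open>f w\<close> because
  \<open>szego w 0 = 1\<close>.\<close>

lemma circle_mean_szego:
  assumes f: "f holomorphic_on ball 0 R" and R: "R > 1" and w: "cmod w * R \<le> 1"
  shows "circle_mean (\<lambda>z. Re (f z * cnj (szego w z))) = Re (f w)"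
proof -
  have w1: "cmod w < 1"
    using R w by (smt (verit) mult_left_le norm_ge_zero mult_cancel_left1 mult_less_cancel_left_disj)
  have s: "szego w holomorphic_on ball 0 R" by (rule szego_holomorphic[OF w R])
  have d: "(\<lambda>z. z * diff_quot f w z) holomorphic_on ball 0 R"
    using w1 R by (intro holomorphic_intros diff_quot_holomorphic f) auto
  have "circle_mean (\<lambda>z. Re (f z * cnj (szego w z)))
     = circle_mean (\<lambda>z. Re (z * diff_quot f w z) + Re (f w * cnj (szego w z)))"
  proof (rule circle_mean_cong)
    fix z :: complex assume z: "cmod z = 1"
    then have "z - w \<noteq> 0" using w1 by auto
    then have "f z * cnj (szego w z) = z * diff_quot f w z + f w * cnj (szego w z)"
    proof -
      have "f z = f w + (z - w) * diff_quot f w z" by (simp add: diff_quot_mult)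
      moreover have "(u + (z - w) * q) * (z / (z - w)) = z * q + u * (z / (z - w))" for u q
        using \<open>z - w \<noteq> 0\<close> by (simp add: field_simps)
      ultimately show ?thesis unfolding cnj_szego_circle[OF z w1] by metis
    qed
    then show "Re (f z * cnj (szego w z)) = Re (z * diff_quot f w z) + Re (f w * cnj (szego w z))" by simp
  qed
  also have "\<dots> = circle_mean (\<lambda>z. Re (z * diff_quot f w z)) + circle_mean (\<lambda>z. Re (f w * cnj (szego w z)))"
    by (intro circle_mean_add continuous_intros continuous_on_sphere_if_cball
        holomorphic_continuous_cball[OF d R] holomorphic_continuous_cball[OF s R])
  also have "circle_mean (\<lambda>z. Re (z * diff_quot f w z)) = 0"
    using circle_mean_Re_holomorphic[OF d R] by simp
  also have "circle_mean (\<lambda>z. Re (f w * cnj (szego w z))) = Re (f w)"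
    using littlewood_paley_polarized[OF holomorphic_on_const s R, of "f w"] by (simp add: lp_int_const szego_def)
  finally show ?thesis by simp
qed

definition kernel_sum :: "nat \<Rightarrow> (nat \<Rightarrow> complex) \<Rightarrow> (nat \<Rightarrow> complex) \<Rightarrow> complex \<Rightarrow> complex" where
  "kernel_sum n a c z = (\<Sum>i<n. c i * szego (a i) z)"

lemma kernel_sum_holomorphic:
  assumes "\<And>i. i < n \<Longrightarrow> cmod (a i) * R \<le> 1" "R > 1"
  shows "kernel_sum n a c holomorphic_on ball 0 R"
  unfolding kernel_sum_def using assms by (intro holomorphic_intros szego_holomorphic) auto

lemma circle_mean_kernel_sum:
  fixes c :: "nat \<Rightarrow> complex"
  assumes f: "f holomorphic_on ball 0 R" and R: "R > 1" and a: "\<And>i. i < n \<Longrightarrow> cmod (a i) * R \<le> 1"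
  shows "circle_mean (\<lambda>z. Re (f z * cnj (kernel_sum n a c z))) = Re (\<Sum>i<n. cnj (c i) * f (a i))"
proof -
  have h: "(\<lambda>z. cnj (c i) * f z) holomorphic_on ball 0 R" for i using f by (intro holomorphic_intros)
  have "circle_mean (\<lambda>z. Re (f z * cnj (kernel_sum n a c z)))
     = circle_mean (\<lambda>z. \<Sum>i<n. Re ((cnj (c i) * f z) * cnj (szego (a i) z)))"
    by (rule circle_mean_cong) (simp only: kernel_sum_def cnj_sum sum_distrib_left Re_sum[symmetric] complex_cnj_mult mult_ac)
  also have "\<dots> = (\<Sum>i<n. circle_mean (\<lambda>z. Re ((cnj (c i) * f z) * cnj (szego (a i) z))))"
    by (rule circle_mean_sum)
      (auto intro!: continuous_intros continuous_on_sphere_if_cball holomorphic_continuous_cball[OF f R]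
        holomorphic_continuous_cball[OF szego_holomorphic[OF a R] R])
  also have "\<dots> = (\<Sum>i<n. Re (cnj (c i) * f (a i)))"
    using circle_mean_szego[OF h R a] by simp
  finally show ?thesis by simp
qed

lemma mean_sq_combine_le:
  assumes "continuous_on (sphere 0 1) f" "continuous_on (sphere 0 1) g" "continuous_on (sphere 0 1) h"
    and "\<And>z. cmod z = 1 \<Longrightarrow> (cmod (h z))\<^sup>2 \<le> 2 * (cmod (f z))\<^sup>2 + 2 * (cmod (g z))\<^sup>2"
  shows "mean_sq h \<le> 2 * mean_sq f + 2 * mean_sq g"
proof -
  have "mean_sq h \<le> circle_mean (\<lambda>z. 2 * (cmod (f z))\<^sup>2 + 2 * (cmod (g z))\<^sup>2)"
    by (intro circle_mean_mono continuous_intros assms)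
  also have "\<dots> = 2 * mean_sq f + 2 * mean_sq g"
    by (simp add: circle_mean_add circle_mean_cmult assms continuous_intros)
  finally show ?thesis .
qed

text \<open>\<open>kernel_sum n a (\<lambda>i. c i * cnj (f (a i)))\<close> is the image of \<open>kernel_sum n a c\<close> under the adjoint of
  multiplication by \<open>f\<close> on the Hardy space.\<close>

lemma toeplitz_adjoint:
  fixes c :: "nat \<Rightarrow> complex"
  assumes f: "f holomorphic_on ball 0 R" and R: "R > 1" and a: "\<And>i. i < n \<Longrightarrow> cmod (a i) * R \<le> 1"
    and f1: "\<And>z. cmod z \<le> 1 \<Longrightarrow> cmod (f z) \<le> 1"
  defines "p \<equiv> kernel_sum n a c" and "y \<equiv> kernel_sum n a (\<lambda>i. c i * cnj (f (a i)))"
  shows "circle_mean (\<lambda>z. Re (f z * y z * cnj (p z))) = mean_sq y"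
    and "mean_sq y \<le> mean_sq p"
    and "\<exists>X. X holomorphic_on ball 0 R \<and> X 0 = 0 \<and> (\<forall>z. cmod z = 1 \<longrightarrow> X z = f z * cnj (p z) - cnj (y z)) \<and>
           mean_sq X \<le> 4 * mean_sq p"
proof -
  have p: "p holomorphic_on ball 0 R" and y: "y holomorphic_on ball 0 R"
    unfolding p_def y_def by (intro kernel_sum_holomorphic a R; assumption)+
  note c = holomorphic_continuous_cball[OF f R] holomorphic_continuous_cball[OF p R] holomorphic_continuous_cball[OF y R]
  have fy: "(\<lambda>z. f z * y z) holomorphic_on ball 0 R" using f y by (intro holomorphic_intros)
  have "circle_mean (\<lambda>z. Re (f z * y z * cnj (p z))) = Re (\<Sum>i<n. cnj (c i) * (f (a i) * y (a i)))"
    unfolding p_def by (rule circle_mean_kernel_sum[OF fy R a])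
  also have "\<dots> = circle_mean (\<lambda>z. Re (y z * cnj (y z)))"
    unfolding y_def
    by (subst circle_mean_kernel_sum[OF y[unfolded y_def] R a]) (auto simp: mult_ac)
  also have "\<dots> = mean_sq y" by (simp add: complex_norm_square[symmetric] del: of_real_power)
  finally show 1: "circle_mean (\<lambda>z. Re (f z * y z * cnj (p z))) = mean_sq y" .
  \<comment> \<open>Cauchy-Schwarz in arithmetic-geometric form; the left side is
    \<open>mean_sq y\<close>, which absorbs half of itself.\<close>
  have "circle_mean (\<lambda>z. Re (f z * y z * cnj (p z))) \<le> circle_mean (\<lambda>z. (1/2) * (cmod (y z))\<^sup>2 + (1/2) * (cmod (p z))\<^sup>2)"
  proof (intro circle_mean_mono continuous_intros c[THEN continuous_on_sphere_if_cball])
    fix z :: complex assume z: "cmod z = 1"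
    have "Re (f z * y z * cnj (p z)) \<le> cmod (f z * y z * cnj (p z))" by (rule complex_Re_le_cmod)
    also have "\<dots> \<le> 1 * (cmod (y z) * cmod (p z))"
      using f1[of z] z by (simp add: norm_mult mult_left_le_one_le mult.assoc del: mult_1)
    also have "\<dots> \<le> (1/2) * (cmod (y z))\<^sup>2 + (1/2) * (cmod (p z))\<^sup>2"
      using sum_squares_ge_zero[of "cmod (y z) - cmod (p z)" 0] by (simp add: power2_eq_square algebra_simps)
    finally show "Re (f z * y z * cnj (p z)) \<le> (1/2) * (cmod (y z))\<^sup>2 + (1/2) * (cmod (p z))\<^sup>2" .
  qed
  also have "\<dots> = (1/2) * mean_sq y + (1/2) * mean_sq p"
    by (intro circle_mean_lincomb continuous_intros c[THEN continuous_on_sphere_if_cball])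
  finally show 2: "mean_sq y \<le> mean_sq p" using 1 by simp
  \<comment> \<open>On the circle \<open>f * cnj p\<close> is the sum of \<open>X\<close>,
    holomorphic and zero at 0, and the antiholomorphic \<open>cnj y\<close>. Subtracting
    \<open>f (a i)\<close> in each summand cancels the pole of the Cauchy kernel.\<close>
  define X where "X = (\<lambda>z. z * (\<Sum>i<n. cnj (c i) * diff_quot f (a i) z))"
  have a1: "cmod (a i) < 1" if "i < n" for i
    using R a[OF that] by (smt (verit) mult_left_le norm_ge_zero mult_cancel_left1 mult_less_cancel_left_disj)
  have X: "X holomorphic_on ball 0 R"
    unfolding X_def using a1 R by (intro holomorphic_intros diff_quot_holomorphic f) force+
  have eq: "X z = f z * cnj (p z) - cnj (y z)" if z: "cmod z = 1" for z
  proof -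
    have "z * (cnj (c i) * diff_quot f (a i) z) = f z * cnj (c i * szego (a i) z) - cnj (c i * cnj (f (a i)) * szego (a i) z)"
      if "i < n" for i
    proof -
      have "z - a i \<noteq> 0" using a1[OF that] z by auto
      moreover have "(u + d * q) * (C * (z / d)) - C * u * (z / d) = z * (C * q)" if "d \<noteq> 0" for d u q C :: complex
        using that by (simp add: field_simps)
      ultimately have *: "(u + (z - a i) * q) * (C * (z / (z - a i))) - C * u * (z / (z - a i)) = z * (C * q)" for u q C
        by blast
      have "f z = f (a i) + (z - a i) * diff_quot f (a i) z" by (simp add: diff_quot_mult)
      then show ?thesis
        unfolding complex_cnj_mult complex_cnj_cnj cnj_szego_circle[OF z a1[OF that]]
        using *[of "f (a i)" "diff_quot f (a i) z" "cnj (c i)"] by simp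
    qed
    then show ?thesis
      unfolding X_def p_def y_def kernel_sum_def
      by (simp add: sum_distrib_left cnj_sum sum_subtractf[symmetric] del: complex_cnj_mult)
  qed
  have "mean_sq X \<le> 2 * mean_sq p + 2 * mean_sq y"
  proof (rule mean_sq_combine_le)
    fix z :: complex assume z: "cmod z = 1"
    have "(cmod (X z))\<^sup>2 \<le> 2 * (cmod (f z * cnj (p z)))\<^sup>2 + 2 * (cmod (y z))\<^sup>2"
      unfolding eq[OF z] using cmod_diff_sq_le[of "f z * cnj (p z)" "cnj (y z)"] by simp
    moreover have "cmod (f z * cnj (p z)) \<le> cmod (p z)"
      using f1[of z] z by (simp add: norm_mult mult_left_le_one_le)
    then have "(cmod (f z * cnj (p z)))\<^sup>2 \<le> (cmod (p z))\<^sup>2" by (intro power_mono) auto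
    ultimately show "(cmod (X z))\<^sup>2 \<le> 2 * (cmod (p z))\<^sup>2 + 2 * (cmod (y z))\<^sup>2" by linarith
  qed (intro c[THEN continuous_on_sphere_if_cball] continuous_on_sphere_if_cball holomorphic_continuous_cball[OF X R])+
  then have "mean_sq X \<le> 4 * mean_sq p" using 2 by linarith
  then show "\<exists>X. X holomorphic_on ball 0 R \<and> X 0 = 0 \<and> (\<forall>z. cmod z = 1 \<longrightarrow> X z = f z * cnj (p z) - cnj (y z)) \<and>
           mean_sq X \<le> 4 * mean_sq p"
    using X eq by (intro exI[of _ X]) (auto simp: X_def)
qed

text \<open>On the circle \<open>p - \<Theta> * cnj X\<close> equals \<open>(1 - |\<Theta>|\<^sup>2) * p + \<Theta> * w\<close>, and \<open>(1 - t) * log_weight M t\<close> is small,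
  so that up to \<open>w\<close> the weighted boundary term of \<open>energy_estimate\<close> is negligible.\<close>

lemma energy_kernel_sum:
  fixes c :: "nat \<Rightarrow> complex"
  assumes T: "T holomorphic_on ball 0 R" and R: "R > 1" and a: "\<And>i. i < n \<Longrightarrow> cmod (a i) * R \<le> 1"
    and T1: "\<And>z. cmod z \<le> 1 \<Longrightarrow> cmod (T z) \<le> 1" and M: "M > 0"
  defines "p \<equiv> kernel_sum n a c" and "w \<equiv> kernel_sum n a (\<lambda>i. c i * cnj (T (a i)))"
  shows "log_weight M ((cmod (T 0))\<^sup>2) * (cmod (p 0))\<^sup>2 + lp_int (\<lambda>z. log_weight M ((cmod (T z))\<^sup>2) * (cmod (deriv p z))\<^sup>2)
    \<le> 201 / sqrt (harm M) * mean_sq p + 2 * mean_sq w" (is ?th1)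
    and "log_weight M ((cmod (T 0))\<^sup>2) * (cmod (p 0 - T 0 * w 0))\<^sup>2
      + lp_int (\<lambda>z. log_weight M ((cmod (T z))\<^sup>2) * (cmod (deriv (\<lambda>z. p z - T z * w z) z))\<^sup>2)
    \<le> 317 / sqrt (harm M) * mean_sq p" (is ?th2)
    and "mean_sq (\<lambda>z. p z - T z * w z) \<le> 4 * mean_sq p"
proof -
  have p: "p holomorphic_on ball 0 R" and w: "w holomorphic_on ball 0 R"
    unfolding p_def w_def by (intro kernel_sum_holomorphic a R; assumption)+
  define q where "q = (\<lambda>z. p z - T z * w z)"
  have q: "q holomorphic_on ball 0 R" unfolding q_def using p w T by (intro holomorphic_intros)
  obtain X where X: "X holomorphic_on ball 0 R" "X 0 = 0" "mean_sq X \<le> 4 * mean_sq p"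
    and eq: "\<And>z. cmod z = 1 \<Longrightarrow> X z = T z * cnj (p z) - cnj (w z)"
    using toeplitz_adjoint(3)[where n = n and a = a and c = c, OF T R a T1] unfolding p_def w_def by blast
  have wp: "mean_sq w \<le> mean_sq p"
    unfolding p_def w_def by (rule toeplitz_adjoint(2)[OF T R a T1])
  note c = holomorphic_continuous_cball[OF T R] holomorphic_continuous_cball[OF p R] holomorphic_continuous_cball[OF w R]
    holomorphic_continuous_cball[OF X(1) R] holomorphic_continuous_cball[OF q R]
    holomorphic_deriv_continuous_cball[OF p R] holomorphic_deriv_continuous_cball[OF q R]
    holomorphic_deriv_continuous_cball[OF X(1) R]
  note cs = c(1-5)[THEN continuous_on_sphere_if_cball]
  have P0: "mean_sq p \<ge> 0" by (rule mean_sq_nonneg[OF cs(2)])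
  define H :: real where "H = harm M"
  have "harm 1 \<le> H" unfolding H_def using M by (intro harm_mono) auto
  then have H: "H \<ge> 1" by (simp add: harm_expand)
  have sH: "1 / H \<le> 1 / sqrt H" "sqrt H > 0"
    using H real_le_lsqrt[of H H] by (auto intro!: divide_left_mono simp: power2_eq_square mult_le_cancel_left1)
  let ?psi = "\<lambda>z. log_weight M ((cmod (T z))\<^sup>2)"
  have psi: "0 \<le> ?psi z" "?psi z \<le> 1" "(1 - (cmod (T z))\<^sup>2) * ?psi z \<le> 1 / H" "(cmod (T z))\<^sup>2 \<le> 1" if "cmod z \<le> 1" for z
    using T1[OF that] log_weight_nonneg log_weight_le_1[OF _ _ M] one_minus_log_weight_le[OF _ _ M] H_def
    by (auto simp: power_le_one)
  \<comment> \<open>Completing the square reduces the boundary term to the size of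
    \<open>x - T cnj X\<close> and to \<open>(1 - |T|^2) |X|^2\<close>.\<close>
  have U: "(cmod x)\<^sup>2 + (cmod Y)\<^sup>2 - 2 * Re (x * Y * cnj t) = (cmod (x - t * cnj Y))\<^sup>2 + (1 - (cmod t)\<^sup>2) * (cmod Y)\<^sup>2"
    for x Y t
    unfolding cmod_power2 by (simp add: power2_eq_square algebra_simps)
  have drop: "lp_int (\<lambda>z. ?psi z * (cmod (deriv x z))\<^sup>2) \<le> lp_int (\<lambda>z. ?psi z * ((cmod (deriv x z))\<^sup>2 + (cmod (deriv X z))\<^sup>2))"
    if "continuous_on (cball 0 1) (deriv x)" for x
    by (intro lp_int_mono continuous_intros c that mult_left_mono psi) auto
  have e1: "p z - T z * cnj (X z) = of_real (1 - (cmod (T z))\<^sup>2) * p z + T z * w z" if "cmod z = 1" for z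
    unfolding of_real_diff complex_norm_square eq[OF that] by (simp add: algebra_simps)
  \<comment> \<open>Subtracting \<open>T w\<close> from \<open>p\<close> removes \<open>w\<close>
    from the boundary expression, so the second estimate has no \<open>mean_sq w\<close> on the
    right.\<close>
  have e2: "q z - T z * cnj (X z) = of_real (1 - (cmod (T z))\<^sup>2) * p z" if "cmod z = 1" for z
    unfolding q_def using e1[OF that] by (simp add: algebra_simps)
  have small: "?psi z * (1 - (cmod (T z))\<^sup>2)\<^sup>2 \<le> 1 / H" if "cmod z \<le> 1" for z
  proof -
    have "?psi z * (1 - (cmod (T z))\<^sup>2)\<^sup>2 = (1 - (cmod (T z))\<^sup>2) * ((1 - (cmod (T z))\<^sup>2) * ?psi z)"
      by (simp add: power2_eq_square)
    also have "\<dots> \<le> 1 * ((1 - (cmod (T z))\<^sup>2) * ?psi z)"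
      using psi[OF that] by (intro mult_right_mono mult_nonneg_nonneg) auto
    finally show ?thesis using psi(3)[OF that] by linarith
  qed
  have sm: "?psi z * ((1 - (cmod (T z))\<^sup>2) * (cmod (X z))\<^sup>2) \<le> 1 / H * (cmod (X z))\<^sup>2" if "cmod z \<le> 1" for z
    using mult_right_mono[OF psi(3)[OF that], of "(cmod (X z))\<^sup>2"] by (simp add: mult_ac)
  show ?th1
  proof -
    let ?U = "\<lambda>z. (cmod (p z))\<^sup>2 + (cmod (X z))\<^sup>2 - 2 * Re (p z * X z * cnj (T z))"
    have "circle_mean (\<lambda>z. ?psi z * ?U z)
      \<le> circle_mean (\<lambda>z. 1 * ((2/H) * (cmod (p z))\<^sup>2 + 2 * (cmod (w z))\<^sup>2) + (1/H) * (cmod (X z))\<^sup>2)"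
    proof (intro circle_mean_mono continuous_intros cs)
      fix z :: complex assume z: "cmod z = 1"
      let ?s = "1 - (cmod (T z))\<^sup>2"
      have z': "cmod z \<le> 1" using z by simp
      have "(cmod (p z - T z * cnj (X z)))\<^sup>2 \<le> 2 * (?s\<^sup>2 * (cmod (p z))\<^sup>2) + 2 * (cmod (T z * w z))\<^sup>2"
        unfolding e1[OF z] using cmod_add_sq_le[of "of_real ?s * p z" "T z * w z"]
        by (simp only: norm_mult norm_of_real power_mult_distrib power2_abs)
      then have "?psi z * (cmod (p z - T z * cnj (X z)))\<^sup>2
          \<le> ?psi z * (2 * (?s\<^sup>2 * (cmod (p z))\<^sup>2) + 2 * (cmod (T z * w z))\<^sup>2)"
        by (intro mult_left_mono psi[OF z'])
      also have "\<dots> = 2 * ((?psi z * ?s\<^sup>2) * (cmod (p z))\<^sup>2) + 2 * ((?psi z * (cmod (T z))\<^sup>2) * (cmod (w z))\<^sup>2)"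
        by (simp only: norm_mult power_mult_distrib algebra_simps)
      also have "\<dots> \<le> 2 * ((1/H) * (cmod (p z))\<^sup>2) + 2 * (1 * (cmod (w z))\<^sup>2)"
        using psi[OF z'] by (intro add_mono mult_left_mono mult_right_mono small[OF z'] mult_le_one) auto
      finally show "?psi z * ?U z \<le> 1 * ((2/H) * (cmod (p z))\<^sup>2 + 2 * (cmod (w z))\<^sup>2) + (1/H) * (cmod (X z))\<^sup>2"
        using sm[OF z'] unfolding U distrib_left by simp
    qed
    also have "\<dots> = 1 * ((2/H) * mean_sq p + 2 * mean_sq w) + (1/H) * mean_sq X"
      by (subst circle_mean_lincomb, (intro continuous_intros cs)+, subst circle_mean_lincomb)
        (auto intro!: continuous_intros cs)
    also have "\<dots> \<le> 1 * ((2/H) * mean_sq p + 2 * mean_sq w) + (1/H) * (4 * mean_sq p)"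
      using H by (intro add_mono mult_left_mono X order_refl) auto
    also have "\<dots> = 6 * ((1/H) * mean_sq p) + 2 * mean_sq w" by simp
    also have "\<dots> \<le> 6 * ((1 / sqrt H) * mean_sq p) + 2 * mean_sq w"
      using sH P0 by (intro add_mono mult_left_mono mult_right_mono order_refl) auto
    finally have b: "circle_mean (\<lambda>z. ?psi z * ?U z) \<le> 6 * ((1 / sqrt H) * mean_sq p) + 2 * mean_sq w" .
    \<comment> \<open>\<open>201 = 6 + 39 * (1 + 4)\<close>: the 6 is the boundary term, the 4 the
      bound on \<open>X\<close>.\<close>
    have "39 * (mean_sq p + mean_sq X) / sqrt H \<le> 39 * (mean_sq p + 4 * mean_sq p) / sqrt H"
      using X(3) sH(2) by (intro divide_right_mono) auto
    moreover have "39 * (mean_sq p + 4 * mean_sq p) / sqrt H = 195 * ((1 / sqrt H) * mean_sq p)" by simp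
    moreover have "201 / sqrt H * mean_sq p = 201 * ((1 / sqrt H) * mean_sq p)" by simp
    ultimately show ?th1
      using energy_estimate[OF T p X(1) R T1 M, of ?U] drop[OF c(6)] b X(2)
      unfolding H_def[symmetric] by simp
  qed
  have "mean_sq q \<le> 2 * mean_sq p + 2 * mean_sq w"
  proof (rule mean_sq_combine_le[OF cs(2,3,5)])
    fix z :: complex assume z: "cmod z = 1"
    have "cmod (T z * w z) \<le> cmod (w z)"
      using T1[of z] z by (simp add: norm_mult mult_left_le_one_le)
    then have "(cmod (T z * w z))\<^sup>2 \<le> (cmod (w z))\<^sup>2" by (intro power_mono) auto
    then show "(cmod (q z))\<^sup>2 \<le> 2 * (cmod (p z))\<^sup>2 + 2 * (cmod (w z))\<^sup>2"
      unfolding q_def using cmod_diff_sq_le[of "p z" "T z * w z"] by linarith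
  qed
  then have qp: "mean_sq q \<le> 4 * mean_sq p" using wp by linarith
  then show "mean_sq (\<lambda>z. p z - T z * w z) \<le> 4 * mean_sq p" by (simp add: q_def)
  have "log_weight M ((cmod (T 0))\<^sup>2) * (cmod (q 0))\<^sup>2 + lp_int (\<lambda>z. ?psi z * (cmod (deriv q z))\<^sup>2)
    \<le> 317 / sqrt H * mean_sq p"
  proof -
    let ?U = "\<lambda>z. (cmod (q z))\<^sup>2 + (cmod (X z))\<^sup>2 - 2 * Re (q z * X z * cnj (T z))"
    have "circle_mean (\<lambda>z. ?psi z * ?U z)
      \<le> circle_mean (\<lambda>z. (1/H) * (cmod (p z))\<^sup>2 + (1/H) * (cmod (X z))\<^sup>2)"
    proof (intro circle_mean_mono continuous_intros cs)
      fix z :: complex assume z: "cmod z = 1"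
      let ?s = "1 - (cmod (T z))\<^sup>2"
      have z': "cmod z \<le> 1" using z by simp
      have "?psi z * (cmod (q z - T z * cnj (X z)))\<^sup>2 = (?psi z * ?s\<^sup>2) * (cmod (p z))\<^sup>2"
        unfolding e2[OF z] by (simp only: norm_mult norm_of_real power_mult_distrib power2_abs mult.assoc)
      also have "\<dots> \<le> (1/H) * (cmod (p z))\<^sup>2"
        by (intro mult_right_mono small[OF z']) auto
      finally show "?psi z * ?U z \<le> (1/H) * (cmod (p z))\<^sup>2 + (1/H) * (cmod (X z))\<^sup>2"
        using sm[OF z'] unfolding U distrib_left by simp
    qed
    also have "\<dots> = (1/H) * mean_sq p + (1/H) * mean_sq X"
      by (intro circle_mean_lincomb continuous_intros cs)
    also have "\<dots> \<le> (1/H) * mean_sq p + (1/H) * (4 * mean_sq p)"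
      using H by (intro add_mono mult_left_mono X order_refl) auto
    also have "\<dots> = 5 * ((1/H) * mean_sq p)" by simp
    also have "\<dots> \<le> 5 * ((1 / sqrt H) * mean_sq p)"
      using sH P0 by (intro mult_left_mono mult_right_mono) auto
    finally have b: "circle_mean (\<lambda>z. ?psi z * ?U z) \<le> 5 * ((1 / sqrt H) * mean_sq p)" .
    \<comment> \<open>\<open>317 = 5 + 39 * (4 + 4)\<close>, by the bounds on \<open>q\<close> and
      \<open>X\<close>.\<close>
    have "39 * (mean_sq q + mean_sq X) / sqrt H \<le> 39 * (4 * mean_sq p + 4 * mean_sq p) / sqrt H"
      using X(3) qp sH(2) by (intro divide_right_mono) auto
    moreover have "39 * (4 * mean_sq p + 4 * mean_sq p) / sqrt H = 312 * ((1 / sqrt H) * mean_sq p)" by simp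
    moreover have "317 / sqrt H * mean_sq p = 317 * ((1 / sqrt H) * mean_sq p)" by simp
    ultimately show ?thesis
      using energy_estimate[OF T q X(1) R T1 M, of ?U] drop[OF c(7)] b X(2)
      unfolding H_def[symmetric] by simp
  qed
  then show ?th2 unfolding H_def q_def .
qed

text \<open>To be used with \<open>u = p'\<close>, \<open>v = q'\<close> and the logarithmic weights
  of \<open>T\<close> and \<open>f\<close> as \<open>A\<close> and \<open>B\<close>. The factor
  whose weight is at least \<open>1/2\<close> takes the large coefficient
  \<open>1 / \<kappa>\<close>, the other one takes \<open>\<kappa>\<close>.\<close>

lemma corona_pointwise:
  fixes \<kappa> :: real
  assumes "\<kappa> > 0" "0 \<le> A" "0 \<le> B" "1/2 \<le> A \<or> 1/2 \<le> B"
  shows "Re (u * cnj v) \<le> (1/\<kappa>) * (A * (cmod u)\<^sup>2 + B * (cmod v)\<^sup>2) + \<kappa> * ((cmod u)\<^sup>2 + (cmod v)\<^sup>2)"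
proof -
  have amgm: "x * y \<le> (1/\<kappa>) * (x\<^sup>2 / 2) + \<kappa> * y\<^sup>2" if "0 \<le> x" "0 \<le> y" for x y
  proof -
    have "0 \<le> (x - \<kappa> * y)\<^sup>2 / (2 * \<kappa>)" using assms by simp
    also have "\<dots> = (1/\<kappa>) * (x\<^sup>2 / 2) + \<kappa> * y\<^sup>2 / 2 - x * y" using assms by (simp add: field_simps power2_eq_square)
    finally have "x * y \<le> (1/\<kappa>) * (x\<^sup>2 / 2) + \<kappa> * y\<^sup>2 / 2" by simp
    moreover have "\<kappa> * y\<^sup>2 \<ge> 0" using assms by simp
    ultimately show ?thesis by simp
  qed
  have "Re (u * cnj v) \<le> cmod u * cmod v" using complex_Re_le_cmod[of "u * cnj v"] by (simp add: norm_mult)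
  also have "\<dots> \<le> (1/\<kappa>) * (A * (cmod u)\<^sup>2 + B * (cmod v)\<^sup>2) + \<kappa> * ((cmod u)\<^sup>2 + (cmod v)\<^sup>2)"
    using assms(4)
  proof
    assume "1/2 \<le> A"
    have "(cmod u)\<^sup>2 / 2 \<le> A * (cmod u)\<^sup>2 + B * (cmod v)\<^sup>2"
    proof -
      have "0 \<le> B * (cmod v)\<^sup>2" using assms by simp
      moreover have "1/2 * (cmod u)\<^sup>2 \<le> A * (cmod u)\<^sup>2" using \<open>1/2 \<le> A\<close> by (intro mult_right_mono) auto
      ultimately show ?thesis by linarith
    qed
    then have "(1/\<kappa>) * ((cmod u)\<^sup>2 / 2) \<le> (1/\<kappa>) * (A * (cmod u)\<^sup>2 + B * (cmod v)\<^sup>2)"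
      using assms by (intro mult_left_mono) auto
    moreover have "0 \<le> \<kappa> * (cmod u)\<^sup>2" using assms by simp
    ultimately show ?thesis using amgm[of "cmod u" "cmod v"] by (simp add: distrib_left)
  next
    assume "1/2 \<le> B"
    have "(cmod v)\<^sup>2 / 2 \<le> A * (cmod u)\<^sup>2 + B * (cmod v)\<^sup>2"
    proof -
      have "0 \<le> A * (cmod u)\<^sup>2" using assms by simp
      moreover have "1/2 * (cmod v)\<^sup>2 \<le> B * (cmod v)\<^sup>2" using \<open>1/2 \<le> B\<close> by (intro mult_right_mono) auto
      ultimately show ?thesis by linarith
    qed
    then have "(1/\<kappa>) * ((cmod v)\<^sup>2 / 2) \<le> (1/\<kappa>) * (A * (cmod u)\<^sup>2 + B * (cmod v)\<^sup>2)"
      using assms by (intro mult_left_mono) auto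
    moreover have "0 \<le> \<kappa> * (cmod v)\<^sup>2" using assms by simp
    ultimately show ?thesis using amgm[of "cmod v" "cmod u"] by (simp add: distrib_left mult.commute)
  qed
  finally show ?thesis .
qed

theorem kernel_inequality_smooth:
  fixes c :: "nat \<Rightarrow> complex"
  assumes f: "f holomorphic_on ball 0 R" and T: "T holomorphic_on ball 0 R"
    and R: "R > 1" and a: "\<And>i. i < n \<Longrightarrow> cmod (a i) * R \<le> 1"
    and f1: "\<And>z. cmod z \<le> 1 \<Longrightarrow> cmod (f z) \<le> 1" and T1: "\<And>z. cmod z \<le> 1 \<Longrightarrow> cmod (T z) \<le> 1"
    and M: "M > 0" and \<kappa>: "\<kappa> > 0"
    and corona: "\<And>z. cmod z \<le> 1 \<Longrightarrow> 1/2 \<le> ((cmod (f z))\<^sup>2)^M \<or> 1/2 \<le> ((cmod (T z))\<^sup>2)^M"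
  defines "p \<equiv> kernel_sum n a c" and "y \<equiv> kernel_sum n a (\<lambda>i. c i * cnj (f (a i)))"
    and "w \<equiv> kernel_sum n a (\<lambda>i. c i * cnj (T (a i)))"
  shows "(1 - 5 * \<kappa> - 518 / (\<kappa> * sqrt (harm M))) * mean_sq p \<le> mean_sq y + 2 / \<kappa> * mean_sq w"
proof -
  have p: "p holomorphic_on ball 0 R" and y: "y holomorphic_on ball 0 R"
    unfolding p_def y_def by (intro kernel_sum_holomorphic a R; assumption)+
  define q where "q = (\<lambda>z. p z - f z * y z)"
  have q: "q holomorphic_on ball 0 R" unfolding q_def using p y f by (intro holomorphic_intros)
  note c = holomorphic_continuous_cball[OF f R] holomorphic_continuous_cball[OF T R]
    holomorphic_continuous_cball[OF p R] holomorphic_continuous_cball[OF q R] holomorphic_continuous_cball[OF y R]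
    holomorphic_deriv_continuous_cball[OF p R] holomorphic_deriv_continuous_cball[OF q R]
  note cs = c(1-5)[THEN continuous_on_sphere_if_cball]
  let ?A = "\<lambda>z. log_weight M ((cmod (T z))\<^sup>2)" and ?B = "\<lambda>z. log_weight M ((cmod (f z))\<^sup>2)"
  let ?s = "sqrt (harm M)"
  have ET: "?A 0 * (cmod (p 0))\<^sup>2 + lp_int (\<lambda>z. ?A z * (cmod (deriv p z))\<^sup>2) \<le> 201 / ?s * mean_sq p + 2 * mean_sq w"
    unfolding p_def w_def by (rule energy_kernel_sum(1)[OF T R a T1 M])
  have Ef: "?B 0 * (cmod (q 0))\<^sup>2 + lp_int (\<lambda>z. ?B z * (cmod (deriv q z))\<^sup>2) \<le> 317 / ?s * mean_sq p"
    unfolding p_def y_def q_def by (rule energy_kernel_sum(2)[OF f R a f1 M])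
  have Q: "mean_sq q \<le> 4 * mean_sq p"
    unfolding p_def y_def q_def by (rule energy_kernel_sum(3)[OF f R a f1 M])
  have pt: "Re (u * cnj v) \<le> (1/\<kappa>) * (?A z * (cmod u)\<^sup>2 + ?B z * (cmod v)\<^sup>2) + \<kappa> * ((cmod u)\<^sup>2 + (cmod v)\<^sup>2)"
    if "cmod z \<le> 1" for u v z
  proof (rule corona_pointwise[OF \<kappa>])
    show "1/2 \<le> ?A z \<or> 1/2 \<le> ?B z"
      using corona[OF that] log_weight_ge_power[OF _ _ M, of "(cmod (T z))\<^sup>2"] log_weight_ge_power[OF _ _ M, of "(cmod (f z))\<^sup>2"]
        T1[OF that] f1[OF that] by (auto simp: power_le_one)
  qed (auto intro: log_weight_nonneg)
  \<comment> \<open>By \<open>toeplitz_adjoint(1)\<close>, \<open>mean_sq y\<close> is the pairing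
    of \<open>f * y\<close> with \<open>p\<close>; hence the difference pairs \<open>p\<close> with
    \<open>q\<close>.\<close>
  have "mean_sq p - mean_sq y = circle_mean (\<lambda>z. 1 * (cmod (p z))\<^sup>2 + (-1) * Re (f z * y z * cnj (p z)))"
    unfolding p_def y_def
    by (subst circle_mean_lincomb, (intro continuous_intros cs[unfolded p_def y_def])+,
        subst toeplitz_adjoint(1)[OF f R a f1]) simp_all
  also have "\<dots> = circle_mean (\<lambda>z. Re (p z * cnj (q z)))"
    by (rule circle_mean_cong, unfold q_def cmod_power2) (simp add: power2_eq_square algebra_simps)
  also have "\<dots> = Re (p 0 * cnj (q 0)) + lp_int (\<lambda>z. Re (deriv p z * cnj (deriv q z)))"
    by (rule littlewood_paley_polarized[OF p q R])
  also have "\<dots> \<le> (1/\<kappa>) * (?A 0 * (cmod (p 0))\<^sup>2 + ?B 0 * (cmod (q 0))\<^sup>2) + \<kappa> * ((cmod (p 0))\<^sup>2 + (cmod (q 0))\<^sup>2)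
     + lp_int (\<lambda>z. (1/\<kappa>) * (1 * (?A z * (cmod (deriv p z))\<^sup>2) + 1 * (?B z * (cmod (deriv q z))\<^sup>2))
       + \<kappa> * (1 * (cmod (deriv p z))\<^sup>2 + 1 * (cmod (deriv q z))\<^sup>2))"
    unfolding mult_1 by (intro add_mono pt lp_int_mono continuous_intros c) auto
  also have "\<dots> = (1/\<kappa>) * (?A 0 * (cmod (p 0))\<^sup>2 + ?B 0 * (cmod (q 0))\<^sup>2) + \<kappa> * ((cmod (p 0))\<^sup>2 + (cmod (q 0))\<^sup>2)
     + ((1/\<kappa>) * (1 * lp_int (\<lambda>z. ?A z * (cmod (deriv p z))\<^sup>2) + 1 * lp_int (\<lambda>z. ?B z * (cmod (deriv q z))\<^sup>2))
       + \<kappa> * (1 * lp_int (\<lambda>z. (cmod (deriv p z))\<^sup>2) + 1 * lp_int (\<lambda>z. (cmod (deriv q z))\<^sup>2)))"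
    by (subst lp_int_lincomb, (intro continuous_intros c)+)+ (rule refl)
  also have "\<dots> = (1/\<kappa>) * ((?A 0 * (cmod (p 0))\<^sup>2 + lp_int (\<lambda>z. ?A z * (cmod (deriv p z))\<^sup>2))
      + (?B 0 * (cmod (q 0))\<^sup>2 + lp_int (\<lambda>z. ?B z * (cmod (deriv q z))\<^sup>2))) + \<kappa> * (mean_sq p + mean_sq q)"
    unfolding littlewood_paley[OF p R] littlewood_paley[OF q R] by (simp only: algebra_simps)
  \<comment> \<open>The final constants are \<open>518 = 201 + 317\<close> and
    \<open>5 = 1 + 4\<close>, the 4 from \<open>mean_sq q \<le> 4 * mean_sq p\<close>.\<close>
  also have "\<dots> \<le> (1/\<kappa>) * ((201 / ?s * mean_sq p + 2 * mean_sq w) + 317 / ?s * mean_sq p) + \<kappa> * (mean_sq p + 4 * mean_sq p)"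
    using \<kappa> by (intro add_mono mult_left_mono ET Ef Q order_refl) auto
  also have "\<dots> = 518 / (\<kappa> * ?s) * mean_sq p + 2 / \<kappa> * mean_sq w + 5 * \<kappa> * mean_sq p"
    using \<kappa> harm_pos_real[OF M] by (simp add: field_simps)
  finally show ?thesis by (simp add: algebra_simps)
qed

section \<open>Gram matrices and extension of isometries\<close>

text \<open>Cholesky factorisation by Schur complements. If the pivot is 0, its whole row vanishes,
  and since division by 0 gives 0 the same formulas remain valid.\<close>

lemma psd_imp_gram:
  fixes B :: "'i \<Rightarrow> 'i \<Rightarrow> complex"
  assumes "finite I" "\<And>i j. B j i = cnj (B i j)"
    and "\<And>c. 0 \<le> Re (\<Sum>i\<in>I. \<Sum>j\<in>I. c i * cnj (c j) * B i j)"
  shows "\<exists>v. \<forall>i\<in>I. \<forall>j\<in>I. B i j = (\<Sum>k\<in>I. v i k * cnj (v j k))"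
  using assms
proof (induction I arbitrary: B rule: finite_induct)
  case (insert m I)
  let ?S = "\<lambda>c. \<Sum>i\<in>I. c i * B i m"
  let ?Q = "\<lambda>c. \<Sum>i\<in>I. \<Sum>j\<in>I. c i * cnj (c j) * B i j"
  have herm: "B j i = cnj (B i j)" for i j by (rule insert.prems(1))
  have split: "(\<Sum>i\<in>insert m I. \<Sum>j\<in>insert m I. c i * cnj (c j) * B i j)
      = ?Q c + cnj (c m) * ?S c + c m * cnj (?S c) + c m * cnj (c m) * B m m" for c
  proof -
    have "(\<Sum>j\<in>I. c m * cnj (c j) * B m j) = c m * cnj (?S c)"
      unfolding sum_distrib_left cnj_sum by (intro sum.cong refl) (simp add: herm[of m])
    then show ?thesis
      using insert.hyps by (simp add: sum.distrib sum_distrib_left mult_ac)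
  qed
  have pos: "0 \<le> Re (?Q c + cnj (c m) * ?S c + c m * cnj (?S c) + c m * cnj (c m) * B m m)" for c
    using insert.prems(2)[of c] unfolding split .
  define b where "b = Re (B m m)"
  have bm: "B m m = of_real b" using herm[of m m] by (simp add: b_def complex_eq_iff)
  have b0: "b \<ge> 0" using pos[of "\<lambda>i. if i = m then 1 else 0"] insert.hyps bm
    by (simp add: if_distrib[of "\<lambda>x. x * _"] cong: if_cong) (smt (verit) sum.neutral zero_complex.simps(1) mult_eq_0_iff)
  \<comment> \<open>Otherwise the form would be negative on some vector supported at
    \<open>i\<close> and \<open>m\<close>.\<close>
  have zero: "B i m = 0" if "b = 0" "i \<in> I" for i
  proof (rule ccontr)
    assume nz: "B i m \<noteq> 0"
    have "i \<noteq> m" using that insert.hyps by auto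
    have key: "0 \<le> Re (B i i + cnj t * B i m + t * cnj (B i m))" for t
    proof -
      define c where "c = (\<lambda>k. if k = i then 1 else if k = m then t else 0)"
      have ci: "(\<Sum>k\<in>I. c k * g k) = g i" for g
      proof -
        have "(\<Sum>k\<in>I. c k * g k) = (\<Sum>k\<in>I. if k = i then g i else 0)"
          using insert.hyps by (intro sum.cong) (auto simp: c_def)
        then show ?thesis using that insert.hyps by simp
      qed
      have S: "?S c = B i m" by (rule ci)
      have Q: "?Q c = B i i"
      proof -
        have "(\<Sum>j\<in>I. c k * cnj (c j) * B k j) = c k * cnj (\<Sum>j\<in>I. c j * cnj (B k j))" for k
          by (simp add: cnj_sum sum_distrib_left mult_ac)
        then show ?thesis by (simp add: ci)
      qed
      have cm: "c m = t" using \<open>i \<noteq> m\<close> by (simp add: c_def)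
      show ?thesis using pos[of c] that(1) bm unfolding S cm Q by simp
    qed
    \<comment> \<open>Chosen so that the form takes the value \<open>- Re (B i i) - 2\<close>, which
      is negative because \<open>Re (B i i) \<ge> 0\<close>.\<close>
    define s where "s = - (Re (B i i) + 1) / (cmod (B i m))\<^sup>2"
    have "cnj (of_real s * B i m) * B i m + of_real s * B i m * cnj (B i m) = of_real (2 * s * (cmod (B i m))\<^sup>2)"
      unfolding of_real_mult complex_norm_square by simp
    then have "Re (B i i + cnj (of_real s * B i m) * B i m + of_real s * B i m * cnj (B i m)) = Re (B i i) + 2 * s * (cmod (B i m))\<^sup>2"
      by (metis Re_complex_of_real add.assoc plus_complex.simps(1))
    also have "\<dots> = - Re (B i i) - 2" using nz by (simp add: s_def)
    finally have "Re (B i i) \<le> - 2" using key[of "of_real s * B i m"] by linarith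
    moreover have "0 \<le> Re (B i i)" using key[of 0] by simp
    ultimately show False by simp
  qed
  define B' where "B' = (\<lambda>i j. B i j - B i m * cnj (B j m) / of_real b)"
  have "\<exists>v. \<forall>i\<in>I. \<forall>j\<in>I. B' i j = (\<Sum>k\<in>I. v i k * cnj (v j k))"
  proof (rule insert.IH)
    show "B' j i = cnj (B' i j)" for i j
      unfolding B'_def using herm[of j i] by simp
    fix c
    have "(\<Sum>i\<in>I. \<Sum>j\<in>I. c i * cnj (c j) * (B i m * cnj (B j m) / of_real b)) = ?S c * cnj (?S c) / of_real b"
      by (simp add: cnj_sum sum_product sum_divide_distrib mult_ac)
    then have Q': "(\<Sum>i\<in>I. \<Sum>j\<in>I. c i * cnj (c j) * B' i j) = ?Q c - ?S c * cnj (?S c) / of_real b"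
      unfolding B'_def by (simp add: right_diff_distrib sum_subtractf)
    \<comment> \<open>For a positive pivot this coefficient minimises the form in the variable at
      \<open>m\<close>, and the minimum is the form of the Schur complement.\<close>
    define c' where "c' = c(m := - ?S c / of_real b)"
    have eq: "?S c' = ?S c" "?Q c' = ?Q c" using insert.hyps by (auto simp: c'_def intro!: sum.cong)
    have "0 \<le> Re (?Q c + cnj (c' m) * ?S c + c' m * cnj (?S c) + c' m * cnj (c' m) * of_real b)"
      using pos[of c'] unfolding eq bm .
    also have "?Q c + cnj (c' m) * ?S c + c' m * cnj (?S c) + c' m * cnj (c' m) * of_real b
        = ?Q c - ?S c * cnj (?S c) / of_real b"
      by (cases "b = 0") (simp_all add: c'_def)
    finally show "0 \<le> Re (\<Sum>i\<in>I. \<Sum>j\<in>I. c i * cnj (c j) * B' i j)" unfolding Q' .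
  qed
  then obtain v where v: "\<And>i j. i \<in> I \<Longrightarrow> j \<in> I \<Longrightarrow> B' i j = (\<Sum>k\<in>I. v i k * cnj (v j k))" by blast
  \<comment> \<open>Coordinate \<open>m\<close> carries the normalised pivot column, the others the
    factorisation of \<open>B'\<close>.\<close>
  define w where "w = (\<lambda>i k. if k = m then B i m / of_real (sqrt b) else if i = m then 0 else v i k)"
  have sb: "complex_of_real (sqrt b) * of_real (sqrt b) = of_real b"
    using b0 by (simp flip: of_real_mult)
  have "B i j = (\<Sum>k\<in>insert m I. w i k * cnj (w j k))" if ij: "i \<in> insert m I" "j \<in> insert m I" for i j
  proof -
    have "(\<Sum>k\<in>insert m I. w i k * cnj (w j k)) = B i m * cnj (B j m) / of_real b + (\<Sum>k\<in>I. w i k * cnj (w j k))"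
      using insert.hyps by (simp add: w_def sb)
    also have "(\<Sum>k\<in>I. w i k * cnj (w j k)) = (if i = m \<or> j = m then 0 else B' i j)"
      using ij v[of i j] insert.hyps by (auto simp: w_def intro!: sum.neutral sum.cong)
    also have "B i m * cnj (B j m) / of_real b + (if i = m \<or> j = m then 0 else B' i j) = B i j"
    proof (cases "i = m \<or> j = m")
      case False
      then show ?thesis by (simp add: B'_def)
    next
      case True
      show ?thesis
      proof (cases "b = 0")
        case False
        from True show ?thesis
        proof
          assume "i = m"
          then show ?thesis using False bm herm[of j m] by simp
        next
          assume "j = m"
          then show ?thesis using False bm by simp
        qed
      next
        case b: True
        have "B k m = 0 \<and> B m k = 0" if "k \<in> insert m I" for k
        proof -
          have "B k m = 0" using zero[OF b] that bm b by auto
          then show ?thesis using herm[of k m] by simp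
        qed
        then show ?thesis using True ij b by auto
      qed
    qed
    finally show ?thesis by simp
  qed
  then show ?case by blast
next
  case empty
  show ?case by simp
qed

definition ip :: "'a set \<Rightarrow> ('a \<Rightarrow> complex) \<Rightarrow> ('a \<Rightarrow> complex) \<Rightarrow> complex" where
  "ip A x y = (\<Sum>a\<in>A. x a * cnj (y a))"

lemma ip_diff_left: "ip A (\<lambda>a. x a - y a) z = ip A x z - ip A y z"
  by (simp add: ip_def left_diff_distrib sum_subtractf)

lemma ip_diff_right: "ip A z (\<lambda>a. x a - y a) = ip A z x - ip A z y"
  by (simp add: ip_def right_diff_distrib sum_subtractf)

lemma ip_scale_left: "ip A (\<lambda>a. s * x a) z = s * ip A x z"
  by (simp add: ip_def sum_distrib_left mult_ac)

lemma ip_scale_right: "ip A z (\<lambda>a. s * x a) = cnj s * ip A z x"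
  by (simp add: ip_def sum_distrib_left mult_ac)

lemma ip_sum_left: "ip A (\<lambda>a. \<Sum>k\<in>K. s k * x k a) z = (\<Sum>k\<in>K. s k * ip A (x k) z)"
  unfolding ip_def sum_distrib_right sum_distrib_left by (subst sum.swap) (simp add: mult_ac)

lemma ip_sum_right: "ip A z (\<lambda>a. \<Sum>k\<in>K. s k * x k a) = (\<Sum>k\<in>K. cnj (s k) * ip A z (x k))"
  unfolding ip_def cnj_sum sum_distrib_right sum_distrib_left by (subst sum.swap) (simp add: mult_ac)

lemma ip_commute: "ip A y x = cnj (ip A x y)"
  by (simp add: ip_def cnj_sum mult.commute)

lemma ip_cong: "(\<And>a. a \<in> A \<Longrightarrow> x a = x' a) \<Longrightarrow> (\<And>a. a \<in> A \<Longrightarrow> y a = y' a) \<Longrightarrow> ip A x y = ip A x' y'"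
  by (simp add: ip_def)

lemma ip_self: "ip A x x = of_real (\<Sum>a\<in>A. (cmod (x a))\<^sup>2)"
  by (simp add: ip_def complex_norm_square del: of_real_power)

lemma ip_self_eq_0: "finite A \<Longrightarrow> ip A x x = 0 \<Longrightarrow> a \<in> A \<Longrightarrow> x a = 0"
  unfolding ip_self of_real_eq_0_iff by (subst (asm) sum_nonneg_eq_0_iff) auto

text \<open>An isometry between spans in a finite-dimensional space, extended by zero on the orthogonal complement.\<close>

lemma isometry_extension:
  assumes A: "finite A" and J: "finite J"
    and gram: "\<And>i j. i \<in> J \<Longrightarrow> j \<in> J \<Longrightarrow> ip A (e i) (e j) = ip A (d i) (d j)"
  shows "\<exists>W. (\<forall>x. (\<Sum>b\<in>A. (cmod (\<Sum>a\<in>A. W b a * x a))\<^sup>2) \<le> (\<Sum>a\<in>A. (cmod (x a))\<^sup>2)) \<and>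
             (\<forall>i\<in>J. \<forall>b\<in>A. (\<Sum>a\<in>A. W b a * e i a) = d i b)"
proof -
  \<comment> \<open>The linear extension of \<open>e i -> d i\<close> is kept as a relation because
    the \<open>e i\<close> may be dependent; equal Gram matrices make it isometric, hence
    single-valued on \<open>A\<close>.\<close>
  define L where "L = {(x, y). \<exists>s. x = (\<lambda>a. \<Sum>j\<in>J. s j * e j a) \<and> y = (\<lambda>a. \<Sum>j\<in>J. s j * d j a)}"
  have L_isom: "ip A x x' = ip A y y'" if "(x,y) \<in> L" "(x',y') \<in> L" for x y x' y'
    using that unfolding L_def by (auto simp: ip_sum_left ip_sum_right gram)
  have L_scale: "((\<lambda>a. s * x a), (\<lambda>a. s * y a)) \<in> L" if "(x,y) \<in> L" for s x y
    using that unfolding L_def by (auto simp: sum_distrib_left mult.assoc[symmetric])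
  have L_diff: "((\<lambda>a. x a - x' a), (\<lambda>a. y a - y' a)) \<in> L" if "(x,y) \<in> L" "(x',y') \<in> L" for x y x' y'
  proof -
    from that(1) obtain s where s: "x = (\<lambda>a. \<Sum>j\<in>J. s j * e j a)" "y = (\<lambda>a. \<Sum>j\<in>J. s j * d j a)"
      unfolding L_def by blast
    from that(2) obtain s' where s': "x' = (\<lambda>a. \<Sum>j\<in>J. s' j * e j a)" "y' = (\<lambda>a. \<Sum>j\<in>J. s' j * d j a)"
      unfolding L_def by blast
    show ?thesis unfolding L_def s s'
      by (auto intro!: exI[of _ "\<lambda>j. s j - s' j"] simp: left_diff_distrib sum_subtractf)
  qed
  have L_0: "((\<lambda>a. 0), (\<lambda>a. 0)) \<in> L" unfolding L_def by (auto intro!: exI[of _ "\<lambda>_. 0"])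
  have L_sum: "((\<lambda>a. \<Sum>k\<in>K. s k * x k a), (\<lambda>a. \<Sum>k\<in>K. s k * y k a)) \<in> L"
    if "finite K" "\<And>k. k \<in> K \<Longrightarrow> (x k, y k) \<in> L" for K s x y
    using that
  proof (induction K rule: finite_induct)
    case empty
    show ?case using L_0 by simp
  next
    case (insert k K)
    have "((\<lambda>a. s k * x k a - (-1) * (\<Sum>k\<in>K. s k * x k a)), (\<lambda>a. s k * y k a - (-1) * (\<Sum>k\<in>K. s k * y k a))) \<in> L"
      using insert by (intro L_diff L_scale) auto
    then show ?case using insert.hyps by simp
  qed
  have L_e: "(e i, d i) \<in> L" if "i \<in> J" for i
  proof -
    have "(\<Sum>j\<in>J. (if j = i then 1 else 0) * x j) = x i" for x :: "_ \<Rightarrow> complex"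
      using that J by (simp add: if_distrib[of "\<lambda>x. x * _"] cong: if_cong)
    then show ?thesis unfolding L_def by (auto intro!: exI[of _ "\<lambda>j. if j = i then 1 else 0"])
  qed
  define good where "good = (\<lambda>I E D. (\<forall>k\<in>I. (E k, D k) \<in> L) \<and> (\<forall>k\<in>I. \<forall>l\<in>I. k \<noteq> l \<longrightarrow> ip A (E k) (E l) = 0) \<and>
      (\<forall>k\<in>I. ip A (E k) (E k) = 0 \<or> ip A (E k) (E k) = 1) \<and>
      (\<forall>i\<in>I. \<forall>a\<in>A. e i a = (\<Sum>k\<in>I. ip A (e i) (E k) * E k a)))"
  have goodD: "k \<in> I \<Longrightarrow> (E k, D k) \<in> L"
      "k \<in> I \<Longrightarrow> l \<in> I \<Longrightarrow> k \<noteq> l \<Longrightarrow> ip A (E k) (E l) = 0"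
      "k \<in> I \<Longrightarrow> ip A (E k) (E k) = 0 \<or> ip A (E k) (E k) = 1"
      "k \<in> I \<Longrightarrow> a \<in> A \<Longrightarrow> e k a = (\<Sum>l\<in>I. ip A (e k) (E l) * E l a)"
    if good: "good I E D" for I E D k l a
  proof -
    note g = good[unfolded good_def]
    show "k \<in> I \<Longrightarrow> (E k, D k) \<in> L" using conjunct1[OF g] by blast
    show "k \<in> I \<Longrightarrow> l \<in> I \<Longrightarrow> k \<noteq> l \<Longrightarrow> ip A (E k) (E l) = 0"
      using conjunct1[OF conjunct2[OF g]] by blast
    show "k \<in> I \<Longrightarrow> ip A (E k) (E k) = 0 \<or> ip A (E k) (E k) = 1"
      using conjunct1[OF conjunct2[OF conjunct2[OF g]]] by blast
    show "k \<in> I \<Longrightarrow> a \<in> A \<Longrightarrow> e k a = (\<Sum>l\<in>I. ip A (e k) (E l) * E l a)"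
      by (rule bspec[OF bspec[OF conjunct2[OF conjunct2[OF conjunct2[OF g]]]]])
  qed
  have "\<exists>E D. good I E D" if "I \<subseteq> J" for I
    using finite_subset[OF that J] that
  proof (induction I rule: finite_induct)
    case (insert m I)
    then obtain E D where "good I E D" by blast
    note L = goodD(1)[OF this] and orth = goodD(2)[OF this] and unit = goodD(3)[OF this] and exp = goodD(4)[OF this]
    define r where "r = (\<lambda>a. e m a - (\<Sum>k\<in>I. ip A (e m) (E k) * E k a))"
    define r' where "r' = (\<lambda>a. d m a - (\<Sum>k\<in>I. ip A (e m) (E k) * D k a))"
    have rL: "(r, r') \<in> L" unfolding r_def r'_def
      using insert by (intro L_diff L_sum L L_e) auto
    have Er: "ip A (E l) r = 0" if l: "l \<in> I" for l
    proof -
      have "ip A (E l) r = ip A (E l) (e m) - (\<Sum>k\<in>I. cnj (ip A (e m) (E k)) * ip A (E l) (E k))"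
        unfolding r_def by (simp add: ip_diff_right ip_sum_right)
      also have "(\<Sum>k\<in>I. cnj (ip A (e m) (E k)) * ip A (E l) (E k))
        = (\<Sum>k\<in>I. if k = l then cnj (ip A (e m) (E l)) * ip A (E l) (E l) else 0)"
        using orth l by (intro sum.cong) auto
      also have "\<dots> = ip A (E l) (e m) * ip A (E l) (E l)"
        using l insert.hyps ip_commute[of A "E l" "e m"] by simp
      also have "ip A (E l) (e m) - ip A (E l) (e m) * ip A (E l) (E l) = 0"
        using unit[OF l]
      proof
        assume "ip A (E l) (E l) = 0"
        then have "ip A (E l) (e m) = 0"
          using ip_self_eq_0[OF A] unfolding ip_def[of A "E l" "e m"] by (intro sum.neutral) auto
        then show ?thesis by simp
      qed simp
      finally show ?thesis .
    qed
    have er: "ip A (e i) r = 0" if i: "i \<in> I" for i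
    proof -
      have "ip A (e i) r = ip A (\<lambda>a. \<Sum>k\<in>I. ip A (e i) (E k) * E k a) r"
        by (intro ip_cong exp[OF i] refl)
      then show ?thesis by (simp add: ip_sum_left Er)
    qed
    define N where "N = (\<Sum>a\<in>A. (cmod (r a))\<^sup>2)"
    have N: "ip A r r = of_real N" "N \<ge> 0" unfolding N_def ip_self by (auto intro: sum_nonneg)
    have mr: "ip A (e m) r = of_real N"
    proof -
      have "ip A r r = ip A (e m) r - (\<Sum>k\<in>I. ip A (e m) (E k) * ip A (E k) r)"
        by (subst (1) r_def) (simp add: ip_diff_left ip_sum_left)
      then show ?thesis using N Er by simp
    qed
    \<comment> \<open>For \<open>N = 0\<close> this is 0, since \<open>1 / 0 = 0\<close>, and the
      new pair consists of zero vectors.\<close>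
    define \<nu> where "\<nu> = complex_of_real (1 / sqrt N)"
    define E' where "E' = E(m := (\<lambda>a. \<nu> * r a))"
    define D' where "D' = D(m := (\<lambda>a. \<nu> * r' a))"
    have mI: "m \<notin> I" by (rule insert.hyps)
    then have EI: "E' k = E k" "D' k = D k" if "k \<in> I" for k using that by (auto simp: E'_def D'_def)
    have Em: "E' m = (\<lambda>a. \<nu> * r a)" "D' m = (\<lambda>a. \<nu> * r' a)" by (simp_all add: E'_def D'_def)
    have \<nu>N: "\<nu> * cnj \<nu> * of_real N = (if N = 0 then 0 else 1)"
      using N(2) by (simp add: \<nu>_def flip: of_real_mult)
    show ?case
      unfolding good_def
    proof (rule exI[of _ E'], rule exI[of _ D'], intro conjI ballI impI)
      show "(E' k, D' k) \<in> L" if "k \<in> insert m I" for k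
        using that L EI Em L_scale[OF rL] by auto
      show "ip A (E' k) (E' l) = 0" if "k \<in> insert m I" "l \<in> insert m I" "k \<noteq> l" for k l
        using that orth Er ip_commute[of A _ r] by (auto simp: EI Em ip_scale_left ip_scale_right)
      show "ip A (E' k) (E' k) = 0 \<or> ip A (E' k) (E' k) = 1" if "k \<in> insert m I" for k
      proof (cases "k = m")
        case True
        have "ip A (E' m) (E' m) = \<nu> * cnj \<nu> * of_real N"
          by (simp add: Em ip_scale_left ip_scale_right N)
        then show ?thesis using \<nu>N True by simp
      next
        case False
        then show ?thesis using that unit[of k] EI by simp
      qed
      fix i a assume i: "i \<in> insert m I" and a: "a \<in> A"
      have split: "(\<Sum>k\<in>insert m I. ip A (e i) (E' k) * E' k a)
          = ip A (e i) (E' m) * E' m a + (\<Sum>k\<in>I. ip A (e i) (E k) * E k a)"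
        using insert.hyps EI by simp
      show "e i a = (\<Sum>k\<in>insert m I. ip A (e i) (E' k) * E' k a)"
      proof (cases "i = m")
        case False
        then show ?thesis unfolding split using i exp[of i a] er a by (auto simp: Em ip_scale_right)
      next
        case True
        have "ip A (e m) (E' m) * E' m a = (\<nu> * cnj \<nu> * of_real N) * r a"
          by (simp add: Em ip_scale_right mr mult_ac)
        also have "\<dots> = r a"
          unfolding \<nu>N using ip_self_eq_0[OF A _ a, of r] N by auto
        finally show ?thesis unfolding split unfolding True by (simp add: r_def)
      qed
    qed
  qed (simp add: good_def)
  from this[OF order_refl] obtain E D where "good J E D" by blast
  note L = goodD(1)[OF this] and orth = goodD(2)[OF this] and unit = goodD(3)[OF this] and exp = goodD(4)[OF this]
  \<comment> \<open>Orthogonal projection onto the span of the \<open>E k\<close>, followed by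
    \<open>E k -> D k\<close>.\<close>
  define W where "W = (\<lambda>b a. \<Sum>k\<in>J. cnj (E k a) * D k b)"
  have W: "(\<Sum>a\<in>A. W b a * x a) = (\<Sum>k\<in>J. ip A x (E k) * D k b)" for b x
    unfolding W_def ip_def sum_distrib_right by (subst sum.swap) (simp add: mult_ac)
  have diag: "(\<Sum>l\<in>J. g l * ip A (E k) (E l)) = g k * ip A (E k) (E k)" if "k \<in> J" for g k
  proof -
    have "(\<Sum>l\<in>J. g l * ip A (E k) (E l)) = (\<Sum>l\<in>J. if l = k then g k * ip A (E k) (E k) else 0)"
      using orth that by (intro sum.cong) auto
    then show ?thesis using that J by simp
  qed
  have nul: "ip A x (E k) * ip A (E k) (E k) = ip A x (E k)" if k: "k \<in> J" for x k
    using unit[OF k]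
  proof
    assume "ip A (E k) (E k) = 0"
    then have "ip A x (E k) = 0"
      using ip_self_eq_0[OF A] unfolding ip_def[of A x] by (intro sum.neutral) auto
    then show ?thesis by simp
  qed simp
  show ?thesis
  proof (intro exI[of _ W] conjI allI ballI)
    fix x
    let ?P = "\<lambda>a. \<Sum>k\<in>J. ip A x (E k) * E k a" and ?V = "\<lambda>b. \<Sum>k\<in>J. ip A x (E k) * D k b"
    have PV: "(?P, ?V) \<in> L" by (intro L_sum J L)
    have VP: "ip A ?V ?V = ip A ?P ?P" by (rule L_isom[OF PV PV, symmetric])
    have PP: "ip A ?P ?P = (\<Sum>k\<in>J. ip A x (E k) * cnj (ip A x (E k)))"
      unfolding ip_sum_left ip_sum_right
    proof (rule sum.cong[OF refl])
      fix k assume k: "k \<in> J"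
      show "ip A x (E k) * (\<Sum>l\<in>J. cnj (ip A x (E l)) * ip A (E k) (E l)) = ip A x (E k) * cnj (ip A x (E k))"
        unfolding diag[OF k] using nul[OF k, of x] by (metis mult.commute mult.left_commute)
    qed
    have xP: "ip A x ?P = (\<Sum>k\<in>J. ip A x (E k) * cnj (ip A x (E k)))"
      unfolding ip_sum_right by (simp add: mult.commute)
    have "ip A (\<lambda>a. x a - ?P a) (\<lambda>a. x a - ?P a) = ip A x x - ip A ?P ?P"
      unfolding ip_diff_left ip_diff_right using PP xP ip_commute[of A ?P x] ip_commute[of A ?P ?P] by simp
    then have "ip A ?V ?V + ip A (\<lambda>a. x a - ?P a) (\<lambda>a. x a - ?P a) = ip A x x" using VP by simp
    then have "(\<Sum>a\<in>A. (cmod (?V a))\<^sup>2) + (\<Sum>a\<in>A. (cmod (x a - ?P a))\<^sup>2) = (\<Sum>a\<in>A. (cmod (x a))\<^sup>2)"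
      unfolding ip_self of_real_add[symmetric] of_real_eq_iff .
    moreover have "0 \<le> (\<Sum>a\<in>A. (cmod (x a - ?P a))\<^sup>2)" by (intro sum_nonneg) auto
    ultimately show "(\<Sum>b\<in>A. (cmod (\<Sum>a\<in>A. W b a * x a))\<^sup>2) \<le> (\<Sum>a\<in>A. (cmod (x a))\<^sup>2)"
      unfolding W by linarith
  next
    fix i b assume i: "i \<in> J" and b: "b \<in> A"
    \<comment> \<open>The residual of \<open>e i\<close> vanishes on \<open>A\<close>, so its
      partner in \<open>L\<close> has norm 0; this identifies \<open>d i\<close> with the image of
      \<open>e i\<close>.\<close>
    let ?x = "\<lambda>a. e i a - (\<Sum>k\<in>J. ip A (e i) (E k) * E k a)" and ?y = "\<lambda>a. d i a - (\<Sum>k\<in>J. ip A (e i) (E k) * D k a)"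
    have xy: "(?x, ?y) \<in> L" by (intro L_diff L_e L_sum J L i)
    have "ip A ?y ?y = ip A ?x ?x" by (rule L_isom[OF xy xy, symmetric])
    also have "\<dots> = 0" unfolding ip_def[of A ?x ?x] using exp[OF i] by (intro sum.neutral) auto
    finally have "?y b = 0" using ip_self_eq_0[OF A _ b, of ?y] by blast
    then show "(\<Sum>a\<in>A. W b a * e i a) = d i b" unfolding W by simp
  qed
qed

section \<open>Interpolation by a transfer function\<close>

text \<open>Neumann series for \<open>s = W (\<xi> + z Q s)\<close>, where \<open>Q\<close> keeps
  the state coordinates in \<open>H\<close>. As \<open>W\<close> is a contraction, all coefficients
  \<open>u k\<close> are bounded by the norm of \<open>\<xi>\<close>, so the series converges in the
  disc.\<close>

lemma transfer_function:
  fixes W :: "'a \<Rightarrow> 'a \<Rightarrow> complex" and \<xi> :: "'a \<Rightarrow> complex"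
  assumes A: "finite A"
    and W: "\<And>x. (\<Sum>b\<in>A. (cmod (\<Sum>a\<in>A. W b a * x a))\<^sup>2) \<le> (\<Sum>a\<in>A. (cmod (x a))\<^sup>2)"
  shows "\<exists>s. (\<forall>a\<in>A. s a holomorphic_on ball 0 1) \<and>
    (\<forall>z\<in>ball 0 1. \<forall>b\<in>A. s b z = (\<Sum>a\<in>A. W b a * (\<xi> a + z * (if a \<in> H then s a z else 0))))"
proof -
  define V where "V = (\<lambda>x b. \<Sum>a\<in>A. W b a * x a)"
  define Q where "Q = (\<lambda>x a. if a \<in> H then x a else (0::complex))"
  define u where "u = (\<lambda>k. ((\<lambda>x. V (Q x)) ^^ k) (V \<xi>))"
  have u_Suc: "u (Suc k) = V (Q (u k))" and u_0: "u 0 = V \<xi>" for k by (simp_all add: u_def)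
  define B where "B = (\<Sum>a\<in>A. (cmod (\<xi> a))\<^sup>2)"
  have B0: "B \<ge> 0" unfolding B_def by (intro sum_nonneg) auto
  have norm_u: "(\<Sum>a\<in>A. (cmod (u k a))\<^sup>2) \<le> B" for k
  proof (induction k)
    case 0
    show ?case unfolding u_0 V_def B_def by (rule W)
  next
    case (Suc k)
    have "(\<Sum>a\<in>A. (cmod (u (Suc k) a))\<^sup>2) \<le> (\<Sum>a\<in>A. (cmod (Q (u k) a))\<^sup>2)"
      unfolding u_Suc V_def by (rule W)
    also have "\<dots> \<le> (\<Sum>a\<in>A. (cmod (u k a))\<^sup>2)" by (intro sum_mono) (auto simp: Q_def)
    finally show ?case using Suc by linarith
  qed
  have bound: "cmod (u k a) \<le> sqrt B" if "a \<in> A" for k a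
  proof (rule real_le_rsqrt)
    have "(cmod (u k a))\<^sup>2 \<le> (\<Sum>a\<in>A. (cmod (u k a))\<^sup>2)" by (rule member_le_sum[OF that _ A]) auto
    then show "(cmod (u k a))\<^sup>2 \<le> B" using norm_u[of k] by linarith
  qed
  define s where "s = (\<lambda>a z. \<Sum>k. u k a * z ^ k)"
  have summable: "summable (\<lambda>k. u k a * z ^ k)" if "a \<in> A" "cmod z < 1" for a z
  proof (rule summable_comparison_test')
    show "summable (\<lambda>k. sqrt B * cmod z ^ k)" using that by (intro summable_mult summable_geometric) auto
    show "norm (u k a * z ^ k) \<le> sqrt B * cmod z ^ k" if "k \<ge> 0" for k
      unfolding norm_mult norm_power by (intro mult_right_mono bound \<open>a \<in> A\<close>) auto
  qed
  have hol: "s a holomorphic_on ball 0 1" if "a \<in> A" for a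
  proof (rule power_series_holomorphic)
    show "(\<lambda>k. u k a * (z - 0) ^ k) sums s a z" if "z \<in> ball 0 1" for z
      unfolding s_def using summable[OF \<open>a \<in> A\<close>, of z] that by (simp add: summable_sums)
  qed
  have eq: "s b z = (\<Sum>a\<in>A. W b a * (\<xi> a + z * (if a \<in> H then s a z else 0)))"
    if "cmod z < 1" "b \<in> A" for b z
  proof -
    have sums: "(\<lambda>k. Q (u k) a * z ^ k) sums Q (\<lambda>a. s a z) a" if "a \<in> A" for a
      using summable_sums[OF summable[OF that \<open>cmod z < 1\<close>]] by (simp add: Q_def s_def)
    have "(\<lambda>k. z * (\<Sum>a\<in>A. W b a * (Q (u k) a * z ^ k))) sums (z * (\<Sum>a\<in>A. W b a * Q (\<lambda>a. s a z) a))"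
      by (intro sums_mult sums_sum sums)
    moreover have "z * (\<Sum>a\<in>A. W b a * (Q (u k) a * z ^ k)) = u (Suc k) b * z ^ Suc k" for k
      unfolding u_Suc V_def by (simp add: sum_distrib_left sum_distrib_right mult_ac)
    ultimately have "(\<lambda>k. u (Suc k) b * z ^ Suc k) sums (z * (\<Sum>a\<in>A. W b a * Q (\<lambda>a. s a z) a))" by simp
    then have "(\<lambda>k. u k b * z ^ k) sums (z * (\<Sum>a\<in>A. W b a * Q (\<lambda>a. s a z) a) + u 0 b * z ^ 0)"
      by (subst (asm) sums_Suc_iff) simp
    then have "s b z = z * (\<Sum>a\<in>A. W b a * Q (\<lambda>a. s a z) a) + V \<xi> b"
      using sums_unique by (fastforce simp: u_0 s_def)
    also have "\<dots> = (\<Sum>a\<in>A. W b a * (\<xi> a + z * Q (\<lambda>a. s a z) a))"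
      by (simp add: V_def sum_distrib_left sum.distrib distrib_left mult_ac)
    finally show ?thesis by (simp add: Q_def)
  qed
  show ?thesis using hol eq by (intro exI[of _ s]) auto
qed

text \<open>A lurking isometry. Factor the positive kernel as inner products of vectors
  \<open>v i\<close> and clear the denominators: then
  \<open>(F i, T i, z i v i) -> (sqrt \<mu>, 0, v i)\<close> preserves inner products. The transfer
  function of a contractive extension solves the interpolation problem.\<close>

lemma leech_finite:
  fixes F T z :: "nat \<Rightarrow> complex" and \<mu> :: real
  assumes z: "\<And>i. i < n \<Longrightarrow> cmod (z i) < 1" and \<mu>: "\<mu> \<ge> 0"
    and psd: "\<And>c. 0 \<le> Re (\<Sum>i<n. \<Sum>j<n. c i * cnj (c j) *
        ((F i * cnj (F j) + T i * cnj (T j) - of_real \<mu>) / (1 - z i * cnj (z j))))"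
  shows "\<exists>g h. g holomorphic_on ball 0 1 \<and> h holomorphic_on ball 0 1 \<and>
    (\<forall>w\<in>ball 0 1. (cmod (g w))\<^sup>2 + (cmod (h w))\<^sup>2 \<le> 1) \<and>
    (\<forall>i<n. F i * g (z i) + T i * h (z i) = of_real (sqrt \<mu>))"
proof -
  define B where "B = (\<lambda>i j. (F i * cnj (F j) + T i * cnj (T j) - of_real \<mu>) / (1 - z i * cnj (z j)))"
  obtain v where v: "\<And>i j. i < n \<Longrightarrow> j < n \<Longrightarrow> B i j = (\<Sum>k<n. v i k * cnj (v j k))"
    using psd_imp_gram[of "{..<n}" B] psd by (auto simp: B_def mult_ac)
  define A where "A = {..<n+2}"
  have A: "finite A" "0 \<in> A" "1 \<in> A" by (auto simp: A_def)
  have sumA: "(\<Sum>a\<in>A. g a) = g 0 + g 1 + (\<Sum>k<n. g (k+2))" for g :: "nat \<Rightarrow> complex"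
    unfolding A_def by (simp add: sum.lessThan_Suc_shift del: sum.lessThan_Suc add: add.assoc)
  \<comment> \<open>Coordinates 0 and 1 are the inputs, the others the state. The 0 in coordinate 1
    of \<open>d\<close> pads the single output so that \<open>W\<close> acts on one space.\<close>
  define e where "e = (\<lambda>i a. if a = 0 then F i else if a = 1 then T i else z i * v i (a - 2))"
  define d where "d = (\<lambda>i a. if a = 0 then of_real (sqrt \<mu>) else if a = 1 then 0 else v i (a - 2))"
  have gram: "ip A (e i) (e j) = ip A (d i) (d j)" if "i \<in> {..<n}" "j \<in> {..<n}" for i j
  proof -
    have "cmod (z i * cnj (z j)) < 1"
      using z[of i] z[of j] that by (simp add: norm_mult) (smt (verit) mult_left_le_one_le norm_ge_zero)
    then have nz: "1 - z i * cnj (z j) \<noteq> 0" by auto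
    have "ip A (e i) (e j) = F i * cnj (F j) + T i * cnj (T j) + z i * cnj (z j) * (\<Sum>k<n. v i k * cnj (v j k))"
      unfolding ip_def sumA by (simp add: e_def sum_distrib_left mult_ac)
    also have "\<dots> = of_real \<mu> + (\<Sum>k<n. v i k * cnj (v j k))"
      using v[of i j] that nz by (simp add: B_def field_simps)
    also have "of_real \<mu> = of_real (sqrt \<mu>) * complex_of_real (sqrt \<mu>)"
      using \<mu> by (simp flip: of_real_mult)
    also have "of_real (sqrt \<mu>) * complex_of_real (sqrt \<mu>) + (\<Sum>k<n. v i k * cnj (v j k)) = ip A (d i) (d j)"
      unfolding ip_def sumA by (simp add: d_def)
    finally show ?thesis .
  qed
  obtain W where W: "\<And>x. (\<Sum>b\<in>A. (cmod (\<Sum>a\<in>A. W b a * x a))\<^sup>2) \<le> (\<Sum>a\<in>A. (cmod (x a))\<^sup>2)"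
    and Wed: "\<And>i b. i < n \<Longrightarrow> b \<in> A \<Longrightarrow> (\<Sum>a\<in>A. W b a * e i a) = d i b"
  proof -
    have "\<exists>W. (\<forall>x. (\<Sum>b\<in>A. (cmod (\<Sum>a\<in>A. W b a * x a))\<^sup>2) \<le> (\<Sum>a\<in>A. (cmod (x a))\<^sup>2)) \<and>
        (\<forall>i\<in>{..<n}. \<forall>b\<in>A. (\<Sum>a\<in>A. W b a * e i a) = d i b)"
      by (rule isometry_extension[OF A(1) finite_lessThan gram])
    then show thesis using that by (meson lessThan_iff)
  qed
  define H where "H = {a::nat. a \<ge> 2}"
  \<comment> \<open>The responses \<open>s0\<close> and \<open>s1\<close> to the two unit inputs;
    their output coordinate 0 becomes \<open>g\<close> and \<open>h\<close>.\<close>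
  obtain s0 where s0: "\<And>a. a \<in> A \<Longrightarrow> s0 a holomorphic_on ball 0 1"
    and s0_eq: "\<And>w b. w \<in> ball 0 1 \<Longrightarrow> b \<in> A \<Longrightarrow>
      s0 b w = (\<Sum>a\<in>A. W b a * ((if a = 0 then 1 else 0) + w * (if a \<in> H then s0 a w else 0)))"
    using transfer_function[OF A(1) W, where \<xi> = "\<lambda>a. if a = 0 then 1 else 0" and H = H] by blast
  obtain s1 where s1: "\<And>a. a \<in> A \<Longrightarrow> s1 a holomorphic_on ball 0 1"
    and s1_eq: "\<And>w b. w \<in> ball 0 1 \<Longrightarrow> b \<in> A \<Longrightarrow>
      s1 b w = (\<Sum>a\<in>A. W b a * ((if a = 1 then 1 else 0) + w * (if a \<in> H then s1 a w else 0)))"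
    using transfer_function[OF A(1) W, where \<xi> = "\<lambda>a. if a = 1 then 1 else 0" and H = H] by blast
  let ?S = "\<lambda>\<alpha> \<beta> w a. \<alpha> * s0 a w + \<beta> * s1 a w"
  let ?Z = "\<lambda>\<alpha> \<beta> a. if a = 0 then \<alpha> else if a = 1 then \<beta> else (0::complex)"
  have S_eq: "?S \<alpha> \<beta> w b = (\<Sum>a\<in>A. W b a * (?Z \<alpha> \<beta> a + w * (if a \<in> H then ?S \<alpha> \<beta> w a else 0)))"
    if w: "w \<in> ball 0 1" and b: "b \<in> A" for \<alpha> \<beta> w b
    unfolding s0_eq[OF w b] s1_eq[OF w b] sum_distrib_left sum.distrib[symmetric]
    by (rule sum.cong) (auto simp: algebra_simps)
  have normA: "(\<Sum>a\<in>A. (cmod (x a))\<^sup>2) = (cmod (x 0))\<^sup>2 + (cmod (x 1))\<^sup>2 + (\<Sum>k<n. (cmod (x (k+2)))\<^sup>2)" for x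
    unfolding A_def by (simp add: sum.lessThan_Suc_shift del: sum.lessThan_Suc add: add.assoc)
  \<comment> \<open>Energy balance: the state energy on the right carries the factor
    \<open>|w|^2 \<le> 1\<close> and is absorbed by the state energy on the left.\<close>
  have S_norm: "(cmod (?S \<alpha> \<beta> w 0))\<^sup>2 \<le> (cmod \<alpha>)\<^sup>2 + (cmod \<beta>)\<^sup>2" if w: "w \<in> ball 0 1" for \<alpha> \<beta> w
  proof -
    let ?t = "\<Sum>k<n. (cmod (?S \<alpha> \<beta> w (k+2)))\<^sup>2"
    have "(\<Sum>b\<in>A. (cmod (?S \<alpha> \<beta> w b))\<^sup>2)
        = (\<Sum>b\<in>A. (cmod (\<Sum>a\<in>A. W b a * (?Z \<alpha> \<beta> a + w * (if a \<in> H then ?S \<alpha> \<beta> w a else 0))))\<^sup>2)"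
      by (rule sum.cong[OF refl]) (simp only: S_eq[OF w])
    also have "\<dots> \<le> (\<Sum>a\<in>A. (cmod (?Z \<alpha> \<beta> a + w * (if a \<in> H then ?S \<alpha> \<beta> w a else 0)))\<^sup>2)" by (rule W)
    also have "\<dots> = (cmod \<alpha>)\<^sup>2 + (cmod \<beta>)\<^sup>2 + (cmod w)\<^sup>2 * ?t"
      unfolding normA by (simp add: H_def norm_mult power_mult_distrib sum_distrib_left)
    also have "(cmod w)\<^sup>2 * ?t \<le> ?t"
      using w by (intro mult_left_le_one_le sum_nonneg) (auto simp: power_le_one)
    finally show ?thesis unfolding normA[of "\<lambda>b. ?S \<alpha> \<beta> w b"] using zero_le_power2[of "cmod (?S \<alpha> \<beta> w 1)"] by linarith
  qed
  have interp: "?S (F i) (T i) (z i) 0 = of_real (sqrt \<mu>)" if i: "i < n" for i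
  proof -
    have zi: "z i \<in> ball 0 1" using z[OF i] by simp
    \<comment> \<open>The response at \<open>z i\<close> to the input \<open>(F i, T i)\<close> and
      the vector \<open>d i\<close> solve the same fixed point equation, so their difference is
      shrunk by the factor \<open>|z i| < 1\<close>.\<close>
    define \<Delta> where "\<Delta> = (\<lambda>b. ?S (F i) (T i) (z i) b - d i b)"
    have "\<Delta> b = (\<Sum>a\<in>A. W b a * (z i * (if a \<in> H then \<Delta> a else 0)))" if b: "b \<in> A" for b
    proof -
      have "\<Delta> b = (\<Sum>a\<in>A. W b a * (?Z (F i) (T i) a + z i * (if a \<in> H then ?S (F i) (T i) (z i) a else 0)))
         - (\<Sum>a\<in>A. W b a * e i a)"
        unfolding \<Delta>_def Wed[OF i b] by (subst S_eq[OF zi b]) (rule refl)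
      also have "\<dots> = (\<Sum>a\<in>A. W b a * (z i * (if a \<in> H then \<Delta> a else 0)))"
        unfolding sum_subtractf[symmetric]
      proof (rule sum.cong[OF refl])
        fix a :: nat
        consider "a = 0" | "a = 1" | "a \<ge> 2" by linarith
        then show "W b a * (?Z (F i) (T i) a + z i * (if a \<in> H then ?S (F i) (T i) (z i) a else 0)) - W b a * e i a
          = W b a * (z i * (if a \<in> H then \<Delta> a else 0))"
          by cases (auto simp: H_def e_def d_def \<Delta>_def algebra_simps)
      qed
      finally show ?thesis .
    qed
    then have "(\<Sum>b\<in>A. (cmod (\<Delta> b))\<^sup>2) = (\<Sum>b\<in>A. (cmod (\<Sum>a\<in>A. W b a * (z i * (if a \<in> H then \<Delta> a else 0))))\<^sup>2)"
      by (intro sum.cong refl arg_cong[where f = "\<lambda>x. (cmod x)\<^sup>2"])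
    also have "\<dots> \<le> (\<Sum>a\<in>A. (cmod (z i * (if a \<in> H then \<Delta> a else 0)))\<^sup>2)" by (rule W)
    also have "\<dots> \<le> (\<Sum>a\<in>A. (cmod (z i))\<^sup>2 * (cmod (\<Delta> a))\<^sup>2)"
      by (intro sum_mono) (auto simp: norm_mult power_mult_distrib)
    also have "\<dots> = (cmod (z i))\<^sup>2 * (\<Sum>a\<in>A. (cmod (\<Delta> a))\<^sup>2)" by (simp add: sum_distrib_left)
    finally have "(1 - (cmod (z i))\<^sup>2) * (\<Sum>a\<in>A. (cmod (\<Delta> a))\<^sup>2) \<le> 0" by (simp add: algebra_simps)
    moreover have "1 - (cmod (z i))\<^sup>2 > 0" using z[OF i] by (simp add: power_less_one_iff)
    ultimately have "(\<Sum>a\<in>A. (cmod (\<Delta> a))\<^sup>2) \<le> 0" by (simp add: mult_le_0_iff)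
    moreover have "(cmod (\<Delta> 0))\<^sup>2 \<le> (\<Sum>a\<in>A. (cmod (\<Delta> a))\<^sup>2)"
      by (rule member_le_sum[OF A(2) _ A(1)]) auto
    ultimately have "\<Delta> 0 = 0" by (smt (verit) norm_le_zero_iff power2_less_eq_zero_iff zero_le_power2 zero_eq_power2)
    then show ?thesis by (simp add: \<Delta>_def d_def)
  qed
  show ?thesis
  proof (rule exI[of _ "s0 0"], rule exI[of _ "s1 0"], intro conjI ballI allI impI)
    show "s0 0 holomorphic_on ball 0 1" "s1 0 holomorphic_on ball 0 1" using s0 s1 A by auto
    show "F i * s0 0 (z i) + T i * s1 0 (z i) = of_real (sqrt \<mu>)" if "i < n" for i using interp[OF that] .
    fix w :: complex assume w: "w \<in> ball 0 1"
    \<comment> \<open>Taking the conjugates of the two values as inputs gives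
      \<open>m^2 \<le> m\<close>, which bounds both functions jointly.\<close>
    let ?m = "(cmod (s0 0 w))\<^sup>2 + (cmod (s1 0 w))\<^sup>2"
    have "cnj (s0 0 w) * s0 0 w + cnj (s1 0 w) * s1 0 w = of_real ?m"
      unfolding of_real_add complex_norm_square by (simp add: mult.commute)
    then have "?m\<^sup>2 \<le> ?m" using S_norm[OF w, of "cnj (s0 0 w)" "cnj (s1 0 w)"]
      by (simp only: norm_of_real complex_mod_cnj power2_abs)
    moreover have "m \<le> 1" if "m\<^sup>2 \<le> m" for m :: real
    proof (rule ccontr)
      assume "\<not> m \<le> 1"
      then have "m * 1 < m * m" by (intro mult_strict_left_mono) auto
      then show False using that by (simp add: power2_eq_square)
    qed
    ultimately show "?m \<le> 1" by blast
  qed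
qed

section \<open>A sharp corona theorem\<close>

text \<open>The sum is real by Hermitian symmetry. It is the squared Hardy norm of the kernel sum
  with coefficients \<open>cnj (d i)\<close>.\<close>

definition szego_form :: "nat \<Rightarrow> (nat \<Rightarrow> complex) \<Rightarrow> (nat \<Rightarrow> complex) \<Rightarrow> real" where
  "szego_form n a d = Re (\<Sum>i<n. \<Sum>j<n. d i * cnj (d j) / (1 - a i * cnj (a j)))"

lemma mean_sq_kernel_sum:
  fixes c :: "nat \<Rightarrow> complex"
  assumes "\<And>i. i < n \<Longrightarrow> cmod (a i) * R \<le> 1" "R > 1"
  shows "mean_sq (kernel_sum n a c) = szego_form n a (\<lambda>i. cnj (c i))"
proof -
  let ?p = "kernel_sum n a c"
  have "mean_sq ?p = circle_mean (\<lambda>z. Re (?p z * cnj (?p z)))"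
    by (simp add: complex_norm_square[symmetric] del: of_real_power)
  also have "\<dots> = Re (\<Sum>i<n. cnj (c i) * ?p (a i))"
    by (rule circle_mean_kernel_sum[OF kernel_sum_holomorphic[OF assms] assms(2,1)])
  also have "\<dots> = szego_form n a (\<lambda>i. cnj (c i))"
    by (simp add: szego_form_def kernel_sum_def szego_def sum_distrib_left mult.commute)
  finally show ?thesis .
qed

lemma dilation_in_ball: "0 < r \<Longrightarrow> cmod z < 1 / r \<Longrightarrow> of_real r * z \<in> ball 0 1"
  by (simp add: norm_mult field_simps)

lemma holomorphic_dilation:
  assumes "f holomorphic_on ball 0 1" "0 < r"
  shows "(\<lambda>z. f (of_real r * z)) holomorphic_on ball 0 (1 / r)"
  by (rule holomorphic_on_compose_gen[OF _ assms(1), unfolded o_def])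
    (use dilation_in_ball[OF assms(2)] in \<open>auto intro!: holomorphic_intros\<close>)

definition corona_data :: "real \<Rightarrow> (complex \<Rightarrow> complex) \<Rightarrow> (complex \<Rightarrow> complex) \<Rightarrow> bool" where
  "corona_data \<eta> f T \<longleftrightarrow> f holomorphic_on ball 0 1 \<and> T holomorphic_on ball 0 1 \<and>
     (\<forall>z\<in>ball 0 1. cmod (f z) \<le> 1 \<and> cmod (T z) \<le> 1 \<and> (1 - \<eta> \<le> cmod (f z) \<or> 1 - \<eta> \<le> cmod (T z)))"

text \<open>Only finitely many points occur, so the smooth inequality can be applied to
  \<open>f (r z)\<close> and \<open>T (r z)\<close> and \<open>r\<close> sent to 1. This is possible
  because \<open>\<eta>\<close> and \<open>C\<close> depend on \<open>\<epsilon>\<close>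
  alone.\<close>

theorem kernel_inequality_disc:
  fixes \<epsilon> :: real
  assumes \<epsilon>: "0 < \<epsilon>"
  shows "\<exists>\<eta> C. 0 < \<eta> \<and> 0 \<le> C \<and> (\<forall>f T. corona_data \<eta> f T \<longrightarrow>
     (\<forall>n a d. (\<forall>i<n. cmod (a i) < 1) \<longrightarrow>
        (1 - \<epsilon>) * szego_form n a d \<le> szego_form n a (\<lambda>i. d i * f (a i)) + C * szego_form n a (\<lambda>i. d i * T (a i))))"
proof -
  \<comment> \<open>The term \<open>5 * \<kappa>\<close> uses up half of \<open>\<epsilon>\<close>;
    \<open>M\<close> is then taken so large that the other error uses at most the other
    half.\<close>
  define \<kappa> where "\<kappa> = \<epsilon> / 10"
  have \<kappa>: "\<kappa> > 0" using \<epsilon> by (simp add: \<kappa>_def)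
  obtain M where M: "M > 0" "518 / (\<kappa> * sqrt (harm M)) \<le> \<epsilon> / 2"
  proof -
    have "filterlim (\<lambda>n. harm n :: real) at_top sequentially" by (rule harm_at_top)
    then have "eventually (\<lambda>n. harm n \<ge> (1036 / (\<kappa> * \<epsilon>))\<^sup>2) sequentially"
      by (simp add: filterlim_at_top)
    then obtain M where M: "M \<ge> 1" "harm M \<ge> (1036 / (\<kappa> * \<epsilon>))\<^sup>2"
      by (metis (mono_tags, lifting) eventually_sequentially nle_le order_trans)
    have "1036 / (\<kappa> * \<epsilon>) \<le> sqrt (harm M)" using M(2) by (rule real_le_rsqrt)
    moreover have "0 < 1036 / (\<kappa> * \<epsilon>)" using \<kappa> \<epsilon> by simp
    ultimately have "518 / (\<kappa> * sqrt (harm M)) \<le> 518 / (\<kappa> * (1036 / (\<kappa> * \<epsilon>)))"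
      using \<kappa> M(1) by (intro divide_left_mono mult_left_mono mult_pos_pos) auto
    also have "\<dots> = \<epsilon> / 2" using \<kappa> \<epsilon> by (simp add: field_simps)
    finally have "518 / (\<kappa> * sqrt (harm M)) \<le> \<epsilon> / 2" .
    then show thesis using that[of M] M(1) by simp
  qed
  \<comment> \<open>Bernoulli's inequality then gives
    \<open>(1 - \<eta>)^(2M) \<ge> 1 - 2 * M * \<eta> = 1/2\<close>.\<close>
  define \<eta> where "\<eta> = 1 / (4 * real M)"
  have \<eta>: "0 < \<eta>" "\<eta> \<le> 1" using M by (auto simp: \<eta>_def field_simps)
  have half: "1/2 \<le> (x\<^sup>2)^M" if "1 - \<eta> \<le> x" for x
  proof -
    have "1 + real (2*M) * (- \<eta>) \<le> (1 + (- \<eta>)) ^ (2*M)"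
      using \<eta> by (intro Bernoulli_inequality) auto
    also have "\<dots> \<le> x ^ (2*M)" using that \<eta> by (intro power_mono) auto
    finally show ?thesis using M by (simp add: \<eta>_def power_mult)
  qed
  define C where "C = 2 / \<kappa>"
  show ?thesis
  proof (rule exI[of _ \<eta>], rule exI[of _ C], intro conjI allI impI)
    show "0 < \<eta>" "0 \<le> C" using \<eta> \<kappa> by (auto simp: C_def)
    fix f T :: "complex \<Rightarrow> complex" and n :: nat and a d :: "nat \<Rightarrow> complex"
    assume cd: "corona_data \<eta> f T" and a: "\<forall>i<n. cmod (a i) < 1"
    have f: "f holomorphic_on ball 0 1" and T: "T holomorphic_on ball 0 1"
      and fT: "\<forall>z\<in>ball 0 1. cmod (f z) \<le> 1 \<and> cmod (T z) \<le> 1 \<and> (1 - \<eta> \<le> cmod (f z) \<or> 1 - \<eta> \<le> cmod (T z))"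
      using cd unfolding corona_data_def by blast+
    \<comment> \<open>The inserted \<open>1/2\<close> keeps the set nonempty for
      \<open>n = 0\<close> and \<open>\<alpha>\<close> positive.\<close>
    define \<alpha> where "\<alpha> = Max (insert (1/2) ((\<lambda>i. cmod (a i)) ` {..<n}))"
    have \<alpha>: "1/2 \<le> \<alpha>" "\<alpha> < 1" "\<And>i. i < n \<Longrightarrow> cmod (a i) \<le> \<alpha>"
    proof -
      have fin: "finite (insert (1/2) ((\<lambda>i. cmod (a i)) ` {..<n}))" by simp
      show "1/2 \<le> \<alpha>" unfolding \<alpha>_def by (rule Max_ge[OF fin]) simp
      show "\<alpha> < 1" unfolding \<alpha>_def using a by (subst Max_less_iff[OF fin]) auto
      show "cmod (a i) \<le> \<alpha>" if "i < n" for i unfolding \<alpha>_def using that by (intro Max_ge[OF fin]) simp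
    qed
    have dil: "(1 - \<epsilon>) * szego_form n a d \<le> szego_form n a (\<lambda>i. d i * f (of_real r * a i)) + C * szego_form n a (\<lambda>i. d i * T (of_real r * a i))"
      if r: "0 < r" "r < 1" for r :: real
    proof -
      \<comment> \<open>The bound \<open>1/r\<close> serves the dilated functions,
        \<open>1/\<alpha>\<close> the kernels at the points \<open>a i\<close>.\<close>
      define R where "R = min (1/r) (1/\<alpha>)"
      have R: "R > 1" using r \<alpha> by (auto simp: R_def min_def field_simps)
      have aR: "cmod (a i) * R \<le> 1" if "i < n" for i
      proof -
        have "cmod (a i) * R \<le> \<alpha> * (1/\<alpha>)" using \<alpha> that R r by (intro mult_mono) (auto simp: R_def)
        then show ?thesis using \<alpha> by simp
      qed
      have hol: "(\<lambda>z. g (of_real r * z)) holomorphic_on ball 0 R" if "g holomorphic_on ball 0 1" for g :: "complex \<Rightarrow> complex"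
        by (rule holomorphic_on_subset[OF holomorphic_dilation[OF that r(1)]]) (auto simp: R_def)
      have p: "of_real r * z \<in> ball 0 1" if "cmod z \<le> 1" for z :: complex
        using that R by (intro dilation_in_ball r) (auto simp: R_def)
      let ?c = "\<lambda>i. cnj (d i)"
      have ms: "mean_sq (kernel_sum n a c) = szego_form n a (\<lambda>i. cnj (c i))" for c
        by (rule mean_sq_kernel_sum[OF aR R])
      have "(1 - 5 * \<kappa> - 518 / (\<kappa> * sqrt (harm M))) * mean_sq (kernel_sum n a ?c)
        \<le> mean_sq (kernel_sum n a (\<lambda>i. ?c i * cnj (f (of_real r * a i)))) + 2 / \<kappa> * mean_sq (kernel_sum n a (\<lambda>i. ?c i * cnj (T (of_real r * a i))))"
        by (rule kernel_inequality_smooth[OF hol[OF f] hol[OF T] R aR _ _ M(1) \<kappa>]) (use fT p half in blast)+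
      then have "(1 - 5 * \<kappa> - 518 / (\<kappa> * sqrt (harm M))) * szego_form n a d
        \<le> szego_form n a (\<lambda>i. d i * f (of_real r * a i)) + C * szego_form n a (\<lambda>i. d i * T (of_real r * a i))"
        unfolding ms C_def by simp
      moreover have "(1 - \<epsilon>) * szego_form n a d \<le> (1 - 5 * \<kappa> - 518 / (\<kappa> * sqrt (harm M))) * szego_form n a d"
      proof (rule mult_right_mono)
        show "1 - \<epsilon> \<le> 1 - 5 * \<kappa> - 518 / (\<kappa> * sqrt (harm M))" using M(2) by (simp add: \<kappa>_def)
        have "mean_sq (kernel_sum n a ?c) \<ge> 0"
          by (rule mean_sq_nonneg[OF continuous_on_sphere_if_cball[OF holomorphic_continuous_cball[OF kernel_sum_holomorphic[OF aR R] R]]])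
        then show "0 \<le> szego_form n a d" unfolding ms by simp
      qed
      ultimately show ?thesis by linarith
    qed
    have lim: "((\<lambda>r. g (of_real r * a i)) \<longlongrightarrow> g (a i)) (at_left 1)"
      if "g holomorphic_on ball 0 1" "i < n" for g :: "complex \<Rightarrow> complex" and i
    proof -
      have "isCont g (a i)"
        using holomorphic_on_imp_continuous_on[OF that(1)] a that(2) by (simp add: continuous_on_eq_continuous_at)
      moreover have "((\<lambda>r::real. of_real r * a i) \<longlongrightarrow> of_real 1 * a i) (at_left 1)" by (intro tendsto_intros)
      ultimately show ?thesis by (intro isCont_tendsto_compose[of _ g]) auto
    qed
    have form: "((\<lambda>r. szego_form n a (\<lambda>i. d i * g (of_real r * a i))) \<longlongrightarrow> szego_form n a (\<lambda>i. d i * g (a i))) (at_left 1)"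
      if "g holomorphic_on ball 0 1" for g
      unfolding szego_form_def divide_inverse by (intro tendsto_intros lim that) auto
    show "(1 - \<epsilon>) * szego_form n a d \<le> szego_form n a (\<lambda>i. d i * f (a i)) + C * szego_form n a (\<lambda>i. d i * T (a i))"
    proof (rule tendsto_le[OF _ tendsto_add[OF form[OF f] tendsto_mult[OF tendsto_const form[OF T]]] tendsto_const])
      have "eventually (\<lambda>r::real. r \<in> {0<..<1}) (at_left 1)" by (rule eventually_at_leftI) auto
      then show "eventually (\<lambda>r. (1 - \<epsilon>) * szego_form n a d \<le>
        szego_form n a (\<lambda>i. d i * f (of_real r * a i)) + C * szego_form n a (\<lambda>i. d i * T (of_real r * a i))) (at_left 1)"
        by eventually_elim (rule dil; simp)
    qed simp
  qed
qed

lemma montel_bounded: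
  fixes \<F> :: "nat \<Rightarrow> complex \<Rightarrow> complex"
  assumes "\<And>n. \<F> n holomorphic_on ball 0 1" "\<And>n z. z \<in> ball 0 1 \<Longrightarrow> cmod (\<F> n z) \<le> B"
  obtains g r where "g holomorphic_on ball 0 1" "strict_mono (r :: nat \<Rightarrow> nat)"
    "\<And>z. z \<in> ball 0 1 \<Longrightarrow> (\<lambda>n. \<F> (r n) z) \<longlonglongrightarrow> g z"
    "\<And>K. compact K \<Longrightarrow> K \<subseteq> ball 0 1 \<Longrightarrow> uniform_limit K (\<F> \<circ> r) g sequentially"
    "\<And>z. z \<in> ball 0 1 \<Longrightarrow> cmod (g z) \<le> B"
proof -
  obtain g r where gr: "g holomorphic_on ball 0 1" "strict_mono (r :: nat \<Rightarrow> nat)"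
    "\<And>z. z \<in> ball 0 1 \<Longrightarrow> (\<lambda>n. \<F> (r n) z) \<longlonglongrightarrow> g z"
    "\<And>K. compact K \<Longrightarrow> K \<subseteq> ball 0 1 \<Longrightarrow> uniform_limit K (\<F> \<circ> r) g sequentially"
    by (rule Montel[of "ball 0 1" "range \<F>" \<F>]) (use assms in blast)+
  moreover have "cmod (g z) \<le> B" if "z \<in> ball 0 1" for z
    by (rule Lim_bounded[OF tendsto_norm[OF gr(3)[OF that]]]) (use assms that in auto)
  ultimately show thesis using that by blast
qed

text \<open>The kernel inequality is the positivity needed by \<open>leech_finite\<close> at the
  first \<open>n\<close> points, with bounds uniform in \<open>n\<close>. A limit of these solutions
  satisfies the equation at all the points, and hence everywhere.\<close>

theorem sharp_corona:
  fixes \<epsilon> :: real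
  assumes \<epsilon>: "0 < \<epsilon>" "\<epsilon> \<le> 1"
  shows "\<exists>\<eta>>0. \<forall>f T. corona_data \<eta> f T \<longrightarrow>
     (\<exists>g h B. g holomorphic_on ball 0 1 \<and> h holomorphic_on ball 0 1 \<and>
        (\<forall>z\<in>ball 0 1. cmod (g z) \<le> 1 + \<epsilon> \<and> cmod (h z) \<le> B \<and> f z * g z + T z * h z = 1))"
proof -
  define \<mu> where "\<mu> = 1 - \<epsilon> / 2"
  have \<mu>: "\<mu> > 0" using \<epsilon> by (simp add: \<mu>_def)
  obtain \<eta> C where \<eta>: "0 < \<eta>" "0 \<le> C" and ker: "\<And>f T n a d. corona_data \<eta> f T \<Longrightarrow> \<forall>i<n. cmod (a i) < 1 \<Longrightarrow>
        \<mu> * szego_form n a d \<le> szego_form n a (\<lambda>i. d i * f (a i)) + C * szego_form n a (\<lambda>i. d i * T (a i))"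
    using kernel_inequality_disc[of "\<epsilon>/2"] \<epsilon> unfolding \<mu>_def by auto
  \<comment> \<open>Distinct points accumulating at 0, inside the disc, as the identity theorem
    requires.\<close>
  define a where "a = (\<lambda>i. complex_of_real (1 / real (i + 2)))"
  have a1: "cmod (a i) < 1" for i unfolding a_def norm_of_real by simp
  show ?thesis
  proof (intro exI[of _ \<eta>] conjI \<eta> allI impI)
    fix f T :: "complex \<Rightarrow> complex"
    assume cd: "corona_data \<eta> f T"
    then have f: "f holomorphic_on ball 0 1" and T: "T holomorphic_on ball 0 1"
      unfolding corona_data_def by blast+
    \<comment> \<open>The constant \<open>C\<close> is absorbed into the second datum and reappears
      only in the bound for \<open>h\<close>.\<close>
    let ?T = "\<lambda>z. of_real (sqrt C) * T z"
    have "\<exists>g h. g holomorphic_on ball 0 1 \<and> h holomorphic_on ball 0 1 \<and>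
        (\<forall>w\<in>ball 0 1. (cmod (g w))\<^sup>2 + (cmod (h w))\<^sup>2 \<le> 1) \<and>
        (\<forall>i<n. f (a i) * g (a i) + ?T (a i) * h (a i) = of_real (sqrt \<mu>))" for n
    proof (rule leech_finite)
      fix d :: "nat \<Rightarrow> complex"
      have CC: "complex_of_real (sqrt C) * of_real (sqrt C) = of_real C"
        using \<eta>(2) by (simp flip: of_real_mult)
      have "d i * cnj (d j) * ((f (a i) * cnj (f (a j)) + ?T (a i) * cnj (?T (a j)) - of_real \<mu>) / (1 - a i * cnj (a j)))
        = (d i * f (a i)) * cnj (d j * f (a j)) / (1 - a i * cnj (a j))
          + of_real C * ((d i * T (a i)) * cnj (d j * T (a j)) / (1 - a i * cnj (a j)))
          - of_real \<mu> * (d i * cnj (d j) / (1 - a i * cnj (a j)))" for i j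
      proof -
        have "?T (a i) * cnj (?T (a j)) = of_real C * (T (a i) * cnj (T (a j)))"
          unfolding CC[symmetric] by simp
        then show ?thesis by (simp add: add_divide_distrib diff_divide_distrib algebra_simps)
      qed
      then have "Re (\<Sum>i<n. \<Sum>j<n. d i * cnj (d j) * ((f (a i) * cnj (f (a j)) + ?T (a i) * cnj (?T (a j)) - of_real \<mu>) / (1 - a i * cnj (a j))))
        = szego_form n a (\<lambda>i. d i * f (a i)) + C * szego_form n a (\<lambda>i. d i * T (a i)) - \<mu> * szego_form n a d"
        unfolding szego_form_def
        by (simp only: sum.distrib sum_subtractf flip: sum_distrib_left Re_of_real_mult) simp
      then show "0 \<le> Re (\<Sum>i<n. \<Sum>j<n. d i * cnj (d j) * ((f (a i) * cnj (f (a j)) + ?T (a i) * cnj (?T (a j)) - of_real \<mu>) / (1 - a i * cnj (a j))))"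
        using ker[OF cd, of n a d] a1 by simp
    qed (use a1 \<mu> in auto)
    then obtain G H where GH: "\<And>n. G n holomorphic_on ball 0 1" "\<And>n. H n holomorphic_on ball 0 1"
      "\<And>n w. w \<in> ball 0 1 \<Longrightarrow> (cmod (G n w))\<^sup>2 + (cmod (H n w))\<^sup>2 \<le> 1"
      "\<And>n i. i < n \<Longrightarrow> f (a i) * G n (a i) + ?T (a i) * H n (a i) = of_real (sqrt \<mu>)"
      by metis
    have G1: "cmod (G n w) \<le> 1" and H1: "cmod (H n w) \<le> 1" if "w \<in> ball 0 1" for n w
    proof -
      have "(cmod (G n w))\<^sup>2 \<le> 1\<^sup>2" "(cmod (H n w))\<^sup>2 \<le> 1\<^sup>2"
        using GH(3)[OF that, of n] zero_le_power2[of "cmod (G n w)"] zero_le_power2[of "cmod (H n w)"]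
        unfolding one_power2 by linarith+
      then show "cmod (G n w) \<le> 1" "cmod (H n w) \<le> 1" by (auto intro: power2_le_imp_le)
    qed
    obtain g r where g: "g holomorphic_on ball 0 1" "strict_mono (r :: nat \<Rightarrow> nat)"
      "\<And>z. z \<in> ball 0 1 \<Longrightarrow> (\<lambda>n. G (r n) z) \<longlonglongrightarrow> g z" "\<And>z. z \<in> ball 0 1 \<Longrightarrow> cmod (g z) \<le> 1"
      by (rule montel_bounded[of G 1]) (use GH(1) G1 in blast)+
    obtain h q where h: "h holomorphic_on ball 0 1" "strict_mono (q :: nat \<Rightarrow> nat)"
      "\<And>z. z \<in> ball 0 1 \<Longrightarrow> (\<lambda>n. H (r (q n)) z) \<longlonglongrightarrow> h z" "\<And>z. z \<in> ball 0 1 \<Longrightarrow> cmod (h z) \<le> 1"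
      by (rule montel_bounded[of "\<lambda>n. H (r n)" 1]) (use GH(2) H1 in blast)+
    define \<Phi> where "\<Phi> = (\<lambda>z. f z * g z + ?T z * h z - of_real (sqrt \<mu>))"
    have \<Phi>: "\<Phi> holomorphic_on ball 0 1" unfolding \<Phi>_def by (intro holomorphic_intros f T g h)
    have \<Phi>a: "\<Phi> (a i) = 0" for i
    proof -
      have ai: "a i \<in> ball 0 1" using a1 by simp
      have "(\<lambda>n. G (r (q n)) (a i)) \<longlonglongrightarrow> g (a i)"
        using LIMSEQ_subseq_LIMSEQ[OF g(3)[OF ai] h(2)] by (simp add: o_def)
      then have "(\<lambda>n. f (a i) * G (r (q n)) (a i) + ?T (a i) * H (r (q n)) (a i)) \<longlonglongrightarrow> f (a i) * g (a i) + ?T (a i) * h (a i)"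
        by (intro tendsto_intros h ai)
      moreover have "eventually (\<lambda>n. f (a i) * G (r (q n)) (a i) + ?T (a i) * H (r (q n)) (a i) = of_real (sqrt \<mu>)) sequentially"
        using eventually_gt_at_top[of i]
      proof eventually_elim
        case (elim n)
        have "n \<le> r (q n)" using seq_suble[OF g(2), of "q n"] seq_suble[OF h(2), of n] by linarith
        then show ?case using elim by (intro GH(4)) linarith
      qed
      ultimately have "(\<lambda>n::nat. complex_of_real (sqrt \<mu>)) \<longlonglongrightarrow> f (a i) * g (a i) + ?T (a i) * h (a i)"
        by (rule Lim_transform_eventually)
      then show ?thesis unfolding \<Phi>_def by (simp add: LIMSEQ_const_iff)
    qed
    have "\<Phi> z = 0" if "z \<in> ball 0 1" for z
    proof (rule analytic_continuation[OF \<Phi>, of "range a" 0])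
      have "(\<lambda>i. 1 / real (i + 2)) \<longlonglongrightarrow> 0" by real_asymp
      then have "a \<longlonglongrightarrow> of_real 0" unfolding a_def by (rule tendsto_of_real)
      then have lim: "a \<longlonglongrightarrow> 0" by simp
      have "a i \<noteq> 0" for i unfolding a_def by (simp del: of_nat_add of_real_divide)
      then show "0 islimpt range a"
        unfolding islimpt_sequential
        using lim \<open>\<And>i. a i \<noteq> 0\<close> by (intro exI[of _ a]) auto
    qed (use a1 that \<Phi>a in auto)
    then have fgh: "f z * g z + ?T z * h z = of_real (sqrt \<mu>)" if "z \<in> ball 0 1" for z
      using that unfolding \<Phi>_def by simp
    let ?s = "complex_of_real (1 / sqrt \<mu>)"
    \<comment> \<open>\<open>(1 + \<epsilon>)^2 * (1 - \<epsilon>/2) = 1 + 3\<epsilon>/2 -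
      \<epsilon>^3/2\<close>, which is at least 1 for \<open>\<epsilon> \<le> 1\<close>.\<close>
    have s: "1 / sqrt \<mu> \<le> 1 + \<epsilon>"
    proof -
      have "\<epsilon> * \<epsilon> \<le> 1" using \<epsilon> by (simp add: mult_le_one)
      then have "\<epsilon> * (\<epsilon> * \<epsilon>) \<le> \<epsilon> * 1" using \<epsilon> by (intro mult_left_mono) auto
      moreover have "(1 + \<epsilon>)\<^sup>2 * \<mu> = 1 + 3/2 * \<epsilon> - 1/2 * (\<epsilon> * (\<epsilon> * \<epsilon>))" unfolding \<mu>_def by (simp add: power2_eq_square field_simps)
      ultimately have "1 \<le> (1 + \<epsilon>)\<^sup>2 * \<mu>" using \<epsilon> by simp
      then have "1 \<le> sqrt ((1 + \<epsilon>)\<^sup>2 * \<mu>)" by simp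
      then show ?thesis using \<mu> \<epsilon> by (simp add: real_sqrt_mult field_simps)
    qed
    show "\<exists>g h B. g holomorphic_on ball 0 1 \<and> h holomorphic_on ball 0 1 \<and>
        (\<forall>z\<in>ball 0 1. cmod (g z) \<le> 1 + \<epsilon> \<and> cmod (h z) \<le> B \<and> f z * g z + T z * h z = 1)"
    proof (rule exI[of _ "\<lambda>z. ?s * g z"], rule exI[of _ "\<lambda>z. ?s * of_real (sqrt C) * h z"],
        rule exI[of _ "1 / sqrt \<mu> * sqrt C"], intro conjI ballI)
      fix z :: complex assume z: "z \<in> ball 0 1"
      have "cmod (?s * g z) \<le> 1 / sqrt \<mu> * 1" using g(4)[OF z] \<mu> by (simp add: norm_mult norm_divide divide_right_mono)
      then show "cmod (?s * g z) \<le> 1 + \<epsilon>" using s by simp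
      show "cmod (?s * of_real (sqrt C) * h z) \<le> 1 / sqrt \<mu> * sqrt C"
        using h(4)[OF z] \<mu> \<eta>(2) by (simp add: norm_mult norm_divide divide_right_mono mult_left_le)
      have "f z * (?s * g z) + T z * (?s * of_real (sqrt C) * h z) = ?s * (f z * g z + ?T z * h z)"
        by (simp add: algebra_simps add_divide_distrib)
      also have "\<dots> = 1" unfolding fgh[OF z] using \<mu> by (simp flip: of_real_mult)
      finally show "f z * (?s * g z) + T z * (?s * of_real (sqrt C) * h z) = 1" .
    qed (intro holomorphic_intros g h)+
  qed
qed

section \<open>Pseudohyperbolic geometry and narrow sets\<close>

text \<open>The sign is chosen so that 0 goes to \<open>a\<close>: composition with it recentres a
  function at \<open>a\<close>.\<close>

definition disc_aut :: "complex \<Rightarrow> complex \<Rightarrow> complex" where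
  "disc_aut a z = (z + a) / (1 + cnj a * z)"

lemma disc_aut_eq_Moebius: "disc_aut a = Moebius_function 0 (- a)"
  by (rule ext) (simp add: disc_aut_def Moebius_function_simple)

lemma disc_aut_in_ball: "a \<in> ball 0 1 \<Longrightarrow> z \<in> ball 0 1 \<Longrightarrow> disc_aut a z \<in> ball 0 1"
  unfolding disc_aut_eq_Moebius using Moebius_function_norm_lt_1[of "- a" z 0] by simp

lemma disc_aut_holomorphic: "a \<in> ball 0 1 \<Longrightarrow> disc_aut a holomorphic_on ball 0 1"
  unfolding disc_aut_eq_Moebius by (rule Moebius_function_holomorphic) simp

lemma disc_aut_inverse: "a \<in> ball 0 1 \<Longrightarrow> z \<in> ball 0 1 \<Longrightarrow> disc_aut a (disc_aut (- a) z) = z"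
  unfolding disc_aut_eq_Moebius by (rule Moebius_function_compose) auto

lemma disc_aut_inverse': "a \<in> ball 0 1 \<Longrightarrow> z \<in> ball 0 1 \<Longrightarrow> disc_aut (- a) (disc_aut a z) = z"
  using disc_aut_inverse[of "- a" z] by simp

lemma disc_aut_0 [simp]: "disc_aut a 0 = a"
  by (simp add: disc_aut_def)

lemma one_plus_nonzero:
  assumes "a \<in> ball 0 1" "z \<in> ball (0::complex) 1"
  shows "1 + cnj a * z \<noteq> 0"
proof
  assume "1 + cnj a * z = 0"
  then have "cmod (cnj a * z) = 1" by (metis add.inverse_inverse add_eq_0_iff norm_minus_cancel norm_one)
  moreover have "cmod (cnj a * z) < 1" using assms norm_mult_less[of "cnj a" 1 z 1] by simp
  ultimately show False by simp
qed

lemma norm_disc_aut_squared: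
  assumes "a \<in> ball 0 1" "z \<in> ball 0 1"
  shows "1 - (cmod (disc_aut a z))\<^sup>2 = (1 - (cmod a)\<^sup>2) * (1 - (cmod z)\<^sup>2) / (cmod (1 + cnj a * z))\<^sup>2"
proof -
  have nz: "(cmod (1 + cnj a * z))\<^sup>2 \<noteq> 0" using one_plus_nonzero[OF assms] by simp
  have "(cmod (1 + cnj a * z))\<^sup>2 - (cmod (z + a))\<^sup>2 = (1 - (cmod a)\<^sup>2) * (1 - (cmod z)\<^sup>2)"
    unfolding cmod_power2 by (simp add: power2_eq_square algebra_simps)
  then show ?thesis using nz
    by (simp add: disc_aut_def norm_divide power_divide field_simps)
qed

lemma pseudohyp_dist_eq: "pseudohyp_dist z a = cmod (disc_aut (- a) z)"
  by (simp add: pseudohyp_dist_def disc_aut_def)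

lemma pseudohyp_dist_commute: "pseudohyp_dist z w = pseudohyp_dist w z"
proof -
  have "cmod (1 - cnj w * z) = cmod (1 - cnj z * w)"
    using complex_mod_cnj[of "1 - cnj w * z"] by (simp add: mult.commute)
  then show ?thesis unfolding pseudohyp_dist_def norm_divide by (simp add: norm_minus_commute)
qed

lemma pseudohyp_dist_aut:
  assumes "a \<in> ball 0 1" "u \<in> ball 0 1" "w \<in> ball 0 1"
  shows "pseudohyp_dist (disc_aut a u) (disc_aut a w) = pseudohyp_dist u w"
proof -
  let ?p = "1 + cnj a * u" and ?q = "1 + cnj a * w" and ?c = "1 - cnj a * a"
  have p: "?p \<noteq> 0" and q: "?q \<noteq> 0" using one_plus_nonzero assms by auto
  then have q': "cnj ?q \<noteq> 0" by (metis complex_cnj_zero_iff)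
  have "cnj a * a = of_real ((cmod a)\<^sup>2)" by (simp add: complex_norm_square mult.commute del: of_real_power)
  moreover have "(cmod a)\<^sup>2 < 1" using assms(1) by (simp add: power_less_one_iff)
  ultimately have c: "?c \<noteq> 0" by (metis eq_iff_diff_eq_0 less_irrefl of_real_eq_1_iff)
  have "disc_aut a u - disc_aut a w = (u - w) * ?c / (?p * ?q)"
    unfolding disc_aut_def using p q by (simp add: field_simps)
  moreover have "1 - cnj (disc_aut a w) * disc_aut a u = ?c * (1 - cnj w * u) / (?p * cnj ?q)"
  proof -
    have "1 - (W + A) / (1 + a * W) * ((u + a) / (1 + A * u)) = (1 - A * a) * (1 - W * u) / ((1 + A * u) * (1 + a * W))"
      if "1 + a * W \<noteq> 0" "1 + A * u \<noteq> 0" for A W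
    proof -
      have "1 - (W + A) / (1 + a * W) * ((u + a) / (1 + A * u))
        = ((1 + A * u) * (1 + a * W) - (W + A) * (u + a)) / ((1 + A * u) * (1 + a * W))"
        using that by (simp add: diff_divide_distrib mult.commute)
      also have "(1 + A * u) * (1 + a * W) - (W + A) * (u + a) = (1 - A * a) * (1 - W * u)"
        by (simp add: algebra_simps)
      finally show ?thesis .
    qed
    from this[of "cnj w" "cnj a"] show ?thesis using p q' by (simp add: disc_aut_def)
  qed
  moreover have "cmod ((X * c / (p * q)) / (c * Y / (p * q'))) = cmod (X / Y) * (cmod q' / cmod q)"
    if "c \<noteq> 0" "p \<noteq> 0" for X Y c p q q' :: complex
    using that by (simp add: norm_divide norm_mult)
  ultimately have "cmod ((disc_aut a u - disc_aut a w) / (1 - cnj (disc_aut a w) * disc_aut a u))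
      = cmod ((u - w) / (1 - cnj w * u)) * (cmod (cnj ?q) / cmod ?q)"
    using p c by (simp only:) blast
  then show ?thesis unfolding pseudohyp_dist_def complex_mod_cnj using q by simp
qed

lemma pseudohyp_dist_disc_aut:
  assumes "a \<in> ball 0 1" "u \<in> ball 0 1"
  shows "pseudohyp_dist (disc_aut a u) a = cmod u"
  using pseudohyp_dist_aut[OF assms, of 0] by (simp add: pseudohyp_dist_def)

lemma pseudohyp_dist_squared:
  assumes "z \<in> ball 0 1" "a \<in> ball 0 1"
  shows "1 - (pseudohyp_dist z a)\<^sup>2 = (1 - (cmod a)\<^sup>2) * (1 - (cmod z)\<^sup>2) / (cmod (1 - cnj a * z))\<^sup>2"
  unfolding pseudohyp_dist_eq using norm_disc_aut_squared[of "- a" z] assms by simp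

lemma one_minus_norm_le:
  assumes "cmod z \<le> 1"
  shows "1 - cmod a \<le> cmod (1 - cnj a * z)"
proof -
  have "cmod (cnj a * z) \<le> cmod a" using assms by (simp add: norm_mult mult_left_le)
  then have "1 - cmod a \<le> 1 - cmod (cnj a * z)" by simp
  also have "\<dots> \<le> cmod (1 - cnj a * z)" by (metis norm_one norm_triangle_ineq2)
  finally show ?thesis .
qed

lemma one_minus_square_le: "1 - t\<^sup>2 \<le> 2 * (1 - t)" for t :: real
  using zero_le_power2[of "1 - t"] by (simp add: power2_eq_square algebra_simps)

text \<open>As \<open>|1 - cnj a * z| \<ge> 1 - |a|\<close>, the identity for
  \<open>1 - pseudohyp_dist^2\<close> keeps a whole pseudohyperbolic disc about \<open>a\<close>
  inside an explicit smaller disc about 0.\<close>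

lemma pseudohyp_dist_imp_norm_le:
  assumes "z \<in> ball 0 1" "a \<in> ball 0 1" "pseudohyp_dist z a \<le> \<rho>" "\<rho> \<le> 1"
  shows "(cmod z)\<^sup>2 \<le> 1 - (1 - \<rho>\<^sup>2) * (1 - (cmod a)\<^sup>2) / 4"
proof -
  let ?z = "(cmod z)\<^sup>2" and ?a = "(cmod a)\<^sup>2" and ?m = "(cmod (1 - cnj a * z))\<^sup>2"
  have a: "0 < 1 - ?a" "1 - ?a \<le> 1" using assms by (auto simp: power_less_one_iff)
  have "0 \<le> pseudohyp_dist z a" by (simp add: pseudohyp_dist_def)
  then have "(pseudohyp_dist z a)\<^sup>2 \<le> \<rho>\<^sup>2" using assms by (intro power_mono) auto
  then have "1 - \<rho>\<^sup>2 \<le> (1 - ?a) * (1 - ?z) / ?m" using pseudohyp_dist_squared[OF assms(1,2)] by linarith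
  moreover have m: "?m > 0" using one_plus_nonzero[of "- a" z] assms by auto
  ultimately have *: "(1 - \<rho>\<^sup>2) * ?m \<le> (1 - ?a) * (1 - ?z)" by (simp add: field_simps)
  have am: "(1 - cmod a)\<^sup>2 \<le> ?m" using assms by (intro power_mono one_minus_norm_le) auto
  have "1 - ?a \<le> 2 * (1 - cmod a)" by (rule one_minus_square_le)
  then have "(1 - ?a)\<^sup>2 \<le> (2 * (1 - cmod a))\<^sup>2" using a by (intro power_mono) auto
  also have "(2 * (1 - cmod a))\<^sup>2 = 4 * (1 - cmod a)\<^sup>2" by (simp only: power_mult_distrib) simp
  finally have "(1 - ?a)\<^sup>2 \<le> 4 * ?m" using am by linarith
  moreover have r: "0 \<le> 1 - \<rho>\<^sup>2"
    using assms \<open>0 \<le> pseudohyp_dist z a\<close> by (simp add: power_le_one)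
  ultimately have "(1 - \<rho>\<^sup>2) * (1 - ?a)\<^sup>2 \<le> (1 - \<rho>\<^sup>2) * (4 * ?m)" by (intro mult_left_mono)
  also have "\<dots> = 4 * ((1 - \<rho>\<^sup>2) * ?m)" by simp
  also have "\<dots> \<le> 4 * ((1 - ?a) * (1 - ?z))" using * by (intro mult_left_mono) auto
  also have "\<dots> = (1 - ?a) * (4 * (1 - ?z))" by simp
  finally have "(1 - ?a) * ((1 - \<rho>\<^sup>2) * (1 - ?a)) \<le> (1 - ?a) * (4 * (1 - ?z))"
    by (simp add: power2_eq_square mult_ac)
  then have "(1 - \<rho>\<^sup>2) * (1 - ?a) \<le> 4 * (1 - ?z)" using a by simp
  then show ?thesis by simp
qed

text \<open>Recentring at \<open>a\<close> and at \<open>f a\<close> reduces this to the Schwarz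
  lemma.\<close>

lemma schwarz_pick:
  assumes f: "f holomorphic_on ball 0 1" and f1: "\<And>z. z \<in> ball 0 1 \<Longrightarrow> f z \<in> ball 0 1"
    and z: "z \<in> ball 0 1" and a: "a \<in> ball 0 1"
  shows "pseudohyp_dist (f z) (f a) \<le> pseudohyp_dist z a"
proof -
  define g where "g = (\<lambda>u. disc_aut (- f a) (f (disc_aut a u)))"
  have fa: "- f a \<in> ball 0 1" using f1[OF a] by simp
  define u where "u = disc_aut (- a) z"
  have u: "u \<in> ball 0 1" unfolding u_def by (rule disc_aut_in_ball) (use a z in auto)
  have zu: "z = disc_aut a u" unfolding u_def by (rule disc_aut_inverse[OF a z, symmetric])
  have "g holomorphic_on ball 0 1"
  proof -
    have "(f \<circ> disc_aut a) holomorphic_on ball 0 1"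
      by (rule holomorphic_on_compose_gen[OF disc_aut_holomorphic[OF a] f]) (use a in \<open>auto intro: disc_aut_in_ball\<close>)
    then have "(disc_aut (- f a) \<circ> (f \<circ> disc_aut a)) holomorphic_on ball 0 1"
      by (rule holomorphic_on_compose_gen[OF _ disc_aut_holomorphic[OF fa]])
        (use a f1 disc_aut_in_ball in \<open>auto simp del: mem_ball\<close>)
    then show ?thesis by (simp add: g_def o_def)
  qed
  moreover have "g 0 = 0" by (simp add: g_def disc_aut_def)
  moreover have "norm (g w) < 1" if "norm w < 1" for w
    using disc_aut_in_ball[OF fa f1[OF disc_aut_in_ball[OF a, of w]]] that by (simp add: g_def)
  ultimately have "norm (g u) \<le> norm u" using u by (intro Schwarz_Lemma(1)) auto
  then show ?thesis unfolding pseudohyp_dist_eq g_def zu u_def[symmetric]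
    using disc_aut_inverse'[OF a u] by simp
qed

text \<open>By Schwarz-Pick and \<open>|1 - cnj (f a) * f z| \<ge> 1 - |f z|\<close>, one factor
  \<open>1 - |f z|\<close> cancels. So the defect from modulus 1 grows at most by a factor depending
  on \<open>R\<close>.\<close>

lemma schwarz_pick_norm_ge:
  assumes f: "f holomorphic_on ball 0 1" and f1: "\<And>z. z \<in> ball 0 1 \<Longrightarrow> f z \<in> ball 0 1"
    and z: "z \<in> ball 0 1" and a: "a \<in> ball 0 1" and R: "pseudohyp_dist z a \<le> R" "0 < R" "R < 1"
    and \<delta>: "1 - \<delta> \<le> cmod (f a)"
  shows "1 - 4 * \<delta> / (1 - R\<^sup>2) \<le> cmod (f z)"
proof -
  let ?x = "cmod (f z)" and ?y = "cmod (f a)" and ?m = "(cmod (1 - cnj (f a) * f z))\<^sup>2"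
  have x: "0 \<le> ?x" "?x < 1" and y: "0 \<le> ?y" "?y < 1" using f1[OF z] f1[OF a] by auto
  have d0: "0 < \<delta>" using \<delta> y by linarith
  have "pseudohyp_dist (f z) (f a) \<le> R" using schwarz_pick[OF f f1 z a] R by linarith
  moreover have "0 \<le> pseudohyp_dist (f z) (f a)" by (simp add: pseudohyp_dist_def)
  ultimately have "(pseudohyp_dist (f z) (f a))\<^sup>2 \<le> R\<^sup>2" by (intro power_mono)
  then have "1 - R\<^sup>2 \<le> (1 - ?y\<^sup>2) * (1 - ?x\<^sup>2) / ?m"
    using pseudohyp_dist_squared[OF f1[OF z] f1[OF a]] by linarith
  moreover have m: "?m > 0" using one_plus_nonzero[of "- f a" "f z"] f1[OF z] f1[OF a] by auto
  ultimately have *: "(1 - R\<^sup>2) * ?m \<le> (1 - ?y\<^sup>2) * (1 - ?x\<^sup>2)" by (simp add: field_simps)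
  have "(1 - ?x)\<^sup>2 \<le> ?m"
    using one_minus_norm_le[of "f a" "f z"] x y complex_mod_cnj[of "1 - cnj (f a) * f z"]
    by (intro power_mono) (auto simp: mult.commute)
  moreover have R2: "0 < 1 - R\<^sup>2" using R by (simp add: power_less_one_iff)
  ultimately have "(1 - R\<^sup>2) * (1 - ?x)\<^sup>2 \<le> (1 - R\<^sup>2) * ?m" by (intro mult_left_mono) auto
  also have "\<dots> \<le> (1 - ?y\<^sup>2) * (1 - ?x\<^sup>2)" by (rule *)
  also have "\<dots> \<le> (2 * \<delta>) * (2 * (1 - ?x))"
  proof (intro mult_mono)
    show "1 - ?y\<^sup>2 \<le> 2 * \<delta>" "1 - ?x\<^sup>2 \<le> 2 * (1 - ?x)"
      using one_minus_square_le[of ?y] one_minus_square_le[of ?x] \<delta> by auto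
  qed (use x d0 in \<open>auto simp: power_le_one\<close>)
  finally have "(1 - ?x) * ((1 - R\<^sup>2) * (1 - ?x)) \<le> (1 - ?x) * (4 * \<delta>)" by (simp add: power2_eq_square mult_ac)
  then have "(1 - R\<^sup>2) * (1 - ?x) \<le> 4 * \<delta>" using x by simp
  then have "1 - ?x \<le> 4 * \<delta> / (1 - R\<^sup>2)" using R2 by (simp add: field_simps)
  then show ?thesis by simp
qed

definition zero_free_disc :: "(complex \<Rightarrow> complex) \<Rightarrow> complex \<Rightarrow> real \<Rightarrow> bool" where
  "zero_free_disc T z R \<longleftrightarrow> (\<forall>w\<in>ball 0 1. pseudohyp_dist w z < R \<longrightarrow> T w \<noteq> 0)"

text \<open>A normal families argument. Among the points whose pseudohyperbolic discs of radius tending to \<open>1\<close>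
  contain no zero of \<open>T\<close>, choose ones where \<open>|T|\<close> is asymptotically minimal, and recentre: the limit
  attains its minimum modulus at \<open>0\<close>, so it is constant, and narrowness makes the constant unimodular.\<close>

lemma narrow_imp_near_1:
  fixes T :: "complex \<Rightarrow> complex"
  assumes T: "T holomorphic_on ball 0 1" and T1: "\<And>z. z \<in> ball 0 1 \<Longrightarrow> cmod (T z) \<le> 1"
    and nar: "\<And>\<epsilon>::real. 0 < \<epsilon> \<Longrightarrow> \<epsilon> < 1 \<Longrightarrow> narrow {z \<in> ball 0 1. 0 < cmod (T z) \<and> cmod (T z) < 1 - \<epsilon>}"
    and \<eta>: "0 < \<eta>"
  shows "\<exists>R. 0 < R \<and> R < 1 \<and> (\<forall>z\<in>ball 0 1. zero_free_disc T z R \<longrightarrow> 1 - \<eta> \<le> cmod (T z))"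
proof (rule ccontr)
  assume neg: "\<not> ?thesis"
  define \<rho> where "\<rho> = (\<lambda>n. 1 - 1 / real (n + 2))"
  have \<rho>: "0 < \<rho> n" "\<rho> n < 1" for n by (auto simp: \<rho>_def field_simps)
  have \<rho>lim: "\<rho> \<longlonglongrightarrow> 1" unfolding \<rho>_def by real_asymp
  define P where "P = (\<lambda>n. {z \<in> ball 0 1. zero_free_disc T z (\<rho> n)})"
  define m where "m = (\<lambda>n. INF z\<in>P n. cmod (T z))"
  have bdd: "bdd_below ((\<lambda>z. cmod (T z)) ` P n)" for n by (rule bdd_belowI[of _ 0]) auto
  have ex: "\<exists>z\<in>P n. cmod (T z) < 1 - \<eta>" for n
    using neg \<rho>[of n] unfolding P_def by (force simp: not_le)
  have m_le: "m n \<le> cmod (T z)" if "z \<in> P n" for n z unfolding m_def by (rule cINF_lower[OF bdd that])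
  have m1: "m n < 1 - \<eta>" for n using ex[of n] m_le by force
  have m0: "0 \<le> m n" for n unfolding m_def using ex[of n] by (intro cINF_greatest) auto
  have Pmono: "P n \<subseteq> P k" if "k \<le> n" for n k
  proof -
    have "\<rho> k \<le> \<rho> n" using that unfolding \<rho>_def by (simp add: field_simps)
    then show ?thesis unfolding P_def zero_free_disc_def by force
  qed
  have minc: "incseq m" unfolding incseq_def
  proof (intro allI impI)
    fix k n :: nat assume "k \<le> n"
    have "m k \<le> (INF z\<in>P n. cmod (T z))" using ex[of n] Pmono[OF \<open>k \<le> n\<close>] m_le
      by (intro cINF_greatest) auto
    then show "m k \<le> m n" by (simp add: m_def)
  qed
  obtain \<mu> where \<mu>: "m \<longlonglongrightarrow> \<mu>" "\<And>n. m n \<le> \<mu>"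
    using incseq_convergent[OF minc, of "1 - \<eta>"] m1 less_imp_le by metis
  have \<mu>1: "\<mu> \<le> 1 - \<eta>" by (rule LIMSEQ_le_const2[OF \<mu>(1)]) (use m1 less_imp_le in blast)
  have \<mu>0: "0 \<le> \<mu>" using \<mu>(2)[of 0] m0[of 0] by linarith
  have "\<exists>z\<in>P n. cmod (T z) < m n + 1 / real (n + 2)" for n
  proof -
    have "m n < m n + 1 / real (n + 2)" by simp
    then show ?thesis unfolding m_def using ex[of n] bdd[of n] by (subst (asm) (1) cINF_less_iff) auto
  qed
  then obtain Z where Z: "\<And>n. Z n \<in> P n" "\<And>n. cmod (T (Z n)) < m n + 1 / real (n + 2)" by metis
  have Zb: "Z n \<in> ball 0 1" for n using Z(1)[of n] by (simp add: P_def)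
  define F where "F = (\<lambda>n u. T (disc_aut (Z n) u))"
  have F: "F n holomorphic_on ball 0 1" for n
    unfolding F_def using holomorphic_on_compose_gen[OF disc_aut_holomorphic[OF Zb] T, of n] disc_aut_in_ball[OF Zb]
    by (auto simp: o_def image_subset_iff)
  have F1: "cmod (F n u) \<le> 1" if "u \<in> ball 0 1" for n u unfolding F_def by (intro T1 disc_aut_in_ball Zb that)
  obtain G r where G: "G holomorphic_on ball 0 1" "strict_mono (r :: nat \<Rightarrow> nat)"
    and Glim: "\<And>z. z \<in> ball 0 1 \<Longrightarrow> (\<lambda>n. F (r n) z) \<longlonglongrightarrow> G z"
    and Gunif: "\<And>K. compact K \<Longrightarrow> K \<subseteq> ball 0 1 \<Longrightarrow> uniform_limit K (F \<circ> r) G sequentially"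
    by (rule montel_bounded[of F 1]) (use F F1 in blast)+
  have \<rho>r: "(\<lambda>n. \<rho> (r n)) \<longlonglongrightarrow> 1" using LIMSEQ_subseq_LIMSEQ[OF \<rho>lim G(2)] by (simp add: o_def)
  have F_nz: "F n u \<noteq> 0" if "u \<in> ball 0 1" "cmod u < \<rho> n" for n u
    using Z(1)[of n] disc_aut_in_ball[OF Zb that(1)] pseudohyp_dist_disc_aut[OF Zb that(1)] that(2)
    unfolding P_def zero_free_disc_def F_def by simp
  have G0: "cmod (G 0) = \<mu>"
  proof (rule antisym)
    have "(\<lambda>n. m (r n) + 1 / real (r n + 2)) \<longlonglongrightarrow> \<mu> + 0"
    proof (rule tendsto_add)
      show "(\<lambda>n. m (r n)) \<longlonglongrightarrow> \<mu>" using LIMSEQ_subseq_LIMSEQ[OF \<mu>(1) G(2)] by (simp add: o_def)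
      have "(\<lambda>n. 1 / real (n + 2)) \<longlonglongrightarrow> 0" by real_asymp
      from LIMSEQ_subseq_LIMSEQ[OF this G(2)] show "(\<lambda>n. 1 / real (r n + 2)) \<longlonglongrightarrow> 0" by (simp add: o_def)
    qed
    moreover have "cmod (F (r n) 0) \<le> m (r n) + 1 / real (r n + 2)" for n
      using Z(2)[of "r n"] by (simp add: F_def)
    ultimately show "cmod (G 0) \<le> \<mu>"
      using LIMSEQ_le[OF tendsto_norm[OF Glim[of 0]]] by auto
    have "m (r n) \<le> cmod (F (r n) 0)" for n using m_le[OF Z(1)] by (simp add: F_def)
    moreover have "(\<lambda>n. m (r n)) \<longlonglongrightarrow> \<mu>" using LIMSEQ_subseq_LIMSEQ[OF \<mu>(1) G(2)] by (simp add: o_def)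
    ultimately show "\<mu> \<le> cmod (G 0)"
      using LIMSEQ_le[OF _ tendsto_norm[OF Glim[of 0]]] by auto
  qed
  \<comment> \<open>For fixed \<open>k\<close> and large \<open>n\<close>, the disc of radius
    \<open>\<rho> k\<close> about the recentred point \<open>w\<close> lies in the zero-free disc of
    radius \<open>\<rho> (r n)\<close> about \<open>Z (r n)\<close>. So that point is in
    \<open>P k\<close>, whence \<open>m k \<le> |G w|\<close>, and \<open>k\<close> may tend to
    infinity.\<close>
  have Gge: "\<mu> \<le> cmod (G w)" if w: "w \<in> ball 0 1" for w
  proof (rule LIMSEQ_le_const2[OF \<mu>(1)], intro exI[of _ 0] allI impI)
    fix k
    define c where "c = (1 - (\<rho> k)\<^sup>2) * (1 - (cmod w)\<^sup>2) / 4"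
    have "0 < 1 - (\<rho> k)\<^sup>2" "0 < 1 - (cmod w)\<^sup>2" using \<rho>[of k] w by (auto simp: power_less_one_iff)
    then have c: "c > 0" by (simp add: c_def)
    have "(\<lambda>n. (\<rho> (r n))\<^sup>2) \<longlonglongrightarrow> 1\<^sup>2" by (intro tendsto_power \<rho>r)
    then have "eventually (\<lambda>n. (\<rho> (r n))\<^sup>2 > 1 - c) sequentially" using c by (intro order_tendstoD) auto
    then have "eventually (\<lambda>n. m k \<le> cmod (F (r n) w)) sequentially"
    proof eventually_elim
      case (elim n)
      have "disc_aut (Z (r n)) w \<in> P k"
        unfolding P_def zero_free_disc_def
      proof (intro CollectI conjI ballI impI disc_aut_in_ball Zb w)
        fix v assume v: "v \<in> ball 0 1" "pseudohyp_dist v (disc_aut (Z (r n)) w) < \<rho> k"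
        define u where "u = disc_aut (- Z (r n)) v"
        have u: "u \<in> ball 0 1" unfolding u_def using Zb[of "r n"] v by (intro disc_aut_in_ball) auto
        have vu: "v = disc_aut (Z (r n)) u" unfolding u_def using disc_aut_inverse[OF Zb v(1)] by simp
        have "pseudohyp_dist u w < \<rho> k" using v(2) unfolding vu pseudohyp_dist_aut[OF Zb u w] .
        then have "(cmod u)\<^sup>2 \<le> 1 - c"
          unfolding c_def using \<rho>[of k] by (intro pseudohyp_dist_imp_norm_le u w) auto
        then have "(cmod u)\<^sup>2 < (\<rho> (r n))\<^sup>2" using elim by linarith
        then have "cmod u < \<rho> (r n)" by (rule power2_less_imp_less) (rule less_imp_le[OF \<rho>(1)])
        then show "T v \<noteq> 0" using F_nz[OF u] unfolding F_def vu by blast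
      qed
      then show ?case using m_le unfolding F_def by blast
    qed
    then show "m k \<le> cmod (G w)"
      by (intro tendsto_lowerbound[OF tendsto_norm[OF Glim[OF w]]]) auto
  qed
  have const: "G constant_on ball 0 1"
  proof (cases "\<mu> = 0")
    case False
    then have nz: "G w \<noteq> 0" if "w \<in> ball 0 1" for w using Gge[OF that] \<mu>0 by auto
    have "(\<lambda>w. 1 / G w) constant_on ball 0 1"
    proof (rule maximum_modulus_principle)
      show "(\<lambda>w. 1 / G w) holomorphic_on ball 0 1" using nz by (intro holomorphic_intros G)
      show "norm (1 / G z) \<le> norm (1 / G 0)" if "z \<in> ball 0 1" for z
        using Gge[OF that] G0 False \<mu>0 by (simp add: norm_divide frac_le)
    qed auto
    then obtain k where "\<And>w. w \<in> ball 0 1 \<Longrightarrow> 1 / G w = k" by (auto simp: constant_on_def)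
    then have "G w = 1 / k" if "w \<in> ball 0 1" for w using that by force
    then show ?thesis unfolding constant_on_def by blast
  next
    case True
    then have G00: "G 0 = 0" using G0 by simp
    \<comment> \<open>Hurwitz: the recentred functions eventually have no zeros in the half disc,
      while their limit vanishes at 0.\<close>
    have half: "G constant_on ball 0 (1/2)"
    proof (rule ccontr)
      assume nc: "\<not> G constant_on ball 0 (1/2)"
      have "eventually (\<lambda>n. \<rho> (r n) > 1/2) sequentially" by (rule order_tendstoD(1)[OF \<rho>r]) simp
      then obtain N where N: "\<And>n. n \<ge> N \<Longrightarrow> \<rho> (r n) > 1/2" by (auto simp: eventually_sequentially)
      have sub: "ball (0::complex) (1/2) \<subseteq> ball 0 1" by auto
      have "G 0 \<noteq> 0"
      proof (rule Hurwitz_no_zeros[of "ball 0 (1/2)" "\<lambda>n. F (r (n + N))" G])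
        show "F (r (n + N)) holomorphic_on ball 0 (1/2)" for n using F sub by (rule holomorphic_on_subset)
        show "G holomorphic_on ball 0 (1/2)" using G(1) sub by (rule holomorphic_on_subset)
        show "uniform_limit K (\<lambda>n. F (r (n + N))) G sequentially" if K: "compact K" "K \<subseteq> ball 0 (1/2)" for K
        proof -
          have "uniform_limit K (F \<circ> r) G sequentially" using K sub by (intro Gunif) auto
          then show ?thesis using filterlim_compose[OF _ filterlim_add_const_nat_at_top]
            by (auto simp: o_def)
        qed
        show "F (r (n + N)) z \<noteq> 0" if "z \<in> ball 0 (1/2)" for n z
          using that N[of "n + N"] by (intro F_nz) auto
      qed (use nc in auto)
      then show False using G00 by simp
    qed
    have "G w = 0" if "w \<in> ball 0 1" for w
    proof (rule analytic_continuation[OF G(1), of "ball 0 (1/2)" 0])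
      show "(0::complex) islimpt ball 0 (1/2)" by (simp add: islimpt_ball)
      show "G z = 0" if "z \<in> ball 0 (1/2)" for z using half G00 that unfolding constant_on_def by force
    qed (use that in auto)
    then show ?thesis unfolding constant_on_def by blast
  qed
  then have Gmu: "cmod (G w) = \<mu>" if "w \<in> ball 0 1" for w
    using G0 that unfolding constant_on_def by force
  \<comment> \<open>With \<open>\<mu> + \<epsilon> = 1 - \<epsilon>\<close>, a function uniformly
    within \<open>\<epsilon>\<close> of modulus \<open>\<mu>\<close> stays below
    \<open>1 - \<epsilon>\<close>. Being zero-free as well, it would fill a disc that narrowness
    excludes.\<close>
  define \<epsilon> where "\<epsilon> = (1 - \<mu>) / 2"
  have \<epsilon>: "0 < \<epsilon>" "\<epsilon> < 1" "\<mu> + \<epsilon> = 1 - \<epsilon>" using \<mu>1 \<mu>0 \<eta> by (auto simp: \<epsilon>_def field_simps)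
  obtain R where R: "0 < R" "R < 1" and Rn: "\<And>z. z \<in> ball 0 1 \<Longrightarrow>
     \<not> {w \<in> ball 0 1. pseudohyp_dist z w < R} \<subseteq> {z \<in> ball 0 1. 0 < cmod (T z) \<and> cmod (T z) < 1 - \<epsilon>}"
    using nar[OF \<epsilon>(1,2)] unfolding narrow_def by auto
  have "uniform_limit (cball 0 R) (F \<circ> r) G sequentially" using R by (intro Gunif) auto
  then have e1: "eventually (\<lambda>n. \<forall>u\<in>cball 0 R. dist ((F \<circ> r) n u) (G u) < \<epsilon>) sequentially"
    using \<epsilon> by (intro uniform_limitD)
  have e2: "eventually (\<lambda>n. \<rho> (r n) > R) sequentially" by (rule order_tendstoD(1)[OF \<rho>r R(2)])
  obtain n where n: "\<forall>u\<in>cball 0 R. dist ((F \<circ> r) n u) (G u) < \<epsilon>" "\<rho> (r n) > R"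
    using eventually_happens'[OF _ eventually_conj[OF e1 e2]] by auto
  obtain w where w: "w \<in> ball 0 1" "pseudohyp_dist (Z (r n)) w < R" "\<not> (0 < cmod (T w) \<and> cmod (T w) < 1 - \<epsilon>)"
    using Rn[OF Zb[of "r n"]] by auto
  define u where "u = disc_aut (- Z (r n)) w"
  have u: "u \<in> ball 0 1" unfolding u_def using Zb[of "r n"] w by (intro disc_aut_in_ball) auto
  have wu: "w = disc_aut (Z (r n)) u" unfolding u_def using disc_aut_inverse[OF Zb w(1)] by simp
  have uR: "cmod u < R"
    using w(2) pseudohyp_dist_commute[of "Z (r n)" w] pseudohyp_dist_eq[of w "Z (r n)"] unfolding u_def by linarith
  have Fw: "F (r n) u = T w" by (simp add: F_def wu)
  have "T w \<noteq> 0" using F_nz[OF u, of "r n"] uR n(2) Fw by auto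
  then have "1 - \<epsilon> \<le> cmod (F (r n) u)" using w(3) Fw by auto
  moreover have "dist (F (r n) u) (G u) < \<epsilon>" using n(1) uR by auto
  then have "cmod (F (r n) u) < cmod (G u) + \<epsilon>"
    using norm_triangle_sub[of "F (r n) u" "G u"] by (simp add: dist_norm)
  ultimately show False using Gmu[OF u] \<epsilon>(3) by linarith
qed

section \<open>The quotient algebra\<close>

lemma H_infty_carrier_iff:
  "f \<in> carrier H_infty \<longleftrightarrow> f holomorphic_on unit_disc \<and> (\<exists>B. \<forall>z\<in>unit_disc. cmod (f z) \<le> B) \<and>
     (\<forall>z. z \<notin> unit_disc \<longrightarrow> f z = 0)"
  by (auto simp: H_infty_def bounded_iff)

lemma H_infty_memI:
  assumes "f holomorphic_on unit_disc" "\<And>z. z \<in> unit_disc \<Longrightarrow> cmod (f z) \<le> B"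
  shows "(\<lambda>z. if z \<in> unit_disc then f z else 0) \<in> carrier H_infty"
  unfolding H_infty_carrier_iff
proof (intro conjI)
  show "(\<lambda>z. if z \<in> unit_disc then f z else 0) holomorphic_on unit_disc"
    by (rule holomorphic_transform[OF assms(1)]) simp
  show "\<exists>B. \<forall>z\<in>unit_disc. cmod (if z \<in> unit_disc then f z else 0) \<le> B"
    using assms(2) by (intro exI[of _ B]) simp
qed simp

lemma cmod_le_sup_norm:
  assumes "f \<in> carrier H_infty" "z \<in> unit_disc"
  shows "cmod (f z) \<le> sup_norm f"
  unfolding sup_norm_def
proof (rule cSUP_upper[OF assms(2)])
  obtain B where "\<forall>z\<in>unit_disc. cmod (f z) \<le> B" using assms(1) unfolding H_infty_carrier_iff by blast
  then show "bdd_above ((\<lambda>z. cmod (f z)) ` unit_disc)" by (intro bdd_aboveI2) blast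
qed

lemma sup_norm_le: "(\<And>z. z \<in> unit_disc \<Longrightarrow> cmod (f z) \<le> B) \<Longrightarrow> sup_norm f \<le> B"
  unfolding sup_norm_def by (rule cSUP_least) auto

lemma sup_norm_nonneg: "f \<in> carrier H_infty \<Longrightarrow> 0 \<le> sup_norm f"
  using order_trans[OF norm_ge_zero cmod_le_sup_norm[of f 0]] by simp

lemma quot_class_eq:
  "quot_class \<Theta> f = {\<lambda>z. x z * \<Theta> z + f z | x. x \<in> carrier H_infty}"
  by (auto simp: quot_class_def a_r_coset_def' cgenideal_def H_infty_def)

lemma quot_class_subset_carrier:
  assumes "\<Theta> \<in> carrier H_infty" "f \<in> carrier H_infty"
  shows "quot_class \<Theta> f \<subseteq> carrier H_infty"
proof -
  interpret ideal "PIdl\<^bsub>H_infty\<^esub> \<Theta>" H_infty by (rule ideal_PIdl_H_infty[OF assms(1)])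
  show ?thesis unfolding quot_class_def by (rule a_r_coset_subset_G) (use a_subset assms in auto)
qed

lemma quot_norm_quot_class_le:
  assumes "\<Theta> \<in> carrier H_infty" "f \<in> carrier H_infty"
  shows "quot_norm (quot_class \<Theta> f) \<le> sup_norm f"
  unfolding quot_norm_def
proof (rule cINF_lower)
  show "bdd_below (sup_norm ` quot_class \<Theta> f)"
    using quot_class_subset_carrier[OF assms] sup_norm_nonneg by (intro bdd_belowI2[of _ 0]) blast
  have "(\<lambda>z. 0) \<in> carrier H_infty" unfolding H_infty_carrier_iff by auto
  then show "f \<in> quot_class \<Theta> f" unfolding quot_class_eq by force
qed

lemma quot_norm_lessD:
  assumes "quot_norm (quot_class \<Theta> f) < c"
  obtains g where "g \<in> carrier H_infty" "sup_norm (\<lambda>z. g z * \<Theta> z + f z) < c"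
proof -
  have "(\<lambda>z. 0) \<in> carrier H_infty" unfolding H_infty_carrier_iff by auto
  then have "quot_class \<Theta> f \<noteq> {}" unfolding quot_class_eq by auto
  then obtain h where "h \<in> quot_class \<Theta> f" "sup_norm h < c"
    using cInf_lessD[of "sup_norm ` quot_class \<Theta> f" c] assms unfolding quot_norm_def by auto
  then show thesis using that unfolding quot_class_eq by auto
qed

text \<open>The strict bound \<open>c\<close> provides an actual representative of the inverse
  coset, since the infimum need not be attained.\<close>

lemma quot_class_unitD:
  assumes \<Theta>: "\<Theta> \<in> carrier H_infty" and f: "f \<in> carrier H_infty"
    and unit: "quot_class \<Theta> f \<in> Units (quot_algebra \<Theta>)"
    and c: "quot_norm (inv\<^bsub>quot_algebra \<Theta>\<^esub> (quot_class \<Theta> f)) < c"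
  obtains g x where "g \<in> carrier H_infty" "x \<in> carrier H_infty" "sup_norm g < c"
    "\<And>z. z \<in> unit_disc \<Longrightarrow> f z * g z = 1 + x z * \<Theta> z"
proof -
  interpret I: ideal "PIdl\<^bsub>H_infty\<^esub> \<Theta>" H_infty by (rule ideal_PIdl_H_infty[OF \<Theta>])
  interpret Q: ring "quot_algebra \<Theta>" unfolding quot_algebra_def by (rule I.quotient_is_ring)
  let ?D = "inv\<^bsub>quot_algebra \<Theta>\<^esub> (quot_class \<Theta> f)"
  have "?D \<in> carrier (quot_algebra \<Theta>)" by (rule Q.Units_inv_closed[OF unit])
  then obtain d where d: "d \<in> carrier H_infty" "?D = quot_class \<Theta> d"
    unfolding quot_algebra_def quot_class_def FactRing_def A_RCOSETS_def' by auto
  obtain y where y: "y \<in> carrier H_infty" "sup_norm (\<lambda>z. y z * \<Theta> z + d z) < c"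
    using quot_norm_lessD c unfolding d(2) by blast
  define g where "g = (\<lambda>z. y z * \<Theta> z + d z)"
  have gD: "g \<in> quot_class \<Theta> d" unfolding quot_class_eq g_def using y(1) by blast
  have g: "g \<in> carrier H_infty" using gD quot_class_subset_carrier[OF \<Theta> d(1)] by blast
  have "quot_class \<Theta> d = quot_class \<Theta> g"
    unfolding quot_class_def by (rule I.a_repr_independence'[OF gD[unfolded quot_class_def] d(1)])
  then have Dg: "?D = quot_class \<Theta> g" unfolding d(2) .
  have "quot_class \<Theta> f \<otimes>\<^bsub>quot_algebra \<Theta>\<^esub> ?D = \<one>\<^bsub>quot_algebra \<Theta>\<^esub>" by (rule Q.Units_r_inv[OF unit])
  then have "quot_class \<Theta> (f \<otimes>\<^bsub>H_infty\<^esub> g) = quot_class \<Theta> \<one>\<^bsub>H_infty\<^esub>"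
    unfolding Dg using I.rcoset_mult_add[OF f g] by (simp add: quot_algebra_def quot_class_def FactRing_def)
  then have "f \<otimes>\<^bsub>H_infty\<^esub> g \<in> quot_class \<Theta> \<one>\<^bsub>H_infty\<^esub>"
    unfolding quot_class_def using f g by (intro I.a_repr_independenceD) auto
  then obtain x where x: "x \<in> carrier H_infty" "f \<otimes>\<^bsub>H_infty\<^esub> g = (\<lambda>z. x z * \<Theta> z + \<one>\<^bsub>H_infty\<^esub> z)"
    unfolding quot_class_eq by blast
  have "f z * g z = 1 + x z * \<Theta> z" if "z \<in> unit_disc" for z
    using fun_cong[OF x(2), of z] that by (simp add: H_infty_def)
  then show thesis using that g x(1) y(2) unfolding g_def by blast
qed

lemma quot_class_unitI:
  assumes \<Theta>: "\<Theta> \<in> carrier H_infty" and f: "f \<in> carrier H_infty" and g: "g \<in> carrier H_infty"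
    and x: "x \<in> carrier H_infty" and eq: "\<And>z. z \<in> unit_disc \<Longrightarrow> f z * g z = 1 + x z * \<Theta> z"
  shows "quot_class \<Theta> f \<in> Units (quot_algebra \<Theta>)"
    and "inv\<^bsub>quot_algebra \<Theta>\<^esub> (quot_class \<Theta> f) = quot_class \<Theta> g"
proof -
  interpret I: ideal "PIdl\<^bsub>H_infty\<^esub> \<Theta>" H_infty by (rule ideal_PIdl_H_infty[OF \<Theta>])
  interpret Q: cring "quot_algebra \<Theta>" unfolding quot_algebra_def by (rule I.quotient_is_cring[OF cring_H_infty])
  have carr: "quot_class \<Theta> h \<in> carrier (quot_algebra \<Theta>)" if "h \<in> carrier H_infty" for h
    unfolding quot_algebra_def quot_class_def FactRing_def A_RCOSETS_def' using that by auto
  have "f \<otimes>\<^bsub>H_infty\<^esub> g = (\<lambda>z. x z * \<Theta> z + \<one>\<^bsub>H_infty\<^esub> z)"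
    using eq f x by (auto simp: H_infty_def fun_eq_iff)
  then have "f \<otimes>\<^bsub>H_infty\<^esub> g \<in> quot_class \<Theta> \<one>\<^bsub>H_infty\<^esub>"
    unfolding quot_class_eq using x by blast
  then have "quot_class \<Theta> \<one>\<^bsub>H_infty\<^esub> = quot_class \<Theta> (f \<otimes>\<^bsub>H_infty\<^esub> g)"
    unfolding quot_class_def by (intro I.a_repr_independence') auto
  then have fg: "quot_class \<Theta> f \<otimes>\<^bsub>quot_algebra \<Theta>\<^esub> quot_class \<Theta> g = \<one>\<^bsub>quot_algebra \<Theta>\<^esub>"
    using I.rcoset_mult_add[OF f g] by (simp add: quot_algebra_def quot_class_def FactRing_def)
  then have gf: "quot_class \<Theta> g \<otimes>\<^bsub>quot_algebra \<Theta>\<^esub> quot_class \<Theta> f = \<one>\<^bsub>quot_algebra \<Theta>\<^esub>"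
    using Q.m_comm[OF carr[OF f] carr[OF g]] by simp
  show "quot_class \<Theta> f \<in> Units (quot_algebra \<Theta>)"
    unfolding Units_def using carr f g fg gf by blast
  show "inv\<^bsub>quot_algebra \<Theta>\<^esub> (quot_class \<Theta> f) = quot_class \<Theta> g"
    by (rule Q.comm_inv_char[OF carr[OF f] carr[OF g] fg])
qed

section \<open>The two implications\<close>

text \<open>Radial limits of \<open>|\<Theta>|\<close> enter only through the defect \<open>|1 - |\<Theta>||\<close>, whose circle means tend to \<open>0\<close>.
  Applying Cauchy's estimate to powers of \<open>G\<close> removes the constant.\<close>

lemma inner_maximum_principle:
  assumes inner: "inner_function \<Theta>" and G: "G holomorphic_on ball 0 1" and B: "B \<ge> 0"
    and bound: "\<And>z. z \<in> ball 0 1 \<Longrightarrow> cmod (G z) \<le> 1 + B * \<bar>1 - cmod (\<Theta> z)\<bar>"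
    and z: "z \<in> ball 0 1"
  shows "cmod (G z) \<le> 1"
proof -
  have \<Theta>: "\<Theta> holomorphic_on ball 0 1" and "\<exists>C. \<forall>z\<in>ball 0 1. cmod (\<Theta> z) \<le> C"
    and lim: "AE t in lebesgue_on {0..2 * pi}.
        \<exists>l. cmod l = 1 \<and> ((\<lambda>r::real. \<Theta> (of_real r * cis t)) \<longlongrightarrow> l) (at_left 1)"
    using inner unfolding inner_function_def H_infty_carrier_iff by auto
  \<comment> \<open>The bound by 1 is deduced from this lemma, so dominated convergence works with
    an arbitrary bound.\<close>
  then obtain C where C: "\<And>z. z \<in> ball 0 1 \<Longrightarrow> cmod (\<Theta> z) \<le> C" by blast
  have C0: "C \<ge> 0" using order_trans[OF norm_ge_zero C[of 0]] by simp
  define r where "r = (\<lambda>n. 1 - 1 / real (n + 2))"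
  have r: "0 < r n" "r n < 1" for n by (auto simp: r_def field_simps)
  have rlim: "r \<longlonglongrightarrow> 1" unfolding r_def by real_asymp
  have rl: "filterlim r (at_left 1) sequentially"
    unfolding filterlim_at using rlim r by (auto intro!: always_eventually simp: less_imp_neq)
  have rb': "of_real (r n) * w \<in> ball 0 1" if "cmod w \<le> 1" for w n
    using that r[of n] by (intro dilation_in_ball) (auto simp: order_le_less_trans)
  have hol: "(\<lambda>w. F (of_real (r n) * w)) holomorphic_on ball 0 (1 / r n)" if "F holomorphic_on ball 0 1" for F n
    by (rule holomorphic_dilation[OF that r(1)])
  have r1: "1 / r n > 1" for n using r[of n] by (simp add: field_simps)
  have cont: "continuous_on (cball 0 1) (\<lambda>w. F (of_real (r n) * w))" if "F holomorphic_on ball 0 1" for F n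
    by (rule holomorphic_continuous_cball[OF hol[OF that] r1])
  have key: "cmod (G z) ^ k \<le> 1 / (1 - cmod z)" for k
  proof -
    let ?W = "\<lambda>n w. (1 + B * \<bar>1 - cmod (\<Theta> (of_real (r n) * w))\<bar>) ^ k"
    have contW: "continuous_on (sphere 0 1) (?W n)" for n
      by (intro continuous_intros continuous_on_sphere_if_cball cont \<Theta>)
    have W_lim: "(\<lambda>n. circle_mean (?W n)) \<longlonglongrightarrow> 1"
    proof -
      let ?M = "lebesgue_on {0..2*pi}"
      have int: "integrable ?M (\<lambda>t. ?W n (cis t))" for n
        by (intro continuous_imp_integrable_real continuous_on_compose2[OF contW]) (auto intro!: continuous_intros)
      have eq: "circle_mean (?W n) = integral\<^sup>L ?M (\<lambda>t. ?W n (cis t)) / (2*pi)" for n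
        unfolding circle_mean_def using lebesgue_integral_eq_integral[OF int] by simp
      have "(\<lambda>n. integral\<^sup>L ?M (\<lambda>t. ?W n (cis t))) \<longlonglongrightarrow> integral\<^sup>L ?M (\<lambda>t. 1)"
      proof (rule integral_dominated_convergence)
        show "integrable ?M (\<lambda>t. (1 + B * (1 + C)) ^ k)" by (intro continuous_imp_integrable_real continuous_intros)
        show "(\<lambda>t. ?W n (cis t)) \<in> borel_measurable ?M" for n using int by (rule borel_measurable_integrable)
        show "AE t in ?M. norm (?W n (cis t)) \<le> (1 + B * (1 + C)) ^ k" for n
        proof (rule AE_I2)
          fix t
          have "\<bar>1 - cmod (\<Theta> (of_real (r n) * cis t))\<bar> \<le> 1 + C"
          proof -
            have "cmod (\<Theta> (of_real (r n) * cis t)) \<le> C" by (rule C[OF rb']) simp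
            moreover have "0 \<le> cmod (\<Theta> (of_real (r n) * cis t))" by (rule norm_ge_zero)
            ultimately show ?thesis by linarith
          qed
          then show "norm (?W n (cis t)) \<le> (1 + B * (1 + C)) ^ k"
            using B by (simp add: power_mono mult_left_mono)
        qed
        show "AE t in ?M. (\<lambda>n. ?W n (cis t)) \<longlonglongrightarrow> 1"
          using lim
        proof eventually_elim
          case (elim t)
          then obtain l where l: "cmod l = 1" "((\<lambda>r::real. \<Theta> (of_real r * cis t)) \<longlongrightarrow> l) (at_left 1)" by blast
          have "(\<lambda>n. \<Theta> (of_real (r n) * cis t)) \<longlonglongrightarrow> l" by (rule filterlim_compose[OF l(2) rl])
          then have "(\<lambda>n. ?W n (cis t)) \<longlonglongrightarrow> (1 + B * \<bar>1 - cmod l\<bar>) ^ k" by (intro tendsto_intros)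
          then show ?case using l(1) by simp
        qed
      qed simp
      moreover have "integral\<^sup>L ?M (\<lambda>t. 1::real) = 2 * pi"
        by (subst lebesgue_integral_eq_integral) (auto intro!: continuous_imp_integrable_real)
      ultimately have "(\<lambda>n. integral\<^sup>L ?M (\<lambda>t. ?W n (cis t)) / (2*pi)) \<longlonglongrightarrow> 2 * pi / (2*pi)"
        by (intro tendsto_divide) auto
      then show ?thesis unfolding eq by simp
    qed
    have "eventually (\<lambda>n. r n > cmod z) sequentially" using z by (intro order_tendstoD(1)[OF rlim]) auto
    then have ev: "eventually (\<lambda>n. cmod (G z) ^ k \<le> 1 / (1 - cmod z / r n) * circle_mean (?W n)) sequentially"
    proof eventually_elim
      case (elim n)
      define w where "w = z / of_real (r n)"
      have wz: "of_real (r n) * w = z" using r[of n] by (simp add: w_def)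
      have cw: "cmod w = cmod z / r n" using r[of n] by (simp add: w_def norm_divide)
      have w1: "cmod w < 1" unfolding cw using elim r[of n] by simp
      have wR: "cmod w * (min (1 / r n) (1 / max (1/2) (cmod w))) \<le> 1"
      proof -
        have "cmod w * (min (1 / r n) (1 / max (1/2) (cmod w))) \<le> cmod w * (1 / max (1/2) (cmod w))"
          by (intro mult_left_mono) auto
        also have "\<dots> \<le> 1" by (auto simp: max_def field_simps)
        finally show ?thesis .
      qed
      \<comment> \<open>The maximum with \<open>1/2\<close> avoids a division by 0 when
        \<open>w = 0\<close>.\<close>
      define R where "R = min (1 / r n) (1 / max (1/2) (cmod w))"
      have "0 < max (1/2) (cmod w)" "max (1/2) (cmod w) < 1" using w1 by auto
      then have R: "R > 1" unfolding R_def using r1[of n] by (simp add: less_divide_eq)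
      \<comment> \<open>\<open>circle_mean_szego\<close> gives real parts only; this factor rotates
        \<open>G z ^ k\<close> onto its modulus.\<close>
      define c where "c = cnj (sgn (G z ^ k))"
      have cn: "cmod c \<le> 1" by (simp add: c_def norm_sgn)
      have cG: "c * G z ^ k = of_real (cmod (G z) ^ k)"
      proof -
        have "cnj (sgn x) * x = of_real (cmod x)" for x :: complex
        proof (cases "x = 0")
          case False
          have "cnj (sgn x) * x = (x * cnj x) / of_real (cmod x)" by (simp add: sgn_eq)
          also have "\<dots> = of_real (cmod x)"
            using False by (simp add: complex_norm_square[symmetric] power2_eq_square)
          finally show ?thesis .
        qed simp
        from this[of "G z ^ k"] show ?thesis by (simp add: c_def norm_power)
      qed
      have hG: "(\<lambda>u. c * G (of_real (r n) * u) ^ k) holomorphic_on ball 0 R"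
        by (intro holomorphic_intros holomorphic_on_subset[OF hol[OF G]]) (auto simp: R_def)
      have sz: "szego w holomorphic_on ball 0 R" by (rule szego_holomorphic) (use wR R in \<open>auto simp: R_def\<close>)
      have "cmod (G z) ^ k = Re (c * G (of_real (r n) * w) ^ k)" unfolding wz cG by simp
      also have "\<dots> = circle_mean (\<lambda>u. Re (c * G (of_real (r n) * u) ^ k * cnj (szego w u)))"
        by (rule circle_mean_szego[OF hG R, symmetric]) (use wR in \<open>simp add: R_def\<close>)
      also have "\<dots> \<le> circle_mean (\<lambda>u. 1 / (1 - cmod w) * ?W n u)"
      proof (rule circle_mean_mono)
        show "continuous_on (sphere 0 1) (\<lambda>u. Re (c * G (of_real (r n) * u) ^ k * cnj (szego w u)))"
          by (intro continuous_intros continuous_on_sphere_if_cball cont[OF G] holomorphic_continuous_cball[OF sz R])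
        show "continuous_on (sphere 0 1) (\<lambda>u. 1 / (1 - cmod w) * ?W n u)"
          by (rule continuous_on_mult[OF continuous_on_const contW])
        fix u :: complex assume u: "cmod u = 1"
        have "Re (c * G (of_real (r n) * u) ^ k * cnj (szego w u)) \<le> cmod (c * G (of_real (r n) * u) ^ k * cnj (szego w u))"
          by (rule complex_Re_le_cmod)
        also have "\<dots> = cmod c * (cmod (G (of_real (r n) * u)) ^ k * cmod (szego w u))"
          by (simp add: norm_mult norm_power)
        also have "\<dots> \<le> 1 * (?W n u * (1 / (1 - cmod w)))"
        proof (intro mult_mono cn power_mono bound)
          have "1 - cmod w \<le> cmod (1 - cnj w * u)"
            using u by (intro one_minus_norm_le) simp
          then show "cmod (szego w u) \<le> 1 / (1 - cmod w)" unfolding szego_def norm_divide norm_one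
            using w1 by (intro divide_left_mono mult_pos_pos) auto
          show "of_real (r n) * u \<in> ball 0 1" using u by (intro rb') simp
        qed (use B in auto)
        finally show "Re (c * G (of_real (r n) * u) ^ k * cnj (szego w u)) \<le> 1 / (1 - cmod w) * ?W n u" by simp
      qed
      also have "\<dots> = 1 / (1 - cmod z / r n) * circle_mean (?W n)" unfolding circle_mean_cmult cw ..
      finally show ?case .
    qed
    have "(\<lambda>n. 1 / (1 - cmod z / r n) * circle_mean (?W n)) \<longlonglongrightarrow> 1 / (1 - cmod z / 1) * 1"
      using z by (intro tendsto_intros rlim W_lim) auto
    from tendsto_lowerbound[OF this ev] show ?thesis by simp
  qed
  show ?thesis
  proof (rule ccontr)
    assume "\<not> ?thesis"
    then obtain k where "1 / (1 - cmod z) < cmod (G z) ^ k" using real_arch_pow[of "cmod (G z)"] by auto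
    then show False using key[of k] by simp
  qed
qed

text \<open>For \<open>G = \<Theta>\<close> and \<open>B = 1\<close> the pointwise hypothesis of the
  maximum principle is the triangle inequality.\<close>

lemma inner_function_le_1:
  assumes "inner_function \<Theta>" "z \<in> ball 0 1"
  shows "cmod (\<Theta> z) \<le> 1"
proof (rule inner_maximum_principle[OF assms(1), where B = 1 and G = \<Theta> and z = z])
  show "\<Theta> holomorphic_on ball 0 1" using assms(1) unfolding inner_function_def H_infty_carrier_iff by blast
qed (use assms(2) in auto)

lemma SIP_imp_narrow:
  fixes \<epsilon> :: real
  assumes inner: "inner_function \<Theta>" and sip: "SIP \<Theta>" and \<epsilon>: "0 < \<epsilon>" "\<epsilon> < 1"
  shows "narrow {z \<in> unit_disc. 0 < cmod (\<Theta> z) \<and> cmod (\<Theta> z) < 1 - \<epsilon>}" (is "narrow ?S")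
proof (rule ccontr)
  assume neg: "\<not> narrow ?S"
  have \<Theta>: "\<Theta> \<in> carrier H_infty" using inner by (simp add: inner_function_def)
  have \<Theta>hol: "\<Theta> holomorphic_on unit_disc" using \<Theta> by (simp add: H_infty_carrier_iff)
  obtain \<delta> where \<delta>: "\<delta> > 0" and S: "\<And>f. f \<in> carrier H_infty \<Longrightarrow> quot_norm (quot_class \<Theta> f) \<le> 1 \<Longrightarrow>
        (zero_set \<Theta> \<noteq> {} \<longrightarrow> (INF z\<in>zero_set \<Theta>. cmod (f z)) \<ge> 1 - \<delta>) \<Longrightarrow>
        quot_class \<Theta> f \<in> Units (quot_algebra \<Theta>) \<and>
        quot_norm (inv\<^bsub>quot_algebra \<Theta>\<^esub> (quot_class \<Theta> f)) \<le> 1 + \<epsilon>/4"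
    using sip \<epsilon> unfolding SIP_def by (metis divide_pos_pos zero_less_numeral)
  \<comment> \<open>Every zero of \<open>\<Theta>\<close> is at distance at least
    \<open>R \<ge> 1 - \<delta>\<close> from the centre, and this distance is \<open>|f|\<close>
    there. The \<open>1/2\<close> keeps \<open>R\<close> positive.\<close>
  define R where "R = max (1/2) (1 - \<delta>)"
  have R: "0 < R" "R < 1" "1 - \<delta> \<le> R" using \<delta> by (auto simp: R_def)
  obtain a where a: "a \<in> unit_disc" "{w \<in> unit_disc. pseudohyp_dist a w < R} \<subseteq> ?S"
    using neg R unfolding narrow_def by blast
  define f where "f = (\<lambda>z. if z \<in> unit_disc then disc_aut (- a) z else 0)"
  have am: "- a \<in> ball 0 1" using a(1) by simp
  have aut1: "cmod (disc_aut (- a) z) \<le> 1" if "z \<in> unit_disc" for z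
    using disc_aut_in_ball[OF am that] by simp
  have f: "f \<in> carrier H_infty" unfolding f_def by (rule H_infty_memI[OF disc_aut_holomorphic[OF am] aut1])
  have "sup_norm f \<le> 1" by (rule sup_norm_le) (use aut1 in \<open>simp add: f_def\<close>)
  then have n1: "quot_norm (quot_class \<Theta> f) \<le> 1" using quot_norm_quot_class_le[OF \<Theta> f] by linarith
  have "1 - \<delta> \<le> cmod (f z)" if "z \<in> zero_set \<Theta>" for z
  proof -
    have z: "z \<in> unit_disc" "\<Theta> z = 0" using that by (auto simp: zero_set_def)
    then have "\<not> pseudohyp_dist a z < R" using a(2) by auto
    then show ?thesis using z R(3) pseudohyp_dist_commute[of a z] pseudohyp_dist_eq[of z a] by (simp add: f_def)
  qed
  then have "zero_set \<Theta> \<noteq> {} \<longrightarrow> (INF z\<in>zero_set \<Theta>. cmod (f z)) \<ge> 1 - \<delta>" by (auto intro!: cINF_greatest)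
  from S[OF f n1 this] have unit: "quot_class \<Theta> f \<in> Units (quot_algebra \<Theta>)"
    and "quot_norm (inv\<^bsub>quot_algebra \<Theta>\<^esub> (quot_class \<Theta> f)) < 1 + \<epsilon>/2" using \<epsilon> by auto
  from quot_class_unitD[OF \<Theta> f this] obtain g h where g: "g \<in> carrier H_infty" "sup_norm g < 1 + \<epsilon>/2"
    and h: "h \<in> carrier H_infty" and eq: "\<And>z. z \<in> unit_disc \<Longrightarrow> f z * g z = 1 + h z * \<Theta> z" by blast
  obtain H where H: "\<And>z. z \<in> unit_disc \<Longrightarrow> cmod (h z) \<le> H" using h unfolding H_infty_carrier_iff by blast
  have H0: "H \<ge> 0" using order_trans[OF norm_ge_zero H[of 0]] by simp
  \<comment> \<open>The shift by \<open>\<epsilon>\<close> keeps the denominator away from 0: its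
    real part is at least \<open>\<epsilon>/2\<close>.\<close>
  define u where "u = (\<lambda>z. of_real \<epsilon> - h z * \<Theta> z)"
  have Re_le: "Re (h z * \<Theta> z) \<le> \<epsilon>/2" if z: "z \<in> unit_disc" for z
  proof -
    have "Re (1 + h z * \<Theta> z) \<le> cmod (f z * g z)" unfolding eq[OF z, symmetric] by (rule complex_Re_le_cmod)
    also have "\<dots> \<le> 1 * cmod (g z)" unfolding norm_mult using aut1[OF z] z by (intro mult_right_mono) (auto simp: f_def)
    also have "\<dots> \<le> 1 + \<epsilon>/2" using cmod_le_sup_norm[OF g(1) z] g(2) by simp
    finally show ?thesis by simp
  qed
  have u_ge: "\<epsilon>/2 \<le> cmod (u z)" if z: "z \<in> unit_disc" for z
  proof -
    have "\<epsilon>/2 \<le> Re (u z)" using Re_le[OF z] by (simp add: u_def)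
    then show ?thesis using complex_Re_le_cmod[of "u z"] by linarith
  qed
  \<comment> \<open>As \<open>Re (h \<Theta>) \<le> \<epsilon>/2\<close>, the value \<open>h \<Theta>\<close> is at least as close to \<open>0\<close> as to \<open>\<epsilon>\<close>.\<close>
  have vu: "cmod (h z * \<Theta> z) \<le> cmod (u z)" if z: "z \<in> unit_disc" for z
  proof (rule power2_le_imp_le)
    have "(cmod (of_real \<epsilon> - v))\<^sup>2 = (cmod v)\<^sup>2 + 2 * \<epsilon> * (\<epsilon>/2 - Re v)" for v
      unfolding cmod_power2 by (simp add: power2_eq_square algebra_simps)
    moreover have "0 \<le> 2 * \<epsilon> * (\<epsilon>/2 - Re (h z * \<Theta> z))" using Re_le[OF z] \<epsilon> by (intro mult_nonneg_nonneg) auto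
    ultimately show "(cmod (h z * \<Theta> z))\<^sup>2 \<le> (cmod (u z))\<^sup>2" unfolding u_def by simp
  qed simp
  have unz: "u z \<noteq> 0" if "z \<in> unit_disc" for z using u_ge[OF that] \<epsilon> by auto
  \<comment> \<open>The inequality \<open>|G| |\<Theta>| \<le> 1\<close> bounds
    \<open>G = h / u\<close> up to the defect \<open>1 - |\<Theta>|\<close>, which is paid for with
    the crude bound \<open>2 * H / \<epsilon>\<close>.\<close>
  have "cmod (h a / u a) \<le> 1"
  proof (rule inner_maximum_principle[OF inner, where B = "2 * H / \<epsilon>" and G = "\<lambda>z. h z / u z"])
    show "(\<lambda>z. h z / u z) holomorphic_on ball 0 1"
      unfolding u_def using h \<Theta>hol unz[unfolded u_def] by (auto intro!: holomorphic_intros simp: H_infty_carrier_iff)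
    fix z :: complex assume z: "z \<in> ball 0 1"
    let ?G = "cmod (h z / u z)" and ?t = "cmod (\<Theta> z)"
    have "?G * ?t \<le> 1" using vu[OF z] unz[OF z] by (simp add: norm_divide norm_mult)
    moreover have "?G \<le> 2 * H / \<epsilon>"
    proof -
      have "?G \<le> H / (\<epsilon>/2)" unfolding norm_divide using H[OF z] u_ge[OF z] \<epsilon> H0 by (intro frac_le) auto
      then show ?thesis by (simp add: mult.commute)
    qed
    then have "?G * (1 - ?t) \<le> 2 * H / \<epsilon> * \<bar>1 - ?t\<bar>"
      by (intro order.trans[OF mult_left_mono[of "1 - ?t" "\<bar>1 - ?t\<bar>"] mult_right_mono]) auto
    ultimately show "?G \<le> 1 + 2 * H / \<epsilon> * \<bar>1 - ?t\<bar>" by (simp add: algebra_simps)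
  qed (use a H0 \<epsilon> in auto)
  then have "cmod (h a) \<le> cmod (u a)" using unz[OF a(1)] by (simp add: norm_divide)
  moreover have "f a = 0" by (simp add: f_def disc_aut_def)
  then have "h a * \<Theta> a = - 1" using eq[OF a(1)] by (simp add: eq_neg_iff_add_eq_0 add.commute)
  moreover from this have "u a = of_real (1 + \<epsilon>)" by (simp add: u_def)
  moreover have "cmod (of_real (1 + \<epsilon>)) = 1 + \<epsilon>" using \<epsilon> unfolding norm_of_real by simp
  ultimately have ha: "cmod (h a) \<le> 1 + \<epsilon>" "cmod (h a) * cmod (\<Theta> a) = 1"
    by (auto simp flip: norm_mult)
  have "pseudohyp_dist a a < R" using R by (simp add: pseudohyp_dist_def)
  then have "cmod (\<Theta> a) < 1 - \<epsilon>" using a by auto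
  moreover have "cmod (h a) * cmod (\<Theta> a) \<le> (1 + \<epsilon>) * cmod (\<Theta> a)" using ha(1) by (intro mult_right_mono) auto
  ultimately have "1 < (1 + \<epsilon>) * (1 - \<epsilon>)" using ha(2) \<epsilon> by (smt (verit) mult_strict_left_mono)
  then show False using \<epsilon> by (simp add: algebra_simps)
qed

text \<open>At each point there are two cases: no zero of \<open>\<Theta>\<close> within distance
  \<open>R\<close>, and then \<open>|\<Theta>|\<close> is near 1 by narrowness, or a nearby zero
  from which Schwarz-Pick transports the lower bound for the normalised representative of
  \<open>f\<close>.\<close>

lemma narrow_imp_SIP:
  assumes inner: "inner_function \<Theta>"
    and nar: "\<And>\<epsilon>::real. 0 < \<epsilon> \<Longrightarrow> \<epsilon> < 1 \<Longrightarrow> narrow {z \<in> unit_disc. 0 < cmod (\<Theta> z) \<and> cmod (\<Theta> z) < 1 - \<epsilon>}"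
  shows "SIP \<Theta>"
  unfolding SIP_def
proof (intro allI impI)
  fix \<epsilon> :: real assume \<epsilon>: "0 < \<epsilon>"
  have \<Theta>: "\<Theta> \<in> carrier H_infty" using inner by (simp add: inner_function_def)
  have \<Theta>hol: "\<Theta> holomorphic_on unit_disc" using \<Theta> by (simp add: H_infty_carrier_iff)
  obtain \<eta> where \<eta>: "\<eta> > 0" and corona: "\<And>f T. corona_data \<eta> f T \<Longrightarrow>
     (\<exists>g h B. g holomorphic_on ball 0 1 \<and> h holomorphic_on ball 0 1 \<and>
        (\<forall>z\<in>ball 0 1. cmod (g z) \<le> 1 + min \<epsilon> 1 \<and> cmod (h z) \<le> B \<and> f z * g z + T z * h z = 1))"
    using sharp_corona[of "min \<epsilon> 1"] \<epsilon> by auto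
  obtain R where R: "0 < R" "R < 1" and near: "\<And>z. z \<in> ball 0 1 \<Longrightarrow> zero_free_disc \<Theta> z R \<Longrightarrow> 1 - \<eta> \<le> cmod (\<Theta> z)"
    using narrow_imp_near_1[OF \<Theta>hol inner_function_le_1[OF inner] nar \<eta>] by blast
  have R2: "0 < 1 - R\<^sup>2" using R by (simp add: power_less_one_iff)
  \<comment> \<open>One \<open>\<delta>\<close> is lost at the zeros and another by dividing by
    \<open>1 + \<delta>\<close>; \<open>schwarz_pick_norm_ge\<close> multiplies the total
    \<open>2 * \<delta>\<close> by \<open>4 / (1 - R^2)\<close>.\<close>
  define \<delta> where "\<delta> = \<eta> * (1 - R\<^sup>2) / 8"
  have \<delta>: "\<delta> > 0" "4 * (2 * \<delta>) / (1 - R\<^sup>2) = \<eta>" using \<eta> R2 by (auto simp: \<delta>_def)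
  show "\<exists>\<delta>>0. \<forall>f \<in> carrier H_infty.
        quot_norm (quot_class \<Theta> f) \<le> 1 \<longrightarrow>
        (zero_set \<Theta> \<noteq> {} \<longrightarrow> (INF z\<in>zero_set \<Theta>. cmod (f z)) \<ge> 1 - \<delta>) \<longrightarrow>
        quot_class \<Theta> f \<in> Units (quot_algebra \<Theta>) \<and>
        quot_norm (inv\<^bsub>quot_algebra \<Theta>\<^esub> (quot_class \<Theta> f)) \<le> 1 + \<epsilon>"
  proof (intro exI[of _ \<delta>] conjI \<delta>(1) ballI impI)
    fix f assume f: "f \<in> carrier H_infty" and n: "quot_norm (quot_class \<Theta> f) \<le> 1"
      and zs: "zero_set \<Theta> \<noteq> {} \<longrightarrow> (INF z\<in>zero_set \<Theta>. cmod (f z)) \<ge> 1 - \<delta>"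
    have "quot_norm (quot_class \<Theta> f) < 1 + \<delta>" using n \<delta> by simp
    then obtain g0 where g0: "g0 \<in> carrier H_infty" "sup_norm (\<lambda>z. g0 z * \<Theta> z + f z) < 1 + \<delta>"
      by (rule quot_norm_lessD)
    \<comment> \<open>A representative of norm below \<open>1 + \<delta>\<close>; it agrees with
      \<open>f\<close> at the zeros of \<open>\<Theta>\<close>.\<close>
    define F where "F = (\<lambda>z. g0 z * \<Theta> z + f z)"
    have F: "F \<in> carrier H_infty"
      using quot_class_subset_carrier[OF \<Theta> f] g0(1) unfolding quot_class_eq F_def by blast
    have Fhol: "F holomorphic_on unit_disc" using F by (simp add: H_infty_carrier_iff)
    have F1: "cmod (F z) < 1 + \<delta>" if "z \<in> unit_disc" for z
      using cmod_le_sup_norm[OF F that] g0(2) by (simp add: F_def)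
    define f1 where "f1 = (\<lambda>z. F z / of_real (1 + \<delta>))"
    have nd: "cmod (of_real (1 + \<delta>)) = 1 + \<delta>" using \<delta> unfolding norm_of_real by simp
    have nz: "complex_of_real (1 + \<delta>) \<noteq> 0" using \<delta>(1) unfolding of_real_eq_0_iff by linarith
    have f1hol: "f1 holomorphic_on ball 0 1" unfolding f1_def
      by (rule holomorphic_on_divide[OF Fhol holomorphic_on_const nz])
    have f1b: "f1 z \<in> ball 0 1" if "z \<in> ball 0 1" for z
    proof -
      have "cmod (f1 z) = cmod (F z) / (1 + \<delta>)" unfolding f1_def norm_divide nd ..
      then show ?thesis using F1[OF that] \<delta>(1) by simp
    qed
    have max: "1 - \<eta> \<le> cmod (f1 z) \<or> 1 - \<eta> \<le> cmod (\<Theta> z)" if z: "z \<in> ball 0 1" for z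
    proof (cases "zero_free_disc \<Theta> z R")
      case True
      then show ?thesis using near[OF z] by blast
    next
      case False
      then obtain w where w: "w \<in> ball 0 1" "pseudohyp_dist w z < R" "\<Theta> w = 0"
        unfolding zero_free_disc_def by blast
      then have wz: "w \<in> zero_set \<Theta>" by (simp add: zero_set_def)
      have "(INF z\<in>zero_set \<Theta>. cmod (f z)) \<le> cmod (f w)"
        by (rule cINF_lower[OF _ wz]) (intro bdd_belowI2[of _ 0], simp)
      then have "1 - \<delta> \<le> cmod (F w)" using zs wz w(3) by (auto simp: F_def)
      moreover have "(1 - 2 * \<delta>) * (1 + \<delta>) \<le> 1 - \<delta>" using \<delta>(1) by (simp add: algebra_simps)
      ultimately have "1 - 2 * \<delta> \<le> cmod (F w) / (1 + \<delta>)" using \<delta>(1) by (simp add: pos_le_divide_eq)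
      then have "1 - 2 * \<delta> \<le> cmod (f1 w)" unfolding f1_def norm_divide nd .
      then have "1 - 4 * (2 * \<delta>) / (1 - R\<^sup>2) \<le> cmod (f1 z)"
        using w(2) pseudohyp_dist_commute[of w z] R by (intro schwarz_pick_norm_ge[OF f1hol f1b z w(1)]) auto
      then show ?thesis unfolding \<delta>(2) by blast
    qed
    have "\<exists>g h B. g holomorphic_on ball 0 1 \<and> h holomorphic_on ball 0 1 \<and>
        (\<forall>z\<in>ball 0 1. cmod (g z) \<le> 1 + min \<epsilon> 1 \<and> cmod (h z) \<le> B \<and> f1 z * g z + \<Theta> z * h z = 1)"
    proof (rule corona)
      have "cmod (f1 z) \<le> 1" if "z \<in> ball 0 1" for z using f1b[OF that] by simp
      then show "corona_data \<eta> f1 \<Theta>"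
        unfolding corona_data_def using f1hol \<Theta>hol max inner_function_le_1[OF inner] by blast
    qed
    then obtain g h B where gh: "g holomorphic_on ball 0 1" "h holomorphic_on ball 0 1"
      "\<And>z. z \<in> ball 0 1 \<Longrightarrow> cmod (g z) \<le> 1 + min \<epsilon> 1" "\<And>z. z \<in> ball 0 1 \<Longrightarrow> cmod (h z) \<le> B"
      "\<And>z. z \<in> ball 0 1 \<Longrightarrow> f1 z * g z + \<Theta> z * h z = 1" by blast
    define G where "G = (\<lambda>z. if z \<in> unit_disc then g z / of_real (1 + \<delta>) else 0)"
    have Gb: "cmod (g z / of_real (1 + \<delta>)) \<le> 1 + \<epsilon>" if "z \<in> unit_disc" for z
    proof -
      have "cmod (g z / of_real (1 + \<delta>)) = cmod (g z) / (1 + \<delta>)" unfolding norm_divide nd ..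
      also have "\<dots> \<le> cmod (g z) / 1" using \<delta>(1) by (intro divide_left_mono) auto
      also have "\<dots> \<le> 1 + \<epsilon>" using gh(3)[OF that] by simp
      finally show ?thesis .
    qed
    have G: "G \<in> carrier H_infty" unfolding G_def
      by (rule H_infty_memI[OF holomorphic_on_divide[OF gh(1) holomorphic_on_const nz] Gb])
    obtain B0 where B0: "\<And>z. z \<in> unit_disc \<Longrightarrow> cmod (g0 z) \<le> B0" using g0(1) unfolding H_infty_carrier_iff by blast
    \<comment> \<open>Solves \<open>f G = 1 + x \<Theta>\<close>, using
      \<open>f = F - g0 \<Theta>\<close> and \<open>F G = f1 g = 1 - \<Theta> h\<close>.\<close>
    define x where "x = (\<lambda>z. if z \<in> unit_disc then - h z - g0 z * G z else 0)"
    have x: "x \<in> carrier H_infty" unfolding x_def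
    proof (rule H_infty_memI)
      show "(\<lambda>z. - h z - g0 z * G z) holomorphic_on unit_disc"
        using gh(2) g0(1) G by (intro holomorphic_intros) (auto simp: H_infty_carrier_iff)
      show "cmod (- h z - g0 z * G z) \<le> B + B0 * (1 + \<epsilon>)" if z: "z \<in> unit_disc" for z
      proof -
        have "cmod (g0 z * G z) \<le> B0 * (1 + \<epsilon>)"
          unfolding norm_mult using B0[OF z] Gb[OF z] z norm_ge_zero[of "g0 z"]
          by (intro mult_mono) (auto simp: G_def simp del: norm_ge_zero intro: order_trans[OF norm_ge_zero])
        then show ?thesis using norm_triangle_ineq4[of "- h z" "g0 z * G z"] gh(4)[OF z] by simp
      qed
    qed
    have eq: "f z * G z = 1 + x z * \<Theta> z" if z: "z \<in> unit_disc" for z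
    proof -
      have "f z * G z = F z * G z - g0 z * \<Theta> z * G z" by (simp add: F_def algebra_simps)
      also have "F z * G z = f1 z * g z" using z by (simp add: G_def f1_def)
      also have "f1 z * g z = 1 - \<Theta> z * h z" using gh(5)[OF z] by (simp add: algebra_simps)
      finally show ?thesis using z by (simp add: x_def algebra_simps)
    qed
    show "quot_class \<Theta> f \<in> Units (quot_algebra \<Theta>)"
      by (rule quot_class_unitI(1)[OF \<Theta> f G x eq])
    have "sup_norm G \<le> 1 + \<epsilon>" by (rule sup_norm_le) (use Gb in \<open>simp add: G_def\<close>)
    then have "quot_norm (quot_class \<Theta> G) \<le> 1 + \<epsilon>" using quot_norm_quot_class_le[OF \<Theta> G] by linarith
    moreover have "inv\<^bsub>quot_algebra \<Theta>\<^esub> (quot_class \<Theta> f) = quot_class \<Theta> G"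
      by (rule quot_class_unitI(2)[OF \<Theta> f G x eq])
    ultimately show "quot_norm (inv\<^bsub>quot_algebra \<Theta>\<^esub> (quot_class \<Theta> f)) \<le> 1 + \<epsilon>" by simp
  qed
qed

theorem theorem1p4:
  fixes \<Theta> :: "complex \<Rightarrow> complex"
  assumes "inner_function \<Theta>"
  shows "SIP \<Theta> \<longleftrightarrow>
    (\<forall>\<epsilon>::real. 0 < \<epsilon> \<and> \<epsilon> < 1 \<longrightarrow>
       narrow {z \<in> unit_disc. 0 < cmod (\<Theta> z) \<and> cmod (\<Theta> z) < 1 - \<epsilon>})"
  using SIP_imp_narrow[OF assms] narrow_imp_SIP[OF assms] by blast

end
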